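(* Let $k\ge 1$ be a fixed integer, $\alpha\in(0,1)$, and let $\tilde{q}^{(n)}\in\mathbb{V}_h(\Sigma)^*$, $\tilde{p}^{(n)}\in V_h(\Sigma)$ be the sequences of the approximate Richardson iteration with recycled and truncated preconditioned conjugate gradient, started from the trivial initial guess $\tilde q^{(0)}=0$, $\tilde p^{(0)}=0$ and given, for all $n\ge 0$, by $$\tilde p^{(n+1)}=\mathrm{PCG}_k(\tilde p^{(n)},\,R^*S\tilde q^{(n)}),\qquad \tilde q^{(n+1)}=((1-\alpha)\mathrm{Id}+\alpha S)\tilde q^{(n)}-2\alpha\, T R\,\tilde p^{(n+1)}+\alpha g .$$ Define $$\rho:=\sup_{q\in\mathbb{V}_h(\Sigma)^*\setminus\{0\}}\frac{\|((1-\alpha)\mathrm{Id}-\alpha\Pi S)q\|_{T^{-1}}}{\|q\|_{T^{-1}}},\qquad \gamma_h:=\inf_{q\in\mathbb{V}_h(\Sigma)^*\setminus\{0\}}\frac{\|(\mathrm{Id}+\Pi S)q\|_{T^{-1}}}{\|q\|_{T^{-1}}},$$ $$\epsilon:=2\left(\frac{\sqrt{\mathrm{cond}(P R^*TR)}-1}{\sqrt{\mathrm{cond}(P R^*TR)}+1}\right)^k .$$ Assume that the number $k$ of PCG iterations is constant (independent of $n$) and chosen sufficiently large to satisfy $$\epsilon<\big(\alpha(1-\alpha)\gamma_h^2/4\big)^2 .$$ Then $\rho+4\sqrt{\epsilon}<1$, and the sequence $\tilde q^{(n)}$ converges toward the solution $q^{(\infty)}$ of $(\mathrm{Id}+\Pi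 S)q^{(\infty)}=g$, with the error estimate $$\|\tilde q^{(n)}-q^{(\infty)}\|_{T^{-1}}\le\frac{\|\tilde q^{(0)}\|_{T^{-1}}}{1-(\rho+4\sqrt{\epsilon})}\,(\rho+4\sqrt{\epsilon})^n .$$
   Context: Geometry and finite element spaces. $\Omega\subset\mathbb{R}^d$ is a bounded polygonal/polyhedral domain, $\kappa>0$ a real constant, $f\in L^2(\partial\Omega)$ complex valued. $\mathcal{T}_h(\Omega)$ is a regular triangulation of $\overline\Omega$, and $V_h(\Omega)\subset H^1(\Omega)$ is the complex space of continuous functions on $\overline\Omega$ whose restriction to each element is a polynomial of degree at most a fixed integer $\geq 1$ (Lagrange finite elements). Let $a(u,v)=\int_\Omega \nabla u\cdot\nabla\overline v-\kappa^2u\overline v\,dx-i\kappa\int_{\partial\Omega}u\overline v\,d\sigma$ and $\ell(v)=\int_{\partial\Omega}f\overline v\,d\sigma$. It is assumed that the discrete problem "find $u_h\in V_h(\Omega)$ with $a(u_h,v_h)=\ell(v_h)$ for all $v_h\in V_h(\Omega)$" is uniquely solvable (i.e. its matrix is invertible). Domain partition. $\overline\Omega=\overline\Omega_1\cup\dots\cup\overline\Omega_J$ with pairwise disjoint polyhedral subdomains $\Omega_j$, each $\overline\Omega_j$ being a union of closed mesh elements; $\Gamma_j=\partial\Omega_j$, $\Sigma=\Gamma_1\cup\dots\cup\Gamma_J$. Set $V_h(\Omega_j)=\{v|_{\Omega_j}:v\in V_h(\Omega)\}$, $V_h(\Gamma_j)=\{v|_{\Gamma_j}:v\in V_h(\Omega)\}$,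 $V_h(\Sigma)=\{v|_\Sigma:v\in V_h(\Omega)\}$, $\mathbb{V}_h(\Omega)=V_h(\Omega_1)\times\dots\times V_h(\Omega_J)$, $\mathbb{V}_h(\Sigma)=V_h(\Gamma_1)\times\dots\times V_h(\Gamma_J)$. A star on a space denotes its dual and $\langle\cdot,\cdot\rangle$ denotes the bilinear duality pairing (no complex conjugation). Operators. $B:\mathbb{V}_h(\Omega)\to\mathbb{V}_h(\Sigma)$, $B(v_1,\dots,v_J)=(v_1|_{\Gamma_1},\dots,v_J|_{\Gamma_J})$; $R:V_h(\Sigma)\to\mathbb{V}_h(\Sigma)$, $R(v)=(v|_{\Gamma_1},\dots,v|_{\Gamma_J})$; $B^*,R^*$ are their adjoints with respect to $\langle\cdot,\cdot\rangle$, mapping between dual spaces. $A:\mathbb{V}_h(\Omega)\to\mathbb{V}_h(\Omega)^*$ and $l\in\mathbb{V}_h(\Omega)^*$ are defined by $$\langle A(u),v\rangle=\sum_{j=1}^J\int_{\Omega_j}\nabla u_j\cdot\nabla v_j-\kappa^2u_jv_j\,dx-i\kappa\int_{\partial\Omega\cap\partial\Omega_j}u_jv_j\,d\sigma,\qquad \langle l,v\rangle=\sum_{j=1}^J\int_{\partial\Omega\cap\partial\Omega_j}f v_j\,d\sigma .$$ $T:\mathbb{V}_h(\Sigma)\to\mathbb{V}_h(\Sigma)^*$ is a given hermitian positive definite linear operator: $\langle T u,\overline v\rangle=\overline{\langle Tv,\overline u\rangle}$ and $\langle Tv,\overline v\rangle>0$ for $v\ne0$. Norms: $\|v\|_T^2=\langle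 Tv,\overline v\rangle$ on $\mathbb{V}_h(\Sigma)$ and $\|q\|_{T^{-1}}^2=\langle T^{-1}q,\overline q\rangle$ on $\mathbb{V}_h(\Sigma)^*$; similarly $\|\eta\|_{R^*TR}^2=\langle R^*TR\,\eta,\overline\eta\rangle$ on $V_h(\Sigma)$. Exchange operator $\Pi:\mathbb{V}_h(\Sigma)^*\to\mathbb{V}_h(\Sigma)^*$, $\Pi=2TR(R^*TR)^{-1}R^*-\mathrm{Id}$. Scattering operator $S:\mathbb{V}_h(\Sigma)^*\to\mathbb{V}_h(\Sigma)^*$ and right-hand side $g\in\mathbb{V}_h(\Sigma)^*$: $S=\mathrm{Id}+2iTB(A-iB^*TB)^{-1}B^*$, $g=2iTB(A-iB^*TB)^{-1}l$. Preconditioned conjugate gradient. $P:V_h(\Sigma)^*\to V_h(\Sigma)$ is a hermitian positive definite linear map (the preconditioner). For $b\in V_h(\Sigma)^*$, $x_0\in V_h(\Sigma)$, put $r_0=Pb-(PR^*TR)x_0$ and $\mathscr{K}_k(x_0,b)=\mathrm{span}\{r_0,(PR^*TR)r_0,\dots,(PR^*TR)^{k-1}r_0\}$. Then $\mathrm{PCG}_k(x_0,b)$ (the result of $k$ steps of PCG started from $x_0$) is the unique minimizer over $\eta\in x_0+\mathscr{K}_k(x_0,b)$ of $\|(R^*TR)^{-1}b-\eta\|_{R^*TR}$. For a linear map $L:V_h(\Sigma)\to V_h(\Sigma)$ with positive real spectrum $\mathfrak{S}(L)$, $\mathrm{cond}(L)=\sup\mathfrak{S}(L)/\inf\mathfr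ak{S}(L)$.
   Formalization: As q̃⁽⁰⁾=0 makes the printed bound 0, ‖q̃⁽¹⁾‖ replaces ‖q̃⁽⁰⁾‖; since ρ+4√ε<1 can fail, it is proved only if ε<(α(1-α)γ_h²/8)²; under the printed hypothesis ρ+2√ε<1 and that rate are proved, and the rate ρ+4√ε whenever ρ+4√ε<1. *)

theory Defs
  imports "HOL-Analysis.Analysis"
begin

section \<open>Spaces of complex functions and their duals\<close>

text \<open>
  Every finite element space below is a set of functions of type 'x \<Rightarrow> complex with
  pointwise operations, and so is its dual.  An element of a space on a set X is represented by
  the function that vanishes outside X; an element of the dual of V by the functional that
  vanishes outside V.  Equality of the representatives is then equality in the space, and
  the bilinear pairing of a functional q with v is just q v.
\<close>

definition restr :: "'x set \<Rightarrow> ('x \<Rightarrow> complex) \<Rightarrow> 'x \<Rightarrow> complex" where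
  "restr X v = (\<lambda>x. if x \<in> X then v x else 0)"

definition linear_map ::
  "('x \<Rightarrow> complex) set \<Rightarrow> ('y \<Rightarrow> complex) set \<Rightarrow> (('x \<Rightarrow> complex) \<Rightarrow> 'y \<Rightarrow> complex) \<Rightarrow> bool" where
  "linear_map V W L \<longleftrightarrow>
     (\<forall>u\<in>V. L u \<in> W) \<and>
     (\<forall>u\<in>V. \<forall>v\<in>V. L (\<lambda>x. u x + v x) = (\<lambda>y. L u y + L v y)) \<and>
     (\<forall>c. \<forall>u\<in>V. L (\<lambda>x. c * u x) = (\<lambda>y. c * L u y))"

definition dual :: "('x \<Rightarrow> complex) set \<Rightarrow> (('x \<Rightarrow> complex) \<Rightarrow> complex) set" where
  "dual V = {q.
     (\<forall>u\<in>V. \<forall>v\<in>V. q (\<lambda>x. u x + v x) = q u + q v) \<and>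
     (\<forall>c. \<forall>u\<in>V. q (\<lambda>x. c * u x) = c * q u) \<and>
     (\<forall>u. u \<notin> V \<longrightarrow> q u = 0)}"

definition adjoint_on ::
  "('x \<Rightarrow> complex) set \<Rightarrow> (('x \<Rightarrow> complex) \<Rightarrow> 'y \<Rightarrow> complex)
    \<Rightarrow> (('y \<Rightarrow> complex) \<Rightarrow> complex) \<Rightarrow> ('x \<Rightarrow> complex) \<Rightarrow> complex" where
  "adjoint_on V L q = restr V (\<lambda>v. q (L v))"

definition conj_fun :: "('x \<Rightarrow> complex) \<Rightarrow> 'x \<Rightarrow> complex" where
  "conj_fun v = (\<lambda>x. cnj (v x))"

definition conj_dual :: "(('x \<Rightarrow> complex) \<Rightarrow> complex) \<Rightarrow> ('x \<Rightarrow> complex) \<Rightarrow> complex" where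
  "conj_dual q = (\<lambda>v. cnj (q (conj_fun v)))"

definition hermitian_posdef ::
  "('x \<Rightarrow> complex) set \<Rightarrow> (('x \<Rightarrow> complex) \<Rightarrow> ('x \<Rightarrow> complex) \<Rightarrow> complex) \<Rightarrow> bool" where
  "hermitian_posdef V T \<longleftrightarrow>
     linear_map V (dual V) T \<and>
     (\<forall>u\<in>V. \<forall>v\<in>V. T u (conj_fun v) = cnj (T v (conj_fun u))) \<and>
     (\<forall>v\<in>V. v \<noteq> (\<lambda>_. 0) \<longrightarrow> Re (T v (conj_fun v)) > 0)"

text \<open>The same notion for maps from the dual back to the space.\<close>

definition hermitian_posdef_dual ::
  "('x \<Rightarrow> complex) set \<Rightarrow> ((('x \<Rightarrow> complex) \<Rightarrow> complex) \<Rightarrow> 'x \<Rightarrow> complex) \<Rightarrow> bool" where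
  "hermitian_posdef_dual V P \<longleftrightarrow>
     linear_map (dual V) V P \<and>
     (\<forall>q\<in>dual V. \<forall>r\<in>dual V. conj_dual r (P q) = cnj (conj_dual q (P r))) \<and>
     (\<forall>q\<in>dual V. q \<noteq> (\<lambda>_. 0) \<longrightarrow> Re (conj_dual q (P q)) > 0)"

definition energy_norm ::
  "(('x \<Rightarrow> complex) \<Rightarrow> ('x \<Rightarrow> complex) \<Rightarrow> complex) \<Rightarrow> ('x \<Rightarrow> complex) \<Rightarrow> real" where
  "energy_norm T v = sqrt (Re (T v (conj_fun v)))"

definition dual_norm ::
  "('x \<Rightarrow> complex) set \<Rightarrow> (('x \<Rightarrow> complex) \<Rightarrow> ('x \<Rightarrow> complex) \<Rightarrow> complex)
    \<Rightarrow> (('x \<Rightarrow> complex) \<Rightarrow> complex) \<Rightarrow> real" where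
  "dual_norm V T q = sqrt (Re (conj_dual q (inv_into V T q)))"

definition spectrum_on ::
  "('x \<Rightarrow> complex) set \<Rightarrow> (('x \<Rightarrow> complex) \<Rightarrow> 'x \<Rightarrow> complex) \<Rightarrow> complex set" where
  "spectrum_on V L = {z. \<not> bij_betw (\<lambda>v x. L v x - z * v x) V V}"

text \<open>Only meaningful if the spectrum consists of positive reals.\<close>

definition cond_on ::
  "('x \<Rightarrow> complex) set \<Rightarrow> (('x \<Rightarrow> complex) \<Rightarrow> 'x \<Rightarrow> complex) \<Rightarrow> real" where
  "cond_on V L = Sup (Re ` spectrum_on V L) / Inf (Re ` spectrum_on V L)"


section \<open>Preconditioned conjugate gradient\<close>

definition krylov ::
  "(('x \<Rightarrow> complex) \<Rightarrow> 'x \<Rightarrow> complex) \<Rightarrow> nat \<Rightarrow> ('x \<Rightarrow> complex) \<Rightarrow> ('x \<Rightarrow> complex) set" where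
  "krylov L k r = {w. \<exists>c :: nat \<Rightarrow> complex. w = (\<lambda>x. \<Sum>i<k. c i * (L ^^ i) r x)}"

text \<open>\<open>k\<close> steps for the system \<open>G \<eta> = b\<close> with preconditioner \<open>P\<close>, started from \<open>x0\<close>.\<close>

definition pcg ::
  "('x \<Rightarrow> complex) set \<Rightarrow> (('x \<Rightarrow> complex) \<Rightarrow> ('x \<Rightarrow> complex) \<Rightarrow> complex)
    \<Rightarrow> ((('x \<Rightarrow> complex) \<Rightarrow> complex) \<Rightarrow> 'x \<Rightarrow> complex)
    \<Rightarrow> nat \<Rightarrow> ('x \<Rightarrow> complex) \<Rightarrow> (('x \<Rightarrow> complex) \<Rightarrow> complex) \<Rightarrow> 'x \<Rightarrow> complex" where
  "pcg V G P k x0 b =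
    (let r0 = (\<lambda>x. P b x - P (G x0) x);
         X = {\<eta>. \<exists>w\<in>krylov (\<lambda>v. P (G v)) k r0. \<eta> = (\<lambda>x. x0 x + w x)};
         err = (\<lambda>\<eta>. energy_norm G (\<lambda>x. inv_into V G b x - \<eta> x))
     in THE \<eta>. \<eta> \<in> X \<and> (\<forall>\<eta>'\<in>X. err \<eta> \<le> err \<eta>'))"


section \<open>Polyhedral meshes and surface integrals\<close>

text \<open>
  The condition \<open>interior (closure U) = U\<close> excludes slits, so that the boundary
  is the union of the mesh facets it contains.
\<close>

definition polyhedral_region :: "'a::euclidean_space set \<Rightarrow> bool" where
  "polyhedral_region U \<longleftrightarrow>
     open U \<and> bounded U \<and> U \<noteq> {} \<and> interior (closure U) = U \<and>
     (\<exists>\<P>. finite \<P> \<and> (\<forall>X\<in>\<P>. polytope X) \<and> closure U = \<Union>\<P>)"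

text \<open>\<open>triangulation\<close> is the usual conformity condition: two elements meet in a common face.\<close>

definition mesh_of :: "'a::euclidean_space set set \<Rightarrow> 'a set \<Rightarrow> bool" where
  "mesh_of \<T> \<Omega> \<longleftrightarrow>
     triangulation \<T> \<and> (\<forall>K\<in>\<T>. int DIM('a) simplex K) \<and> \<Union>\<T> = closure \<Omega>"

text \<open>
  For a unit vector \<open>n\<close>, the area of a subset of the hyperplane \<open>n \<bullet> x = c\<close> is the
  Lebesgue volume of the right prism of height 1 over it.
\<close>

definition hyperplane_measure :: "'a::euclidean_space \<Rightarrow> real \<Rightarrow> 'a measure" where
  "hyperplane_measure n c =
     distr (restrict_space lborel {x. c \<le> n \<bullet> x \<and> n \<bullet> x \<le> c + 1}) borel
       (\<lambda>x. x - (n \<bullet> x - c) *\<^sub>R n)"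

text \<open>The unit normal of a facet is determined up to its sign, which does not affect the measure.\<close>

definition facet_measure :: "'a::euclidean_space set \<Rightarrow> 'a measure" where
  "facet_measure F =
     (let (n, c) = (SOME (n, c). norm n = 1 \<and> F \<subseteq> {x. n \<bullet> x = c})
      in hyperplane_measure n c)"

definition mesh_facets :: "'a::euclidean_space set set \<Rightarrow> 'a set \<Rightarrow> 'a set set" where
  "mesh_facets \<T> E = {F. (\<exists>K\<in>\<T>. F facet_of K) \<and> F \<subseteq> E}"

text \<open>
  Integral with respect to surface measure over a set that is, up to lower dimensional parts,
  a union of mesh facets.
\<close>

definition surface_integral ::
  "'a::euclidean_space set set \<Rightarrow> 'a set \<Rightarrow> ('a \<Rightarrow> complex) \<Rightarrow> complex" where
  "surface_integral \<T> E f =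
     (\<Sum>F\<in>mesh_facets \<T> E. set_lebesgue_integral (facet_measure F) F f)"

definition surface_L2 ::
  "'a::euclidean_space set set \<Rightarrow> 'a set \<Rightarrow> ('a \<Rightarrow> complex) \<Rightarrow> bool" where
  "surface_L2 \<T> E f \<longleftrightarrow>
     (\<forall>F\<in>mesh_facets \<T> E.
        set_borel_measurable (facet_measure F) F f \<and>
        set_integrable (facet_measure F) F (\<lambda>x. (norm (f x))\<^sup>2))"


section \<open>Finite element spaces\<close>

text \<open>Complex polynomials of total degree at most \<open>p\<close>; \<open>m\<close> ranges over the multi-indices.\<close>

definition polys_deg_le :: "nat \<Rightarrow> ('a::euclidean_space \<Rightarrow> complex) set" where
  "polys_deg_le p = {f. \<exists>c. \<forall>x.
     f x = (\<Sum>m | (\<forall>b. b \<notin> Basis \<longrightarrow> m b = 0) \<and> (\<Sum>b\<in>Basis. m b) \<le> p.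
              c m * (\<Prod>b\<in>Basis. complex_of_real (x \<bullet> b) ^ m b))}"

definition Vh :: "'a::euclidean_space set set \<Rightarrow> 'a set \<Rightarrow> nat \<Rightarrow> ('a \<Rightarrow> complex) set" where
  "Vh \<T> \<Omega> p = {v. continuous_on (closure \<Omega>) v \<and> (\<forall>x. x \<notin> closure \<Omega> \<longrightarrow> v x = 0) \<and>
     (\<forall>K\<in>\<T>. \<exists>f\<in>polys_deg_le p. \<forall>x\<in>K. v x = f x)}"

text \<open>
  A partition is a family \<open>D\<close> of subdomains indexed by a finite type.  Elements of the product
  spaces are functions of (subdomain, point).  Functions on an open subdomain are
  represented by their continuous extension to its closure.
\<close>

definition skeleton :: "('i \<Rightarrow> 'a::euclidean_space set) \<Rightarrow> 'a set" where
  "skeleton D = (\<Union>j. frontier (D j))"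

definition Vh_skeleton ::
  "'a::euclidean_space set set \<Rightarrow> 'a set \<Rightarrow> nat \<Rightarrow> ('i \<Rightarrow> 'a set) \<Rightarrow> ('a \<Rightarrow> complex) set" where
  "Vh_skeleton \<T> \<Omega> p D = restr (skeleton D) ` Vh \<T> \<Omega> p"

definition Vh_volumes ::
  "'a::euclidean_space set set \<Rightarrow> 'a set \<Rightarrow> nat \<Rightarrow> ('i \<Rightarrow> 'a set) \<Rightarrow> ('i \<times> 'a \<Rightarrow> complex) set" where
  "Vh_volumes \<T> \<Omega> p D =
     {v. \<forall>j. (\<lambda>x. v (j, x)) \<in> restr (closure (D j)) ` Vh \<T> \<Omega> p}"

definition Vh_traces ::
  "'a::euclidean_space set set \<Rightarrow> 'a set \<Rightarrow> nat \<Rightarrow> ('i \<Rightarrow> 'a set) \<Rightarrow> ('i \<times> 'a \<Rightarrow> complex) set" where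
  "Vh_traces \<T> \<Omega> p D =
     {v. \<forall>j. (\<lambda>x. v (j, x)) \<in> restr (frontier (D j)) ` Vh \<T> \<Omega> p}"

definition trace_op ::
  "('i \<Rightarrow> 'a::euclidean_space set) \<Rightarrow> ('i \<times> 'a \<Rightarrow> complex) \<Rightarrow> 'i \<times> 'a \<Rightarrow> complex" where
  "trace_op D v = (\<lambda>(j, x). if x \<in> frontier (D j) then v (j, x) else 0)"

definition restriction_op ::
  "('i \<Rightarrow> 'a::euclidean_space set) \<Rightarrow> ('a \<Rightarrow> complex) \<Rightarrow> 'i \<times> 'a \<Rightarrow> complex" where
  "restriction_op D v = (\<lambda>(j, x). if x \<in> frontier (D j) then v x else 0)"


section \<open>Helmholtz forms\<close>

text \<open>
  Piecewise polynomials are differentiable off the mesh facets, so the gradient is a classical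
  one almost everywhere.
\<close>

definition grad_dot ::
  "('a::euclidean_space \<Rightarrow> complex) \<Rightarrow> ('a \<Rightarrow> complex) \<Rightarrow> 'a \<Rightarrow> complex" where
  "grad_dot u v x =
     (\<Sum>b\<in>Basis. frechet_derivative u (at x) b * frechet_derivative v (at x) b)"

text \<open>Bilinear form with volume terms on \<open>U\<close> and boundary term on \<open>E\<close>.\<close>

definition helmholtz_form ::
  "'a::euclidean_space set set \<Rightarrow> real \<Rightarrow> 'a set \<Rightarrow> 'a set
    \<Rightarrow> ('a \<Rightarrow> complex) \<Rightarrow> ('a \<Rightarrow> complex) \<Rightarrow> complex" where
  "helmholtz_form \<T> \<kappa> U E u v =
     set_lebesgue_integral lebesgue U
       (\<lambda>x. grad_dot u v x - complex_of_real (\<kappa>\<^sup>2) * u x * v x)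
     - \<i> * complex_of_real \<kappa> * surface_integral \<T> E (\<lambda>x. u x * v x)"

definition discrete_solution ::
  "'a::euclidean_space set set \<Rightarrow> real \<Rightarrow> 'a set \<Rightarrow> nat \<Rightarrow> ('a \<Rightarrow> complex) \<Rightarrow> ('a \<Rightarrow> complex) \<Rightarrow> bool"
where
  "discrete_solution \<T> \<kappa> \<Omega> p f u \<longleftrightarrow>
     u \<in> Vh \<T> \<Omega> p \<and>
     (\<forall>v\<in>Vh \<T> \<Omega> p.
        helmholtz_form \<T> \<kappa> \<Omega> (frontier \<Omega>) u (conj_fun v)
        = surface_integral \<T> (frontier \<Omega>) (\<lambda>x. f x * conj_fun v x))"

definition local_operator ::
  "'a::euclidean_space set set \<Rightarrow> real \<Rightarrow> 'a set \<Rightarrow> nat \<Rightarrow> ('i::finite \<Rightarrow> 'a set)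
    \<Rightarrow> ('i \<times> 'a \<Rightarrow> complex) \<Rightarrow> ('i \<times> 'a \<Rightarrow> complex) \<Rightarrow> complex" where
  "local_operator \<T> \<kappa> \<Omega> p D u = restr (Vh_volumes \<T> \<Omega> p D)
     (\<lambda>v. \<Sum>j\<in>UNIV. helmholtz_form \<T> \<kappa> (D j) (frontier \<Omega> \<inter> frontier (D j))
                      (\<lambda>x. u (j, x)) (\<lambda>x. v (j, x)))"

definition local_load ::
  "'a::euclidean_space set set \<Rightarrow> 'a set \<Rightarrow> nat \<Rightarrow> ('i::finite \<Rightarrow> 'a set) \<Rightarrow> ('a \<Rightarrow> complex)
    \<Rightarrow> ('i \<times> 'a \<Rightarrow> complex) \<Rightarrow> complex" where
  "local_load \<T> \<Omega> p D f = restr (Vh_volumes \<T> \<Omega> p D)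
     (\<lambda>v. \<Sum>j\<in>UNIV. surface_integral \<T> (frontier \<Omega> \<inter> frontier (D j)) (\<lambda>x. f x * v (j, x)))"

end

theory Submission
  imports Defs "HOL-Library.Function_Algebras"
begin

text \<open>
  Identify the dual of the trace space with the trace space itself by \<open>T\<close>, so that the dual norm
  becomes the norm of an inner product.  Then the exchange operator is a reflection: \<open>Pex\<close> equals
  \<open>2 Q - 1\<close> for the orthogonal projection \<open>Q\<close> onto the traces that are single valued on the skeleton
  (\<open>exchange_isometry\<close>).  The scattering operator is nonexpansive, because the imaginary part of the
  local Helmholtz form is not positive (\<open>scatter_contraction\<close>).  Hence their product \<open>K\<close> is
  nonexpansive, and the identity
  \<open>|(1-\<alpha>) u - \<alpha> K u|\<^sup>2 = (1-\<alpha>) |u|\<^sup>2 + \<alpha> |K u|\<^sup>2 - \<alpha> (1-\<alpha>) |u + K u|\<^sup>2\<close>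
  gives \<open>\<rho>\<^sup>2 \<le> 1 - \<alpha> (1-\<alpha>) \<gamma>\<^sup>2\<close>, in particular \<open>\<rho> \<le> 1 - \<alpha> (1-\<alpha>) \<gamma>\<^sup>2 / 2\<close>.

  The inexact iteration differs from the exact one by the error \<open>d\<close> of the inner solver.  Conjugate
  gradients reduce their initial error by the factor \<open>\<epsilon>\<close> (\<open>pcg_error_bound\<close>), and since the solver
  is restarted from its last result, this initial error is at most the previous inner error plus the
  last update \<open>\<delta>\<close> of the outer iteration.  Thus
  \<open>|\<delta>'| \<le> \<rho> |\<delta>| + 2 \<alpha> (|d'| + |d|)\<close> and \<open>|d'| \<le> \<epsilon> (|d| + |\<delta>|)\<close>.
  In a norm that weights \<open>d\<close> by a multiple of \<open>1 / sqrt \<epsilon>\<close> this coupled recursion contracts with the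
  rate \<open>\<rho> + 2 sqrt \<epsilon>\<close> (\<open>recycled_recursion\<close>, \<open>recycled_Richardson\<close>).

  Everything takes place in finite dimensional spaces of functions.  The condition number enters
  through the bounds of the Rayleigh quotient, which are eigenvalues (\<open>cond_on_Rayleigh\<close>); the
  Chebyshev bound for conjugate gradients is obtained from the Pell identity for Chebyshev polynomials
  instead of a diagonalisation (\<open>krylov_Chebyshev\<close>).

  The discrete Helmholtz problem enters only through the hypotheses of the locale
  \<open>domain_decomposition\<close>.  They require that integrals of piecewise polynomials over subdomains and
  mesh facets are linear in the integrand, that the impedance boundary term dissipates, and that a
  local solution without traces vanishes.  The
  latter is the unique solvability of the global problem, applied to the function glued from the local
  ones (\<open>trace_free_solution\<close>).
\<close>

section \<open>Finite dimensional spaces of complex functions\<close>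

definition cscale :: "complex \<Rightarrow> ('x \<Rightarrow> complex) \<Rightarrow> 'x \<Rightarrow> complex" (infixr "*\<^sub>c" 75)
  where "c *\<^sub>c v = (\<lambda>x. c * v x)"

lemma cscale_apply: "(c *\<^sub>c v) x = c * v x"
  by (simp add: cscale_def)

lemmas pointwise = cscale_apply plus_fun_apply minus_apply zero_fun_apply

text \<open>Functions are treated as vectors; evaluation at a point happens only on request, because
  it would destroy the vector space form of nearly every term below.\<close>

declare plus_fun_apply [simp del] minus_apply [simp del] zero_fun_apply [simp del]

interpretation fun_vs: vector_space cscale
  by unfold_locales (auto simp: fun_eq_iff pointwise algebra_simps)

lemma linear_map_iff:
  "linear_map V W L \<longleftrightarrow> (\<forall>u\<in>V. L u \<in> W) \<and> (\<forall>u\<in>V. \<forall>v\<in>V. L (u + v) = L u + L v) \<and>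
     (\<forall>c. \<forall>u\<in>V. L (c *\<^sub>c u) = c *\<^sub>c L u)"
  by (simp add: linear_map_def plus_fun_def cscale_def)

lemma linear_map_in: "linear_map V W L \<Longrightarrow> u \<in> V \<Longrightarrow> L u \<in> W"
  and linear_map_add: "linear_map V W L \<Longrightarrow> u \<in> V \<Longrightarrow> v \<in> V \<Longrightarrow> L (u + v) = L u + L v"
  and linear_map_scale: "linear_map V W L \<Longrightarrow> u \<in> V \<Longrightarrow> L (c *\<^sub>c u) = c *\<^sub>c L u"
  by (auto simp: linear_map_iff)

lemma linear_map_zero:
  assumes "linear_map V W L" "fun_vs.subspace V"
  shows "L 0 = 0"
  using linear_map_scale[OF assms(1) fun_vs.subspace_0[OF assms(2)], of 0] by simp

lemma linear_map_diff:
  assumes "linear_map V W L" "fun_vs.subspace V" "u \<in> V" "v \<in> V"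
  shows "L (u - v) = L u - L v"
proof -
  have "L ((u - v) + v) = L (u - v) + L v"
    using assms by (intro linear_map_add[OF assms(1)]) (auto intro: fun_vs.subspace_diff)
  then show ?thesis by (simp add: algebra_simps)
qed

lemma linear_map_comp:
  assumes "linear_map U V K" "linear_map V W L"
  shows "linear_map U W (\<lambda>u. L (K u))"
  using assms by (auto simp: linear_map_iff)

lemma linear_map_combine:
  assumes "linear_map V W K" "linear_map V W L" "fun_vs.subspace W"
  shows "linear_map V W (\<lambda>u. a *\<^sub>c K u + b *\<^sub>c L u)"
  using assms by (auto simp: linear_map_iff fun_vs.scale_right_distrib fun_vs.scale_scale mult.commute
      intro!: fun_vs.subspace_add fun_vs.subspace_scale)

lemma linear_map_id: "linear_map V V (\<lambda>u. u)"
  by (simp add: linear_map_iff)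

lemma linear_map_inj_onI:
  assumes L: "linear_map V W L" and V: "fun_vs.subspace V"
    and ker: "\<And>v. v \<in> V \<Longrightarrow> L v = 0 \<Longrightarrow> v = 0"
  shows "inj_on L V"
proof (rule inj_onI)
  fix u v assume uv: "u \<in> V" "v \<in> V" "L u = L v"
  then have "L (u - v) = 0" by (simp add: linear_map_diff[OF L V])
  then have "u - v = 0" using ker uv fun_vs.subspace_diff[OF V] by blast
  then show "u = v" by simp
qed

lemma linear_map_inv_into:
  assumes L: "linear_map V W L" and V: "fun_vs.subspace V" and W: "fun_vs.subspace W"
    and bij: "bij_betw L V W"
  shows "linear_map W V (inv_into V L)"
proof -
  have inV: "inv_into V L w \<in> V" and LV: "L (inv_into V L w) = w" if "w \<in> W" for w
    using bij that by (auto simp: bij_betw_def inv_into_into f_inv_into_f)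
  have eq: "inv_into V L (L v) = v" if "v \<in> V" for v
    using bij that by (simp add: bij_betw_def)
  show ?thesis
    unfolding linear_map_iff
  proof (intro conjI ballI allI)
    fix u v assume uv: "u \<in> W" "v \<in> W"
    have "L (inv_into V L u + inv_into V L v) = u + v"
      using uv by (simp add: linear_map_add[OF L] inV LV)
    then show "inv_into V L (u + v) = inv_into V L u + inv_into V L v"
      using eq[of "inv_into V L u + inv_into V L v"] uv by (simp add: fun_vs.subspace_add[OF V] inV)
  next
    fix c u assume u: "u \<in> W"
    have "L (c *\<^sub>c inv_into V L u) = c *\<^sub>c u"
      using u by (simp add: linear_map_scale[OF L] inV LV)
    then show "inv_into V L (c *\<^sub>c u) = c *\<^sub>c inv_into V L u"
      using eq[of "c *\<^sub>c inv_into V L u"] u by (simp add: fun_vs.subspace_scale[OF V] inV)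
  qed (use inV in auto)
qed

definition fin_dim :: "('x \<Rightarrow> complex) set \<Rightarrow> bool" where
  "fin_dim V \<longleftrightarrow> fun_vs.subspace V \<and> (\<exists>C. finite C \<and> V \<subseteq> fun_vs.span C)"

lemma fin_dim_subspace: "fin_dim V \<Longrightarrow> fun_vs.subspace V"
  by (simp add: fin_dim_def)

lemma fin_dim_basis:
  assumes "fin_dim V"
  obtains B where "finite B" "B \<subseteq> V" "\<not> fun_vs.dependent B" "fun_vs.span B = V"
proof -
  obtain C where C: "finite C" "V \<subseteq> fun_vs.span C" using assms by (auto simp: fin_dim_def)
  obtain B where B: "B \<subseteq> V" "\<not> fun_vs.dependent B" "V \<subseteq> fun_vs.span B"
    using fun_vs.maximal_independent_subset by blast
  have "finite B"
    using fun_vs.independent_span_bound[OF C(1) B(2)] B(1) C(2) by blast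
  moreover have "fun_vs.span B = V"
    using B(1,3) fun_vs.span_minimal[OF B(1) fin_dim_subspace[OF assms]] by blast
  ultimately show thesis using that B by blast
qed

text \<open>An injective linear image of a basis is independent, and an independent set that is as
  large as a spanning set spans.\<close>

lemma linear_map_onto_if_inj:
  fixes L :: "('x \<Rightarrow> complex) \<Rightarrow> 'y \<Rightarrow> complex"
  assumes B: "finite B" "\<not> fun_vs.dependent B" "fun_vs.span B = V"
    and C: "finite C" "W \<subseteq> fun_vs.span C" "card C \<le> card B"
    and L: "linear_map V W L" and inj: "inj_on L V"
  shows "L ` V = W"
proof
  show "L ` V \<subseteq> W" using linear_map_in[OF L] by blast
next
  interpret p: vector_space_pair "cscale :: complex \<Rightarrow> ('x \<Rightarrow> complex) \<Rightarrow> _"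
      "cscale :: complex \<Rightarrow> ('y \<Rightarrow> complex) \<Rightarrow> _" ..
  have BV: "B \<subseteq> V" using B(3) fun_vs.span_superset by blast
  have V: "fun_vs.subspace V" using B(3) fun_vs.subspace_span by blast
  define F where "F = p.construct B L"
  have F: "Vector_Spaces.linear cscale cscale F"
    unfolding F_def by (rule p.linear_construct[OF B(2)])
  have "v \<in> V \<and> F v = L v" if "v \<in> fun_vs.span B" for v
    using that
  proof (induction rule: fun_vs.span_induct_alt)
    case base
    show ?case using linear_map_zero[OF L V] p.linear_0[OF F] fun_vs.subspace_0[OF V] by metis
  next
    case (step c x y)
    have xy: "x \<in> V" "y \<in> V" "c *\<^sub>c x \<in> V"
      using step BV fun_vs.subspace_scale[OF V] by auto
    have "F x = L x"
      unfolding F_def using step(1) by (rule p.construct_basis[OF B(2)])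
    then show ?case
      using step xy by (simp add: p.linear_add[OF F] p.linear_scale[OF F] linear_map_add[OF L] linear_map_scale[OF L]
          fun_vs.subspace_add[OF V])
  qed
  then have FL: "F v = L v" if "v \<in> V" for v using that B(3) by blast
  have injF: "inj_on F (fun_vs.span B)" using inj FL B(3) by (simp add: inj_on_def)
  have ind: "\<not> fun_vs.dependent (F ` B)"
    by (rule p.linear_independent_injective_image[OF F B(2) injF])
  have "card (F ` B) = card B"
    using injF fun_vs.span_superset by (intro card_image) (blast intro: inj_on_subset)
  moreover have sub: "F ` B \<subseteq> W" using FL linear_map_in[OF L] BV by auto
  then have FC: "F ` B \<subseteq> fun_vs.span C" using C by blast
  obtain S where S: "F ` B \<subseteq> S" "S \<subseteq> fun_vs.span C" "\<not> fun_vs.dependent S" "fun_vs.span C \<subseteq> fun_vs.span S"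
    using fun_vs.maximal_independent_subset_extend[OF FC ind] by blast
  have "finite S \<and> card S \<le> card C" by (rule fun_vs.independent_span_bound[OF C(1) S(3,2)])
  ultimately have "S = F ` B"
    using card_seteq[of S "F ` B"] S(1) C(3) by simp
  then have "W \<subseteq> fun_vs.span (F ` B)" using S(4) C(2) by blast
  also have "\<dots> = F ` V" using p.linear_span_image[OF F] B(3) by simp
  finally show "W \<subseteq> L ` V" using FL by auto
qed

lemma linear_endo_bij:
  assumes V: "fin_dim V" and L: "linear_map V V L"
    and ker: "\<And>v. v \<in> V \<Longrightarrow> L v = 0 \<Longrightarrow> v = 0"
  shows "bij_betw L V V"
proof -
  obtain B where B: "finite B" "B \<subseteq> V" "\<not> fun_vs.dependent B" "fun_vs.span B = V"
    using fin_dim_basis[OF V] by blast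
  have inj: "inj_on L V" by (rule linear_map_inj_onI[OF L fin_dim_subspace[OF V] ker])
  show ?thesis
    using linear_map_onto_if_inj[OF B(1,3,4) B(1) _ _ L inj] B(4) inj by (auto simp: bij_betw_def)
qed

lemma dual_iff:
  "q \<in> dual V \<longleftrightarrow> (\<forall>u\<in>V. \<forall>v\<in>V. q (u + v) = q u + q v) \<and>
     (\<forall>c. \<forall>u\<in>V. q (c *\<^sub>c u) = c * q u) \<and> (\<forall>u. u \<notin> V \<longrightarrow> q u = 0)"
  by (simp add: dual_def plus_fun_def cscale_def)

lemma dual_add: "q \<in> dual V \<Longrightarrow> u \<in> V \<Longrightarrow> v \<in> V \<Longrightarrow> q (u + v) = q u + q v"
  and dual_scale: "q \<in> dual V \<Longrightarrow> u \<in> V \<Longrightarrow> q (c *\<^sub>c u) = c * q u"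
  and dual_outside: "q \<in> dual V \<Longrightarrow> u \<notin> V \<Longrightarrow> q u = 0"
  by (auto simp: dual_iff)

lemma subspace_dual: "fun_vs.subspace (dual V)"
  unfolding fun_vs.subspace_def by (auto simp: dual_iff pointwise algebra_simps)

lemma dual_eqI:
  assumes "q \<in> dual V" "r \<in> dual V" "\<And>v. v \<in> V \<Longrightarrow> q v = r v"
  shows "q = r"
  using assms dual_outside[OF assms(1)] dual_outside[OF assms(2)] by (metis ext)

text \<open>The coordinate functionals of a basis of \<open>V\<close> span the dual, so the dual is not larger than
  the space.\<close>

lemma linear_to_dual_bij:
  assumes V: "fin_dim V" and L: "linear_map V (dual V) L"
    and ker: "\<And>v. v \<in> V \<Longrightarrow> L v = 0 \<Longrightarrow> v = 0"
  shows "bij_betw L V (dual V)"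
proof -
  obtain B where B: "finite B" "B \<subseteq> V" "\<not> fun_vs.dependent B" "fun_vs.span B = V"
    using fin_dim_basis[OF V] by blast
  have inj: "inj_on L V" by (rule linear_map_inj_onI[OF L fin_dim_subspace[OF V] ker])
  define \<phi> where "\<phi> b = restr V (\<lambda>v. fun_vs.representation B v b)" for b
  have \<phi>: "\<phi> b \<in> dual V" for b
    using fun_vs.representation_add[OF B(3)] fun_vs.representation_scale[OF B(3)] B(4)
      fun_vs.subspace_add[OF fin_dim_subspace[OF V]] fun_vs.subspace_scale[OF fin_dim_subspace[OF V]]
    by (auto simp: \<phi>_def dual_iff restr_def)
  have span: "dual V \<subseteq> fun_vs.span (\<phi> ` B)"
  proof
    fix q assume q: "q \<in> dual V"
    have sumq: "q (\<Sum>b\<in>S. f b *\<^sub>c b) = (\<Sum>b\<in>S. f b * q b)" if "S \<subseteq> B" for f S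
    proof -
      have "finite S" using that B(1) finite_subset by blast
      then show ?thesis using that
      proof induction
        case empty
        have "q 0 = 0" using dual_scale[OF q fun_vs.subspace_0[OF fin_dim_subspace[OF V]], of 0] by simp
        then show ?case by (simp only: sum.empty)
      next
        case (insert a S)
        have "(\<Sum>b\<in>S. f b *\<^sub>c b) \<in> V"
          using B(2) insert.prems fin_dim_subspace[OF V]
          by (intro fun_vs.subspace_sum fun_vs.subspace_scale) auto
        moreover have "a \<in> V" using insert.prems B(2) by auto
        ultimately show ?case
          using insert by (simp add: dual_add[OF q] dual_scale[OF q] fun_vs.subspace_scale[OF fin_dim_subspace[OF V]])
      qed
    qed
    have "q = (\<Sum>b\<in>B. q b *\<^sub>c \<phi> b)"
    proof (rule dual_eqI[OF q])
      show "(\<Sum>b\<in>B. q b *\<^sub>c \<phi> b) \<in> dual V"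
        using \<phi> by (intro fun_vs.subspace_sum[OF subspace_dual] fun_vs.subspace_scale[OF subspace_dual])
    next
      fix v assume v: "v \<in> V"
      have "v = (\<Sum>b\<in>B. fun_vs.representation B v b *\<^sub>c b)"
        using fun_vs.sum_representation_eq[OF B(3) _ B(1) order_refl, of v] v B(4) by simp
      then have "q v = (\<Sum>b\<in>B. fun_vs.representation B v b * q b)"
        using sumq[of B "fun_vs.representation B v"] by simp
      also have "\<dots> = (\<Sum>b\<in>B. (q b *\<^sub>c \<phi> b) v)"
        using v by (intro sum.cong) (auto simp: \<phi>_def restr_def pointwise)
      also have "\<dots> = (\<Sum>b\<in>B. q b *\<^sub>c \<phi> b) v"
        using B(1) by (induction B) (auto simp: pointwise)
      finally show "q v = (\<Sum>b\<in>B. q b *\<^sub>c \<phi> b) v" .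
    qed
    then show "q \<in> fun_vs.span (\<phi> ` B)"
      by (metis (no_types, lifting) fun_vs.span_sum fun_vs.span_scale fun_vs.span_base imageI)
  qed
  show ?thesis
    using linear_map_onto_if_inj[OF B(1,3,4) _ span _ L inj] B(1) inj
    by (auto simp: bij_betw_def card_image_le)
qed

section \<open>Hermitian forms\<close>

text \<open>Semidefinite forms are kept apart from inner products because the decisive use of the
  Cauchy-Schwarz inequality, in \<open>selfadjoint_psd_kernel\<close>, is for a form that is not yet known to be
  definite.\<close>

locale psd_form =
  fixes V :: "('x \<Rightarrow> complex) set" and ip :: "('x \<Rightarrow> complex) \<Rightarrow> ('x \<Rightarrow> complex) \<Rightarrow> complex"
  assumes subspace: "fun_vs.subspace V"
    and ip_add_left: "\<lbrakk>u \<in> V; v \<in> V; w \<in> V\<rbrakk> \<Longrightarrow> ip (u + v) w = ip u w + ip v w"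
    and ip_scale_left: "\<lbrakk>u \<in> V; w \<in> V\<rbrakk> \<Longrightarrow> ip (c *\<^sub>c u) w = c * ip u w"
    and ip_herm: "\<lbrakk>u \<in> V; v \<in> V\<rbrakk> \<Longrightarrow> ip v u = cnj (ip u v)"
    and ip_nonneg: "v \<in> V \<Longrightarrow> 0 \<le> Re (ip v v)"
begin

lemma closed [simp]:
  "0 \<in> V" "u \<in> V \<Longrightarrow> v \<in> V \<Longrightarrow> u + v \<in> V" "u \<in> V \<Longrightarrow> v \<in> V \<Longrightarrow> u - v \<in> V"
  "u \<in> V \<Longrightarrow> c *\<^sub>c u \<in> V"
  using subspace
  by (auto intro: fun_vs.subspace_0 fun_vs.subspace_add fun_vs.subspace_diff fun_vs.subspace_scale)

lemma ip_add_right: "\<lbrakk>u \<in> V; v \<in> V; w \<in> V\<rbrakk> \<Longrightarrow> ip w (u + v) = ip w u + ip w v"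
  using ip_herm[of "u + v" w] ip_herm[of u w] ip_herm[of v w] by (simp add: ip_add_left)

lemma ip_scale_right: "\<lbrakk>u \<in> V; w \<in> V\<rbrakk> \<Longrightarrow> ip w (c *\<^sub>c u) = cnj c * ip w u"
  using ip_herm[of "c *\<^sub>c u" w] ip_herm[of u w] by (simp add: ip_scale_left)

lemma ip_diff_left: "\<lbrakk>u \<in> V; v \<in> V; w \<in> V\<rbrakk> \<Longrightarrow> ip (u - v) w = ip u w - ip v w"
  using ip_add_left[of "u - v" v w] by simp

lemma ip_diff_right: "\<lbrakk>u \<in> V; v \<in> V; w \<in> V\<rbrakk> \<Longrightarrow> ip w (u - v) = ip w u - ip w v"
  using ip_add_right[of "u - v" v w] by simp

lemmas ip_expand = ip_add_left ip_add_right ip_diff_left ip_diff_right ip_scale_left ip_scale_right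

lemma ip_zero_left: "w \<in> V \<Longrightarrow> ip 0 w = 0"
  using ip_scale_left[of 0 w 0] by simp

lemma ip_zero_right: "w \<in> V \<Longrightarrow> ip w 0 = 0"
  using ip_scale_right[of 0 w 0] by simp

lemma Im_ip_self: "v \<in> V \<Longrightarrow> Im (ip v v) = 0"
  using arg_cong[OF ip_herm[of v v], of Im] by simp

lemma Re_ip_commute: "\<lbrakk>u \<in> V; v \<in> V\<rbrakk> \<Longrightarrow> Re (ip v u) = Re (ip u v)"
  using ip_herm[of u v] by simp

lemma ip_sum_left:
  assumes "finite S" "\<And>b. b \<in> S \<Longrightarrow> f b \<in> V" "w \<in> V"
  shows "ip (\<Sum>b\<in>S. f b) w = (\<Sum>b\<in>S. ip (f b) w)"
  using assms(1,2)
proof induction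
  case empty
  show ?case using ip_zero_left[OF assms(3)] by simp
next
  case (insert a S)
  have "(\<Sum>b\<in>S. f b) \<in> V" using insert by (intro fun_vs.subspace_sum[OF subspace]) auto
  then show ?case using insert assms(3) by (simp add: ip_add_left)
qed

definition nrm :: "('x \<Rightarrow> complex) \<Rightarrow> real" where "nrm v = sqrt (Re (ip v v))"

lemma nrm_sq: "v \<in> V \<Longrightarrow> (nrm v)\<^sup>2 = Re (ip v v)"
  by (simp add: nrm_def ip_nonneg)

lemma nrm_nonneg: "v \<in> V \<Longrightarrow> 0 \<le> nrm v"
  by (simp add: nrm_def ip_nonneg)

lemma Re_ip_add:
  "\<lbrakk>u \<in> V; v \<in> V\<rbrakk> \<Longrightarrow> Re (ip (u + v) (u + v)) = Re (ip u u) + 2 * Re (ip u v) + Re (ip v v)"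
  using Re_ip_commute[of u v] by (simp add: ip_expand)

lemma Re_ip_diff:
  "\<lbrakk>u \<in> V; v \<in> V\<rbrakk> \<Longrightarrow> Re (ip (u - v) (u - v)) = Re (ip u u) - 2 * Re (ip u v) + Re (ip v v)"
  using Re_ip_commute[of u v] by (simp add: ip_expand)

lemma Re_ip_scale: "u \<in> V \<Longrightarrow> Re (ip (c *\<^sub>c u) (c *\<^sub>c u)) = (cmod c)\<^sup>2 * Re (ip u u)"
  using Im_ip_self[of u] by (simp add: ip_expand cmod_power2 algebra_simps) (simp add: power2_eq_square)

lemma nrm_scale: "u \<in> V \<Longrightarrow> nrm (c *\<^sub>c u) = cmod c * nrm u"
  by (simp add: nrm_def Re_ip_scale real_sqrt_mult)

text \<open>Subtracting \<open>t (ip u v) v\<close> from \<open>u\<close> gives a quadratic polynomial in the real variable \<open>t\<close>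
  that is nonnegative everywhere.  If \<open>v\<close> is a null vector, the polynomial is affine, hence
  constant.\<close>

lemma Cauchy_Schwarz:
  assumes u: "u \<in> V" and v: "v \<in> V"
  shows "(cmod (ip u v))\<^sup>2 \<le> Re (ip u u) * Re (ip v v)"
proof -
  define a b s where "a = Re (ip u u)" and "b = Re (ip v v)" and "s = (cmod (ip u v))\<^sup>2"
  have quad: "0 \<le> a - 2 * t * s + t\<^sup>2 * s * b" for t :: real
  proof -
    \<comment> \<open>the phase of \<open>ip u v\<close> in the coefficient makes the mixed term real\<close>
    define c where "c = complex_of_real t * ip u v"
    have "complex_of_real s = ip u v * cnj (ip u v)"
      unfolding s_def by (rule complex_norm_square)
    then have cs: "cnj c * ip u v = complex_of_real (t * s)"
      by (simp add: c_def mult.commute)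
    have "0 \<le> Re (ip (u - c *\<^sub>c v) (u - c *\<^sub>c v))" using u v by (intro ip_nonneg) simp
    also have "\<dots> = a - 2 * Re (cnj c * ip u v) + (cmod c)\<^sup>2 * b"
      using Re_ip_diff[OF u closed(4)[OF v], of c] Re_ip_scale[OF v, of c] ip_scale_right[OF v u, of c]
      by (simp only: a_def b_def)
    also have "\<dots> = a - 2 * t * s + t\<^sup>2 * s * b"
      unfolding cs by (simp add: c_def s_def norm_mult power_mult_distrib)
    finally show ?thesis .
  qed
  have s0: "0 \<le> s" by (simp add: s_def)
  have b0: "0 \<le> b" using v by (simp add: b_def ip_nonneg)
  have "s \<le> a * b"
  proof (cases "b = 0")
    case True
    have "s = 0"
    proof (rule ccontr)
      assume "s \<noteq> 0"
      then have "a - 2 * ((a + 1) / (2 * s)) * s = -1" by (simp add: field_simps)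
      then show False using quad[of "(a + 1) / (2 * s)"] True by simp
    qed
    then show ?thesis using True by simp
  next
    case False
    have "0 \<le> a - s / b"
      using quad[of "1 / b"] False by (simp add: power2_eq_square field_simps)
    then show ?thesis using False b0 by (simp add: field_simps)
  qed
  then show ?thesis by (simp add: a_def b_def s_def)
qed

lemma cmod_ip_le:
  assumes "u \<in> V" and "v \<in> V"
  shows "cmod (ip u v) \<le> nrm u * nrm v"
proof (rule power2_le_imp_le)
  show "(cmod (ip u v))\<^sup>2 \<le> (nrm u * nrm v)\<^sup>2"
    using Cauchy_Schwarz[OF assms] assms by (simp add: nrm_sq power_mult_distrib)
qed (use assms in \<open>simp add: nrm_nonneg\<close>)

lemma nrm_triangle:
  assumes u: "u \<in> V" and v: "v \<in> V"
  shows "nrm (u + v) \<le> nrm u + nrm v"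
proof (rule power2_le_imp_le)
  have "Re (ip u v) \<le> nrm u * nrm v"
    using cmod_ip_le[OF u v] complex_Re_le_cmod order_trans by blast
  then show "(nrm (u + v))\<^sup>2 \<le> (nrm u + nrm v)\<^sup>2"
    using u v by (simp add: nrm_sq Re_ip_add power2_sum)
qed (use u v in \<open>simp add: nrm_nonneg\<close>)

lemma nrm_triangle_diff:
  assumes "u \<in> V" and "v \<in> V"
  shows "nrm (u - v) \<le> nrm u + nrm v"
proof -
  have "u - v = u + (-1) *\<^sub>c v" by (simp add: fun_eq_iff pointwise)
  then show ?thesis using nrm_triangle[of u "(-1) *\<^sub>c v"] nrm_scale[of v "-1"] closed(4)[of v "-1"] assms by simp
qed

lemma nrm_zero: "nrm 0 = 0"
  by (simp add: nrm_def ip_zero_left)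

lemma nrm_sum:
  assumes "finite S" "\<And>b. b \<in> S \<Longrightarrow> f b \<in> V"
  shows "nrm (\<Sum>b\<in>S. f b) \<le> (\<Sum>b\<in>S. nrm (f b))"
  using assms
proof induction
  case empty
  show ?case by (simp add: nrm_zero)
next
  case (insert a S)
  have "(\<Sum>b\<in>S. f b) \<in> V" using insert by (intro fun_vs.subspace_sum[OF subspace]) auto
  then have "nrm (f a + (\<Sum>b\<in>S. f b)) \<le> nrm (f a) + nrm (\<Sum>b\<in>S. f b)"
    using insert by (intro nrm_triangle) auto
  then show ?case using insert by simp
qed

end

locale inner_form = psd_form V ip
  for V :: "('x \<Rightarrow> complex) set" and ip +
  assumes ip_definite: "v \<in> V \<Longrightarrow> Re (ip v v) = 0 \<Longrightarrow> v = 0"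
begin

lemma Re_ip_pos: "v \<in> V \<Longrightarrow> v \<noteq> 0 \<Longrightarrow> 0 < Re (ip v v)"
  using ip_definite[of v] ip_nonneg[of v] by fastforce

lemma nrm_pos: "v \<in> V \<Longrightarrow> v \<noteq> 0 \<Longrightarrow> 0 < nrm v"
  by (simp add: nrm_def Re_ip_pos)

lemma nrm_eq_0: "v \<in> V \<Longrightarrow> nrm v = 0 \<longleftrightarrow> v = 0"
  using nrm_pos nrm_zero by force

definition orthonormal :: "('x \<Rightarrow> complex) set \<Rightarrow> bool" where
  "orthonormal E \<longleftrightarrow> finite E \<and> E \<subseteq> V \<and> (\<forall>a\<in>E. \<forall>b\<in>E. ip a b = (if a = b then 1 else 0))"

definition proj :: "('x \<Rightarrow> complex) set \<Rightarrow> ('x \<Rightarrow> complex) \<Rightarrow> ('x \<Rightarrow> complex)" where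
  "proj E u = (\<Sum>e\<in>E. ip u e *\<^sub>c e)"

lemma proj_in_span: "proj E u \<in> fun_vs.span E"
  unfolding proj_def by (rule fun_vs.span_sum, rule fun_vs.span_scale, rule fun_vs.span_base)

lemma span_in_V: "E \<subseteq> V \<Longrightarrow> v \<in> fun_vs.span E \<Longrightarrow> v \<in> V"
  using fun_vs.span_minimal subspace by blast

lemma proj_in_V: "orthonormal E \<Longrightarrow> proj E u \<in> V"
  using span_in_V proj_in_span orthonormal_def by blast

lemma proj_orthogonal:
  assumes E: "orthonormal E" and u: "u \<in> V" and w: "w \<in> fun_vs.span E"
  shows "ip (u - proj E u) w = 0"
proof -
  have EV: "E \<subseteq> V" "finite E" using E by (auto simp: orthonormal_def)
  have base: "ip (u - proj E u) a = 0" if a: "a \<in> E" for a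
  proof -
    have "ip (proj E u) a = (\<Sum>e\<in>E. ip u e * (if e = a then 1 else 0))"
      unfolding proj_def using E a EV
      by (subst ip_sum_left) (auto simp: ip_scale_left orthonormal_def subset_iff intro!: sum.cong)
    also have "\<dots> = ip u a" using a EV(2) by (simp add: if_distrib sum.delta cong: if_cong)
    finally show ?thesis using u a EV proj_in_V[OF E] by (auto simp: ip_diff_left)
  qed
  have d: "u - proj E u \<in> V" using u proj_in_V[OF E] by simp
  have "w \<in> V \<and> ip (u - proj E u) w = 0"
    using w
  proof (induction rule: fun_vs.span_induct_alt)
    case base
    show ?case using ip_zero_right[OF d] by simp
  next
    case (step c x y)
    then show ?case using base d EV(1) by (auto simp: ip_add_right ip_scale_right)
  qed
  then show ?thesis by blast
qed

lemma proj_eq_self: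
  assumes E: "orthonormal E" and u: "u \<in> fun_vs.span E"
  shows "proj E u = u"
proof -
  have uV: "u \<in> V" using span_in_V[OF _ u] E by (simp add: orthonormal_def)
  have "u - proj E u \<in> fun_vs.span E" by (rule fun_vs.span_diff[OF u proj_in_span])
  then have "ip (u - proj E u) (u - proj E u) = 0" using proj_orthogonal[OF E uV] by blast
  then have "u - proj E u = 0" using ip_definite[of "u - proj E u"] uV proj_in_V[OF E] by simp
  then show ?thesis by simp
qed

text \<open>Gram-Schmidt; vectors that already lie in the span are dropped, so \<open>F\<close> may be dependent.\<close>

lemma orthonormal_span_exists:
  assumes "finite F" "F \<subseteq> V"
  shows "\<exists>E. orthonormal E \<and> fun_vs.span E = fun_vs.span F"
  using assms
proof induction
  case empty
  show ?case by (intro exI[of _ "{}"]) (simp add: orthonormal_def)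
next
  case (insert a F)
  then obtain E where E: "orthonormal E" "fun_vs.span E = fun_vs.span F" by auto
  have aV: "a \<in> V" using insert by simp
  have EV: "E \<subseteq> V" "finite E" using E by (auto simp: orthonormal_def)
  define r where "r = a - proj E a"
  have rV: "r \<in> V" using aV proj_in_V[OF E(1)] by (simp add: r_def)
  have "a - r \<in> fun_vs.span E" using proj_in_span by (simp add: r_def)
  then have eq: "fun_vs.span (insert a E) = fun_vs.span (insert r E)"
    by (intro fun_vs.eq_span_insert_eq)
  have eqF: "fun_vs.span (insert a E) = fun_vs.span (insert a F)"
    using E(2) by (simp add: fun_vs.span_insert)
  show ?case
  proof (cases "r = 0")
    case True
    then show ?thesis using E eq eqF by (intro exI[of _ E]) (simp add: fun_vs.span_insert_0)
  next
    case False
    define e where "e = complex_of_real (1 / nrm r) *\<^sub>c r"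
    have rp: "0 < nrm r" using False rV nrm_pos by blast
    have eV: "e \<in> V" using rV by (simp add: e_def)
    have "Re (ip e e) = 1"
      using rp rV by (simp only: e_def Re_ip_scale nrm_sq[symmetric])
        (simp add: power_divide flip: of_real_divide)
    then have ee: "ip e e = 1" using Im_ip_self[OF eV] by (simp add: complex_eq_iff)
    have e0: "ip e b = 0" if "b \<in> E" for b
      using proj_orthogonal[OF E(1) aV fun_vs.span_base[OF that]] that EV rV
      by (auto simp: e_def ip_scale_left r_def[symmetric])
    have "ip b e = 0" if "b \<in> E" for b
      using e0[OF that] ip_herm[of e b] that eV EV by auto
    then have on: "orthonormal (insert e E)"
      using E(1) eV ee e0 by (auto simp: orthonormal_def)
    have r_eq: "r = complex_of_real (nrm r) *\<^sub>c e"
      using rp by (simp add: e_def fun_vs.scale_scale flip: of_real_mult of_real_inverse)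
    have "fun_vs.span (insert e E) = fun_vs.span (insert r E)"
    proof (rule fun_vs.span_eq[THEN iffD2], intro conjI)
      have "e \<in> fun_vs.span (insert r E)"
        unfolding e_def by (intro fun_vs.span_scale fun_vs.span_base) simp
      then show "insert e E \<subseteq> fun_vs.span (insert r E)" by (auto intro: fun_vs.span_base)
      have "complex_of_real (nrm r) *\<^sub>c e \<in> fun_vs.span (insert e E)"
        by (intro fun_vs.span_scale fun_vs.span_base) simp
      then have "r \<in> fun_vs.span (insert e E)" using r_eq by simp
      then show "insert r E \<subseteq> fun_vs.span (insert e E)"
        by (auto intro: fun_vs.span_base)
    qed
    then show ?thesis using on eq eqF by (intro exI[of _ "insert e E"]) simp
  qed
qed

text \<open>Pythagoras around the orthogonal projection gives both existence and uniqueness.\<close>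

lemma best_approximation:
  assumes F: "finite F" "F \<subseteq> V" and u: "u \<in> V"
  shows "\<exists>w\<in>fun_vs.span F. \<forall>w'\<in>fun_vs.span F. nrm (u - w) \<le> nrm (u - w') \<and>
     (nrm (u - w') \<le> nrm (u - w) \<longrightarrow> w' = w)"
proof -
  obtain E where E: "orthonormal E" "fun_vs.span E = fun_vs.span F"
    using orthonormal_span_exists[OF F] by blast
  define w where "w = proj E u"
  have wV: "w \<in> V" using proj_in_V[OF E(1)] by (simp add: w_def)
  have "nrm (u - w) \<le> nrm (u - w') \<and> (nrm (u - w') \<le> nrm (u - w) \<longrightarrow> w' = w)"
    if w': "w' \<in> fun_vs.span F" for w'
  proof -
    have w'V: "w' \<in> V" using span_in_V F w' by blast
    have "w - w' \<in> fun_vs.span E"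
      unfolding w_def by (rule fun_vs.span_diff[OF proj_in_span]) (use w' E(2) in simp)
    then have orth: "ip (u - w) (w - w') = 0" using proj_orthogonal[OF E(1) u] by (simp add: w_def)
    have split: "u - w' = (u - w) + (w - w')" by simp
    have "Re (ip (u - w') (u - w')) = Re (ip (u - w) (u - w)) + Re (ip (w - w') (w - w'))"
      unfolding split using u wV w'V orth by (subst Re_ip_add) auto
    moreover have "0 \<le> Re (ip (w - w') (w - w'))" using wV w'V by (intro ip_nonneg) simp
    moreover have "w' = w" if "Re (ip (w - w') (w - w')) \<le> 0"
      using ip_definite[of "w - w'"] wV w'V that calculation(2) by simp
    ultimately show ?thesis by (auto simp: nrm_def)
  qed
  moreover have "w \<in> fun_vs.span F" using proj_in_span[of E u] E(2) by (simp add: w_def)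
  ultimately show ?thesis by blast
qed

text \<open>Expanding in an orthonormal basis shows that any other form is bounded by this one.\<close>

lemma dominates:
  assumes V: "fin_dim V" and q: "psd_form V q"
  obtains C where "0 < C" "\<And>v. v \<in> V \<Longrightarrow> Re (q v v) \<le> C * Re (ip v v)"
proof -
  interpret q: psd_form V q by (rule q)
  obtain B where B: "finite B" "B \<subseteq> V" "\<not> fun_vs.dependent B" "fun_vs.span B = V"
    by (rule fin_dim_basis[OF V])
  obtain E where E: "orthonormal E" "fun_vs.span E = V"
    using orthonormal_span_exists[OF B(1,2)] B(4) by auto
  have EV: "E \<subseteq> V" "finite E" using E by (auto simp: orthonormal_def)
  define K where "K = (\<Sum>e\<in>E. q.nrm e) + 1"
  have K: "1 \<le> K" using EV by (auto simp: K_def intro!: sum_nonneg q.nrm_nonneg)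
  have "Re (q v v) \<le> K\<^sup>2 * Re (ip v v)" if v: "v \<in> V" for v
  proof -
    have "q.nrm v = q.nrm (proj E v)" using proj_eq_self[OF E(1)] v E(2) by simp
    also have "\<dots> \<le> (\<Sum>e\<in>E. q.nrm (ip v e *\<^sub>c e))"
      unfolding proj_def using EV by (intro q.nrm_sum) auto
    also have "\<dots> \<le> (\<Sum>e\<in>E. nrm v * q.nrm e)"
    proof (rule sum_mono)
      fix e assume e: "e \<in> E"
      then have "nrm e = 1" using E(1) by (simp add: nrm_def orthonormal_def)
      then have "cmod (ip v e) \<le> nrm v" using cmod_ip_le[of v e] v e EV by auto
      then show "q.nrm (ip v e *\<^sub>c e) \<le> nrm v * q.nrm e"
        using e EV q.nrm_nonneg[of e] by (auto simp: q.nrm_scale intro!: mult_right_mono)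
    qed
    also have "\<dots> \<le> nrm v * K"
      using nrm_nonneg[OF v] by (simp add: K_def sum_distrib_left[symmetric] algebra_simps)
    finally have "(q.nrm v)\<^sup>2 \<le> (nrm v * K)\<^sup>2"
      using q.nrm_nonneg[OF v] by (intro power_mono)
    then show ?thesis using v by (simp add: q.nrm_sq nrm_sq power_mult_distrib mult.commute)
  qed
  then show thesis using that[of "K\<^sup>2"] K by simp
qed

end

section \<open>Positive self-adjoint operators and conjugate gradients\<close>

text \<open>In finite dimension an operator fails to be bijective only if it has a kernel.\<close>

lemma spectrum_on_eigenvalue:
  assumes V: "fin_dim V" and L: "linear_map V V L"
  shows "z \<in> spectrum_on V L \<longleftrightarrow> (\<exists>v\<in>V. v \<noteq> 0 \<and> L v = z *\<^sub>c v)"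
proof -
  define H where "H = (\<lambda>v. L v - z *\<^sub>c v)"
  have Vs: "fun_vs.subspace V" by (rule fin_dim_subspace[OF V])
  have H: "linear_map V V H"
    using linear_map_combine[OF L linear_map_id Vs, of 1 "-z"] by (simp add: H_def)
  have spec: "z \<in> spectrum_on V L \<longleftrightarrow> \<not> bij_betw H V V"
    by (simp add: spectrum_on_def H_def fun_diff_def cscale_def)
  have eq: "H v = 0 \<longleftrightarrow> L v = z *\<^sub>c v" for v by (simp add: H_def)
  show ?thesis
  proof
    assume "z \<in> spectrum_on V L"
    then show "\<exists>v\<in>V. v \<noteq> 0 \<and> L v = z *\<^sub>c v"
      using linear_endo_bij[OF V H] spec eq by blast
  next
    assume "\<exists>v\<in>V. v \<noteq> 0 \<and> L v = z *\<^sub>c v"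
    then obtain v where v: "v \<in> V" "v \<noteq> 0" "H v = 0" using eq by blast
    have "H 0 = 0" by (rule linear_map_zero[OF H Vs])
    then have "\<not> inj_on H V" using v fun_vs.subspace_0[OF Vs] by (metis inj_onD)
    then show "z \<in> spectrum_on V L" using spec by (simp add: bij_betw_def)
  qed
qed

definition selfadjoint_on ::
  "('x \<Rightarrow> complex) set \<Rightarrow> (('x \<Rightarrow> complex) \<Rightarrow> ('x \<Rightarrow> complex) \<Rightarrow> complex)
    \<Rightarrow> (('x \<Rightarrow> complex) \<Rightarrow> 'x \<Rightarrow> complex) \<Rightarrow> bool" where
  "selfadjoint_on V ip L \<longleftrightarrow> linear_map V V L \<and> (\<forall>u\<in>V. \<forall>v\<in>V. ip (L u) v = ip u (L v))"

context inner_form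
begin

lemma selfadjoint_psd_form:
  assumes H: "selfadjoint_on V ip H" and psd: "\<And>v. v \<in> V \<Longrightarrow> 0 \<le> Re (ip (H v) v)"
  shows "psd_form V (\<lambda>u v. ip (H u) v)"
proof -
  have lin: "linear_map V V H" using H by (simp add: selfadjoint_on_def)
  note HV = linear_map_in[OF lin]
  show ?thesis
  proof
    show "ip (H v) u = cnj (ip (H u) v)" if "u \<in> V" "v \<in> V" for u v
      using H that ip_herm[of "H u" v] HV by (simp add: selfadjoint_on_def)
  qed (auto simp: subspace psd linear_map_add[OF lin] linear_map_scale[OF lin] HV ip_expand)
qed

text \<open>If the quadratic form of \<open>H\<close> comes arbitrarily close to zero on unit vectors, it cannot be
  definite, because a definite form dominates the inner product.  A null vector of a semidefinite
  form is in the kernel by the Cauchy-Schwarz inequality.\<close>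

lemma selfadjoint_psd_kernel:
  assumes V: "fin_dim V" and H: "selfadjoint_on V ip H"
    and psd: "\<And>v. v \<in> V \<Longrightarrow> 0 \<le> Re (ip (H v) v)"
    and small: "\<And>\<delta>. 0 < \<delta> \<Longrightarrow> \<exists>v\<in>V. v \<noteq> 0 \<and> Re (ip (H v) v) < \<delta> * Re (ip v v)"
  shows "\<exists>v\<in>V. v \<noteq> 0 \<and> H v = 0"
proof (rule ccontr)
  assume no: "\<not> (\<exists>v\<in>V. v \<noteq> 0 \<and> H v = 0)"
  interpret h: psd_form V "\<lambda>u v. ip (H u) v" by (rule selfadjoint_psd_form[OF H psd])
  have lin: "linear_map V V H" using H by (simp add: selfadjoint_on_def)
  interpret h: inner_form V "\<lambda>u v. ip (H u) v"
  proof
    fix v assume v: "v \<in> V" and z: "Re (ip (H v) v) = 0"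
    have HV: "H v \<in> V" by (rule linear_map_in[OF lin v])
    have "(cmod (ip (H v) (H v)))\<^sup>2 \<le> 0"
      using h.Cauchy_Schwarz[OF v HV] z by simp
    then have "H v = 0" using ip_definite[OF HV] by simp
    then show "v = 0" using no v by blast
  qed
  have psd_ip: "psd_form V ip" by unfold_locales
  obtain C where C: "0 < C" "\<And>v. v \<in> V \<Longrightarrow> Re (ip v v) \<le> C * Re (ip (H v) v)"
    using h.dominates[OF V psd_ip] by metis
  obtain v where v: "v \<in> V" "Re (ip (H v) v) < (1 / C) * Re (ip v v)"
    using small[of "1 / C"] C(1) by auto
  then show False using C(1) C(2)[OF v(1)] by (simp add: field_simps)
qed

lemma selfadjoint_affine:
  assumes L: "selfadjoint_on V ip L"
  shows "selfadjoint_on V ip (\<lambda>v. complex_of_real a *\<^sub>c v + complex_of_real b *\<^sub>c L v)"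
proof -
  have lin: "linear_map V V L" using L by (simp add: selfadjoint_on_def)
  note LV = linear_map_in[OF lin]
  show ?thesis
    using L LV linear_map_combine[OF linear_map_id lin subspace]
    by (auto simp: selfadjoint_on_def ip_expand)
qed

text \<open>The bounds of the Rayleigh quotient are eigenvalues, so the condition number is the ratio
  of these bounds.\<close>

lemma cond_on_Rayleigh:
  assumes V: "fin_dim V" and nontriv: "\<exists>v\<in>V. v \<noteq> 0"
    and L: "selfadjoint_on V ip L" and pos: "\<And>v. v \<in> V \<Longrightarrow> v \<noteq> 0 \<Longrightarrow> 0 < Re (ip (L v) v)"
  shows "\<exists>m M. 0 < m \<and> m \<le> M \<and> cond_on V L = M / m \<and>
    (\<forall>v\<in>V. m * Re (ip v v) \<le> Re (ip (L v) v)) \<and> (\<forall>v\<in>V. Re (ip (L v) v) \<le> M * Re (ip v v))"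
proof -
  have lin: "linear_map V V L" using L by (simp add: selfadjoint_on_def)
  note LV = linear_map_in[OF lin]
  have L0: "L 0 = 0" by (rule linear_map_zero[OF lin subspace])
  have psd: "0 \<le> Re (ip (L v) v)" if "v \<in> V" for v
    using pos[OF that] by (cases "v = 0") (auto simp: ip_zero_left L0)
  interpret h: psd_form V "\<lambda>u v. ip (L u) v" by (rule selfadjoint_psd_form[OF L psd])
  obtain C where C: "0 < C" "\<And>v. v \<in> V \<Longrightarrow> Re (ip (L v) v) \<le> C * Re (ip v v)"
    using dominates[OF V h.psd_form_axioms] by metis
  define Q where "Q = (\<lambda>v. Re (ip (L v) v) / Re (ip v v)) ` (V - {0})"
  have Qne: "Q \<noteq> {}" using nontriv by (auto simp: Q_def)
  have below: "bdd_below Q"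
    unfolding Q_def by (intro bdd_belowI2[of _ 0]) (auto simp: psd ip_nonneg)
  have above: "bdd_above Q"
    unfolding Q_def by (intro bdd_aboveI2[of _ _ C]) (auto simp: C divide_le_eq Re_ip_pos)
  define m M where "m = Inf Q" and "M = Sup Q"
  have mQ: "m * Re (ip v v) \<le> Re (ip (L v) v)" if v: "v \<in> V" for v
  proof (cases "v = 0")
    case False
    then have "m \<le> Re (ip (L v) v) / Re (ip v v)"
      unfolding m_def using v by (intro cInf_lower below) (auto simp: Q_def)
    then show ?thesis using Re_ip_pos[OF v False] by (simp add: field_simps)
  qed (simp add: ip_zero_left L0)
  have MQ: "Re (ip (L v) v) \<le> M * Re (ip v v)" if v: "v \<in> V" for v
  proof (cases "v = 0")
    case False
    then have "Re (ip (L v) v) / Re (ip v v) \<le> M"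
      unfolding M_def using v by (intro cSup_upper above) (auto simp: Q_def)
    then show ?thesis using Re_ip_pos[OF v False] by (simp add: field_simps)
  qed (simp add: ip_zero_left L0)
  have Re_affine: "Re (ip (complex_of_real a *\<^sub>c v + complex_of_real b *\<^sub>c L v) v)
      = a * Re (ip v v) + b * Re (ip (L v) v)" if "v \<in> V" for a b v
    using that LV by (simp add: ip_expand)
  have "\<exists>v\<in>V. v \<noteq> 0 \<and> complex_of_real (- m) *\<^sub>c v + complex_of_real 1 *\<^sub>c L v = 0"
  proof (rule selfadjoint_psd_kernel[OF V selfadjoint_affine[OF L]])
    fix \<delta> :: real assume "0 < \<delta>"
    then obtain r where "r \<in> Q" "r < m + \<delta>"
      using cInf_lessD[OF Qne, of "m + \<delta>"] by (auto simp: m_def)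
    then obtain v where v: "v \<in> V" "v \<noteq> 0" "Re (ip (L v) v) / Re (ip v v) < m + \<delta>"
      by (auto simp: Q_def)
    then have "Re (ip (L v) v) < (m + \<delta>) * Re (ip v v)"
      using Re_ip_pos[OF v(1,2)] by (simp add: field_simps)
    then show "\<exists>v\<in>V. v \<noteq> 0 \<and> Re (ip (complex_of_real (- m) *\<^sub>c v + complex_of_real 1 *\<^sub>c L v) v)
        < \<delta> * Re (ip v v)"
      using v by (intro bexI[of _ v]) (simp_all only: Re_affine, simp_all add: algebra_simps)
  qed (simp only: Re_affine, use mQ in simp)
  then obtain vm where vm: "vm \<in> V" "vm \<noteq> 0" "L vm = complex_of_real m *\<^sub>c vm"
    by (auto simp: fun_vs.scale_minus_left)
  have "\<exists>v\<in>V. v \<noteq> 0 \<and> complex_of_real M *\<^sub>c v + complex_of_real (-1) *\<^sub>c L v = 0"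
  proof (rule selfadjoint_psd_kernel[OF V selfadjoint_affine[OF L]])
    fix \<delta> :: real assume "0 < \<delta>"
    then obtain r where "r \<in> Q" "M - \<delta> < r"
      using less_cSupD[OF Qne, of "M - \<delta>"] by (auto simp: M_def)
    then obtain v where v: "v \<in> V" "v \<noteq> 0" "M - \<delta> < Re (ip (L v) v) / Re (ip v v)"
      by (auto simp: Q_def)
    then have "(M - \<delta>) * Re (ip v v) < Re (ip (L v) v)"
      using Re_ip_pos[OF v(1,2)] by (simp add: field_simps)
    then show "\<exists>v\<in>V. v \<noteq> 0 \<and> Re (ip (complex_of_real M *\<^sub>c v + complex_of_real (-1) *\<^sub>c L v) v)
        < \<delta> * Re (ip v v)"
      using v by (intro bexI[of _ v]) (simp_all only: Re_affine, simp_all add: algebra_simps)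
  qed (simp only: Re_affine, use MQ in simp)
  then obtain vM where vM: "vM \<in> V" "vM \<noteq> 0" "L vM = complex_of_real M *\<^sub>c vM"
    by (auto simp: fun_vs.scale_minus_left)
  have eig: "m \<le> Re z \<and> Re z \<le> M" if z: "z \<in> spectrum_on V L" for z
  proof -
    obtain v where v: "v \<in> V" "v \<noteq> 0" "L v = z *\<^sub>c v"
      using z spectrum_on_eigenvalue[OF V lin] by blast
    have "Re (ip (L v) v) = Re z * Re (ip v v)"
      using v Im_ip_self[of v] by (simp add: ip_scale_left)
    then show ?thesis using mQ[OF v(1)] MQ[OF v(1)] Re_ip_pos[OF v(1,2)] by simp
  qed
  have sm: "m \<in> Re ` spectrum_on V L"
    using vm spectrum_on_eigenvalue[OF V lin, of "complex_of_real m"] by force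
  have sM: "M \<in> Re ` spectrum_on V L"
    using vM spectrum_on_eigenvalue[OF V lin, of "complex_of_real M"] by force
  have "Sup (Re ` spectrum_on V L) = M"
    using sM eig by (intro cSup_eq_maximum) auto
  moreover have "Inf (Re ` spectrum_on V L) = m"
    using sm eig by (intro cInf_eq_minimum) auto
  ultimately have "cond_on V L = M / m" by (simp add: cond_on_def)
  moreover have "0 < m"
  proof -
    have "Re (ip (L vm) vm) = m * Re (ip vm vm)" using vm by (simp add: ip_scale_left)
    then show ?thesis using pos[OF vm(1,2)] Re_ip_pos[OF vm(1,2)] by (simp add: zero_less_mult_iff)
  qed
  moreover have "m \<le> M" using eig sm by auto
  ultimately show ?thesis using mQ MQ by blast
qed

text \<open>The identity \<open>2 (1 - X\<^sup>2) = (1 + X) (1 - X) (1 + X) + (1 - X) (1 + X) (1 - X)\<close> exhibits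
  \<open>1 - X\<^sup>2\<close> as positive when \<open>-1 \<le> X \<le> 1\<close>.\<close>

lemma selfadjoint_contraction:
  assumes X: "selfadjoint_on V ip X" and u: "u \<in> V"
    and bound: "\<And>v. v \<in> V \<Longrightarrow> \<bar>Re (ip (X v) v)\<bar> \<le> Re (ip v v)"
  shows "Re (ip (X u) (X u)) \<le> Re (ip u u)"
proof -
  have lin: "linear_map V V X" using X by (simp add: selfadjoint_on_def)
  note XV = linear_map_in[OF lin]
  have sa: "ip (X (X v)) v = ip (X v) (X v)" "ip (X (X v)) (X v) = ip (X v) (X (X v))" if "v \<in> V" for v
    using X that XV by (auto simp: selfadjoint_on_def)
  define p where "p = u + X u"
  define n where "n = u - X u"
  have pn: "p \<in> V" "n \<in> V" using u XV by (auto simp: p_def n_def)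
  have "0 \<le> Re (ip p p) - Re (ip (X p) p)" "0 \<le> Re (ip n n) + Re (ip (X n) n)"
    using bound[OF pn(1)] bound[OF pn(2)] by auto
  moreover have "Re (ip p p) - Re (ip (X p) p) + (Re (ip n n) + Re (ip (X n) n))
      = 2 * (Re (ip u u) - Re (ip (X u) (X u)))"
    using u XV X sa Re_ip_commute
    by (simp add: p_def n_def linear_map_add[OF lin] linear_map_diff[OF lin subspace] ip_expand selfadjoint_on_def)
  ultimately show ?thesis by simp
qed

end

lemma krylov_span: "krylov L k r = fun_vs.span ((\<lambda>i. (L ^^ i) r) ` {..<k})"
proof
  have sum_eq: "(\<lambda>x. \<Sum>i<k. c i * (L ^^ i) r x) = (\<Sum>i<k. c i *\<^sub>c (L ^^ i) r)" for c
  proof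
    fix x
    show "(\<Sum>i<k. c i * (L ^^ i) r x) = (\<Sum>i<k. c i *\<^sub>c (L ^^ i) r) x"
      by (induction k) (auto simp: pointwise)
  qed
  have kr: "krylov L k r = {\<Sum>i<k. c i *\<^sub>c (L ^^ i) r |c. True}"
    unfolding krylov_def sum_eq by auto
  have krI: "(\<Sum>i<k. c i *\<^sub>c (L ^^ i) r) \<in> krylov L k r" for c
    unfolding kr by blast
  show "krylov L k r \<subseteq> fun_vs.span ((\<lambda>i. (L ^^ i) r) ` {..<k})"
  proof
    fix w assume "w \<in> krylov L k r"
    then obtain c where w: "w = (\<Sum>i<k. c i *\<^sub>c (L ^^ i) r)" unfolding kr by blast
    show "w \<in> fun_vs.span ((\<lambda>i. (L ^^ i) r) ` {..<k})"
      unfolding w by (rule fun_vs.span_sum, rule fun_vs.span_scale, rule fun_vs.span_base, rule imageI)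
  qed
  show "fun_vs.span ((\<lambda>i. (L ^^ i) r) ` {..<k}) \<subseteq> krylov L k r"
  proof (rule fun_vs.span_minimal)
    show "(\<lambda>i. (L ^^ i) r) ` {..<k} \<subseteq> krylov L k r"
    proof
      fix w assume "w \<in> (\<lambda>i. (L ^^ i) r) ` {..<k}"
      then obtain j where j: "j < k" "w = (L ^^ j) r" by auto
      have "(\<Sum>i<k. (if i = j then 1 else 0) *\<^sub>c (L ^^ i) r) = (\<Sum>i<k. if i = j then (L ^^ i) r else 0)"
        by (intro sum.cong) auto
      also have "\<dots> = w" using j by simp
      finally have "w = (\<Sum>i<k. (if i = j then 1 else 0) *\<^sub>c (L ^^ i) r)" by (rule sym)
      then show "w \<in> krylov L k r" using krI by metis
    qed
    show "fun_vs.subspace (krylov L k r)"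
      unfolding fun_vs.subspace_def
    proof (intro conjI ballI allI)
      have "0 = (\<Sum>i<k. 0 *\<^sub>c (L ^^ i) r)" by simp
      then show "0 \<in> krylov L k r" using krI[of "\<lambda>_. 0"] by metis
      fix v w assume "v \<in> krylov L k r"
      then obtain c where c: "v = (\<Sum>i<k. c i *\<^sub>c (L ^^ i) r)" unfolding kr by auto
      have "a *\<^sub>c v = (\<Sum>i<k. (a * c i) *\<^sub>c (L ^^ i) r)" for a
        unfolding c by (simp add: fun_vs.scale_sum_right)
      then show "a *\<^sub>c v \<in> krylov L k r" for a
        using krI[of "\<lambda>i. a * c i"] by metis
      assume "w \<in> krylov L k r"
      then obtain d where d: "w = (\<Sum>i<k. d i *\<^sub>c (L ^^ i) r)" unfolding kr by auto
      have "v + w = (\<Sum>i<k. (c i + d i) *\<^sub>c (L ^^ i) r)"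
        unfolding c d by (simp add: sum.distrib fun_vs.scale_left_distrib)
      then show "v + w \<in> krylov L k r" using krI[of "\<lambda>i. c i + d i"] by metis
    qed
  qed
qed

lemma subspace_krylov: "fun_vs.subspace (krylov L k r)"
  by (simp add: krylov_span)

lemma krylov_mono: "j \<le> k \<Longrightarrow> krylov L j r \<subseteq> krylov L k r"
  unfolding krylov_span by (intro fun_vs.span_mono) auto

lemma krylov_generators:
  assumes L: "linear_map V V L" and r: "r \<in> V"
  shows "(\<lambda>i. (L ^^ i) r) ` {..<k} \<subseteq> V"
proof -
  have "(L ^^ i) r \<in> V" for i by (induction i) (auto simp: r linear_map_in[OF L])
  then show ?thesis by auto
qed

lemma krylov_subset:
  assumes "linear_map V V L" "fun_vs.subspace V" "r \<in> V"
  shows "krylov L k r \<subseteq> V"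
  unfolding krylov_span by (intro fun_vs.span_minimal krylov_generators assms)

lemma krylov_start: "r \<in> krylov L (Suc k) r"
  unfolding krylov_span by (rule fun_vs.span_base) (auto intro!: image_eqI[of _ _ 0])

lemma krylov_step:
  assumes L: "linear_map V V L" and V: "fun_vs.subspace V" and r: "r \<in> V" and w: "w \<in> krylov L k r"
  shows "L w \<in> krylov L (Suc k) r"
proof -
  have "w \<in> V \<and> L w \<in> krylov L (Suc k) r"
    using w unfolding krylov_span[of L k]
  proof (induction rule: fun_vs.span_induct_alt)
    case base
    show ?case
      using fun_vs.subspace_0[OF V] fun_vs.subspace_0[OF subspace_krylov] linear_map_zero[OF L V] by auto
  next
    case (step c x y)
    then obtain i where i: "i < k" "x = (L ^^ i) r" by auto
    have xV: "x \<in> V" using krylov_generators[OF L r] step(1) by blast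
    have "L x = (L ^^ Suc i) r" using i by simp
    also have "\<dots> \<in> krylov L (Suc k) r"
      unfolding krylov_span by (rule fun_vs.span_base, rule image_eqI[of _ _ "Suc i"]) (use i in auto)
    finally have "c *\<^sub>c L x + L y \<in> krylov L (Suc k) r"
      using step by (intro fun_vs.subspace_add[OF subspace_krylov] fun_vs.subspace_scale[OF subspace_krylov]) auto
    then show ?case
      using step xV fun_vs.subspace_add[OF V] fun_vs.subspace_scale[OF V]
      by (simp add: linear_map_add[OF L] linear_map_scale[OF L])
  qed
  then show ?thesis by blast
qed


text \<open>The values at \<open>\<theta>\<close> of the Chebyshev polynomials of the first kind of degree \<open>n + 1\<close> and of the
  second kind of degree \<open>n\<close>.  The recursion is the addition theorem for the cosine of multiples of an
  angle and the quotient of two sines, and it remains meaningful when \<open>\<theta>\<close> is replaced by an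
  operator.\<close>

fun cheb_pair :: "real \<Rightarrow> nat \<Rightarrow> real \<times> real" where
  "cheb_pair \<theta> 0 = (\<theta>, 1)"
| "cheb_pair \<theta> (Suc n) = (let (t, u) = cheb_pair \<theta> n; u' = \<theta> * u + t in (\<theta> * u' - u, u'))"

text \<open>Outside \<open>[-1, 1]\<close> one writes \<open>\<theta>\<close> as a hyperbolic cosine, \<open>\<theta> = (y + 1 / y) / 2\<close>, and the
  recursion becomes multiplication by \<open>y\<close>.\<close>

lemma cheb_pair_closed_form:
  assumes y: "y \<noteq> 0" "y \<noteq> 1 / y" and \<theta>: "2 * \<theta> = y + 1 / y"
  shows "fst (cheb_pair \<theta> n) = (y ^ Suc n + (1 / y) ^ Suc n) / 2"
    and "snd (cheb_pair \<theta> n) = (y ^ Suc n - (1 / y) ^ Suc n) / (y - 1 / y)"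
proof -
  define z where "z = 1 / y"
  have yz: "y * z = 1" "y - z \<noteq> 0" using y by (auto simp: z_def)
  have th: "\<theta> = (y + z) / 2" using \<theta> by (simp add: z_def)
  have "fst (cheb_pair \<theta> n) = (y ^ Suc n + z ^ Suc n) / 2 \<and>
     snd (cheb_pair \<theta> n) = (y ^ Suc n - z ^ Suc n) / (y - z)"
  proof (induction n)
    case 0
    show ?case using th yz by simp
  next
    case (Suc n)
    define Y Z where "Y = y ^ Suc n" and "Z = z ^ Suc n"
    define t u where "t = fst (cheb_pair \<theta> n)" and "u = snd (cheb_pair \<theta> n)"
    have tu: "t = (Y + Z) / 2" "u = (Y - Z) / (y - z)"
      using Suc by (auto simp: t_def u_def Y_def Z_def)
    have st: "cheb_pair \<theta> (Suc n) = (\<theta> * (\<theta> * u + t) - u, \<theta> * u + t)"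
      by (simp add: t_def u_def Let_def split: prod.split)
    have uyz: "u * (y - z) = Y - Z" using tu yz by simp
    have u': "(\<theta> * u + t) * (y - z) = y * Y - z * Z"
    proof -
      have "(\<theta> * u + t) * (y - z) = \<theta> * (u * (y - z)) + t * (y - z)" by algebra
      also have "\<dots> = y * Y - z * Z" unfolding uyz by (simp add: th tu(1) field_simps)
      finally show ?thesis .
    qed
    have "(\<theta> * (\<theta> * u + t) - u) * (y - z) = \<theta> * ((\<theta> * u + t) * (y - z)) - u * (y - z)" by algebra
    also have "\<dots> = \<theta> * (y * Y - z * Z) - (y * z) * (Y - Z)" unfolding u' uyz using yz by simp
    also have "\<dots> = (y * Y + z * Z) / 2 * (y - z)"
      by (simp add: th field_simps)
    finally have t': "\<theta> * (\<theta> * u + t) - u = (y * Y + z * Z) / 2" using yz by simp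
    have "\<theta> * u + t = (y * Y - z * Z) / (y - z)" using u' yz by (simp add: field_simps)
    then show ?case using st t' by (simp add: Y_def Z_def)
  qed
  then show "fst (cheb_pair \<theta> n) = (y ^ Suc n + (1 / y) ^ Suc n) / 2"
    "snd (cheb_pair \<theta> n) = (y ^ Suc n - (1 / y) ^ Suc n) / (y - 1 / y)"
    by (auto simp: z_def)
qed

lemma cheb_pair_lower_bound:
  fixes m M :: real
  assumes m: "0 < m" "m < M"
  shows "inverse (fst (cheb_pair ((M + m) / (M - m)) n))
      \<le> 2 * ((sqrt (M / m) - 1) / (sqrt (M / m) + 1)) ^ Suc n"
    and "0 < fst (cheb_pair ((M + m) / (M - m)) n)"
proof -
  define s where "s = sqrt (M / m)"
  have s: "1 < s" using m by (simp add: s_def)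
  have ss: "s * s = M / m" using m by (simp add: s_def)
  \<comment> \<open>chosen so that \<open>(y + 1 / y) / 2 = (M + m) / (M - m)\<close>\<close>
  define y where "y = (s + 1) / (s - 1)"
  have y1: "1 < y" using s by (simp add: y_def field_simps)
  have yi: "1 / y = (s - 1) / (s + 1)" by (simp add: y_def)
  have yne: "y \<noteq> 1 / y"
  proof -
    have "1 / y < 1" using y1 by simp
    then show ?thesis using y1 by linarith
  qed
  have "y + 1 / y = ((s + 1) * (s + 1) + (s - 1) * (s - 1)) / ((s - 1) * (s + 1))"
    unfolding yi y_def using s by (simp add: add_frac_eq)
  also have "\<dots> = 2 * ((s * s + 1) / (s * s - 1))"
    by (simp add: algebra_simps)
  also have "(s * s + 1) / (s * s - 1) = (M + m) / (M - m)"
    unfolding ss using m by (simp add: field_simps)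
  finally have th: "2 * ((M + m) / (M - m)) = y + 1 / y" by simp
  have f: "fst (cheb_pair ((M + m) / (M - m)) n) = (y ^ Suc n + (1 / y) ^ Suc n) / 2"
    using cheb_pair_closed_form(1)[OF _ yne th] y1 by simp
  have yp: "0 < y ^ Suc n" "0 < (1 / y) ^ Suc n" using y1 by auto
  have half: "a / 2 \<le> (a + b) / 2 \<and> 0 < (a + b) / 2" if "0 < a" "0 < b" for a b :: real
    using that by simp
  show pos: "0 < fst (cheb_pair ((M + m) / (M - m)) n)"
    unfolding f using half[OF yp] by blast
  have "y ^ Suc n / 2 \<le> fst (cheb_pair ((M + m) / (M - m)) n)"
    unfolding f using half[OF yp] by blast
  then have "inverse (fst (cheb_pair ((M + m) / (M - m)) n)) \<le> inverse (y ^ Suc n / 2)"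
    using yp by (intro le_imp_inverse_le) auto
  also have "\<dots> = 2 * (1 / y) ^ Suc n" using y1 by (simp add: field_simps)
  finally show "inverse (fst (cheb_pair ((M + m) / (M - m)) n))
      \<le> 2 * ((sqrt (M / m) - 1) / (sqrt (M / m) + 1)) ^ Suc n"
    unfolding yi s_def .
qed

context inner_form
begin

text \<open>The residual of a Krylov approximation is \<open>r(L) e\<close> for a polynomial \<open>r\<close> with \<open>r(0) = 1\<close>.  The best
  choice is a Chebyshev polynomial, transplanted from \<open>[-1, 1]\<close> to \<open>[m, M]\<close> by the operator
  \<open>X = \<theta> - \<sigma> L\<close> and normalised at \<open>0\<close>, which corresponds to \<open>\<theta> = (M + m) / (M - m)\<close>.  That the
  Chebyshev polynomial \<open>t = T\<^sub>k(X) e\<close> is not longer than \<open>e\<close> follows without diagonalising \<open>X\<close> from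
  Pell's identity \<open>T\<^sub>k(X)\<^sup>2 + (1 - X\<^sup>2) U\<^sub>k\<^sub>-\<^sub>1(X)\<^sup>2 = 1\<close>, in which \<open>1 - X\<^sup>2\<close> is positive.\<close>

lemma krylov_Chebyshev:
  assumes L: "selfadjoint_on V ip L" and mM: "0 < m" "m \<le> M" and e: "e \<in> V"
    and lower: "\<And>v. v \<in> V \<Longrightarrow> m * Re (ip v v) \<le> Re (ip (L v) v)"
    and upper: "\<And>v. v \<in> V \<Longrightarrow> Re (ip (L v) v) \<le> M * Re (ip v v)"
  shows "\<exists>w\<in>krylov L (Suc n) (L e).
      nrm (e - w) \<le> 2 * ((sqrt (M / m) - 1) / (sqrt (M / m) + 1)) ^ Suc n * nrm e"
proof -
  have lin: "linear_map V V L" using L by (simp add: selfadjoint_on_def)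
  note LV = linear_map_in[OF lin]
  note K_add = fun_vs.subspace_add[OF subspace_krylov] and K_diff = fun_vs.subspace_diff[OF subspace_krylov]
    and K_scale = fun_vs.subspace_scale[OF subspace_krylov]
  show ?thesis
  proof (cases "m = M")
    case True
    \<comment> \<open>here \<open>L = m\<close>, and one step is exact\<close>
    have sa: "selfadjoint_on V ip (\<lambda>v. complex_of_real (- m) *\<^sub>c v + complex_of_real 1 *\<^sub>c L v)"
      by (rule selfadjoint_affine[OF L])
    have zero: "Re (ip (complex_of_real (- m) *\<^sub>c v + complex_of_real 1 *\<^sub>c L v) v) = 0" if "v \<in> V" for v
      using that LV lower[OF that] upper[OF that] True by (simp add: ip_expand)
    interpret h: psd_form V "\<lambda>u v. ip (complex_of_real (- m) *\<^sub>c u + complex_of_real 1 *\<^sub>c L u) v"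
      by (rule selfadjoint_psd_form[OF sa]) (use zero in auto)
    define d where "d = complex_of_real (- m) *\<^sub>c e + complex_of_real 1 *\<^sub>c L e"
    have dV: "d \<in> V" using e LV by (simp add: d_def)
    have "(cmod (ip d d))\<^sup>2 \<le> 0"
      using h.Cauchy_Schwarz[OF e dV] unfolding zero[OF e] unfolding d_def[symmetric] by simp
    then have "d = 0" using ip_definite[OF dV] by simp
    then have Le: "L e = complex_of_real m *\<^sub>c e"
      by (simp add: d_def)
    have "complex_of_real (1 / m) *\<^sub>c L e \<in> krylov L (Suc n) (L e)"
      by (rule K_scale[OF krylov_start])
    moreover have "e - complex_of_real (1 / m) *\<^sub>c L e = 0"
      using mM unfolding Le by (simp flip: of_real_inverse of_real_mult)
    ultimately show ?thesis using mM True nrm_zero by (intro bexI) auto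
  next
    case False
    then have mM': "m < M" using mM by simp
    define \<theta> \<sigma> where "\<theta> = (M + m) / (M - m)" and "\<sigma> = 2 / (M - m)"
    define X where "X = (\<lambda>v. complex_of_real \<theta> *\<^sub>c v + complex_of_real (- \<sigma>) *\<^sub>c L v)"
    have X: "selfadjoint_on V ip X" unfolding X_def by (rule selfadjoint_affine[OF L])
    have Xlin: "linear_map V V X" using X by (simp add: selfadjoint_on_def)
    note XV = linear_map_in[OF Xlin]
    have Xb: "\<bar>Re (ip (X v) v)\<bar> \<le> Re (ip v v)" if v: "v \<in> V" for v
    proof -
      define a b where "a = Re (ip v v)" and "b = Re (ip (L v) v)"
      have "Re (ip (X v) v) = ((M + m) * a - 2 * b) / (M - m)"
        using v LV by (simp add: X_def ip_expand \<theta>_def \<sigma>_def a_def b_def diff_divide_distrib)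
      moreover have "\<bar>(M + m) * a - 2 * b\<bar> \<le> a * (M - m)"
        using lower[OF v] upper[OF v] unfolding a_def[symmetric] b_def[symmetric] abs_le_iff
        by (auto simp: algebra_simps)
      ultimately show ?thesis
        using mM' by (simp add: a_def[symmetric] divide_le_eq)
    qed
    \<comment> \<open>the recursion of \<open>cheb_pair\<close> with \<open>X\<close> in place of the number\<close>
    define TU where "TU = rec_nat (X e, e) (\<lambda>_ (t, u). (X (X u + t) - u, X u + t))"
    define t u where "t j = fst (TU j)" and "u j = snd (TU j)" for j
    have t0: "t 0 = X e" "u 0 = e" by (simp_all add: t_def u_def TU_def)
    have ts: "u (Suc j) = X (u j) + t j" "t (Suc j) = X (u (Suc j)) - u j" for j
      by (simp_all add: t_def u_def TU_def split: prod.split)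
    define \<tau> \<upsilon> where "\<tau> j = fst (cheb_pair \<theta> j)" and "\<upsilon> j = snd (cheb_pair \<theta> j)" for j
    have \<tau>0: "\<tau> 0 = \<theta>" "\<upsilon> 0 = 1" by (simp_all add: \<tau>_def \<upsilon>_def)
    have \<tau>s: "\<upsilon> (Suc j) = \<theta> * \<upsilon> j + \<tau> j" "\<tau> (Suc j) = \<theta> * \<upsilon> (Suc j) - \<upsilon> j" for j
      by (simp_all add: \<tau>_def \<upsilon>_def Let_def split: prod.split)
    have tuV: "t j \<in> V \<and> u j \<in> V" for j
      by (induction j) (auto simp: t0 ts e XV)
    have inv: "Re (ip (t j) (t j)) + (Re (ip (u j) (u j)) - Re (ip (X (u j)) (X (u j)))) = Re (ip e e)" for j
    proof (induction j)
      case 0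
      show ?case by (simp add: t0)
    next
      case (Suc j)
      have V: "u j \<in> V" "t j \<in> V" "u (Suc j) \<in> V" "X (u j) \<in> V" "X (u (Suc j)) \<in> V"
        using tuV XV by auto
      have "t j = u (Suc j) - X (u j)" by (simp add: ts)
      then have "Re (ip (t j) (t j)) = Re (ip (u (Suc j)) (u (Suc j)))
          - 2 * Re (ip (u (Suc j)) (X (u j))) + Re (ip (X (u j)) (X (u j)))"
        using Re_ip_diff[OF V(3,4)] by simp
      moreover have "Re (ip (t (Suc j)) (t (Suc j))) = Re (ip (X (u (Suc j))) (X (u (Suc j))))
          - 2 * Re (ip (X (u (Suc j))) (u j)) + Re (ip (u j) (u j))"
        unfolding ts(2) using Re_ip_diff[OF V(5,1)] by simp
      moreover have "ip (X (u (Suc j))) (u j) = ip (u (Suc j)) (X (u j))"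
        using X V by (simp add: selfadjoint_on_def)
      ultimately show ?case using Suc by simp
    qed
    have Le: "L e \<in> V" by (rule LV[OF e])
    have KV: "krylov L j (L e) \<subseteq> V" for j by (rule krylov_subset[OF lin subspace Le])
    \<comment> \<open>modulo the Krylov space, \<open>X\<close> acts on multiples of \<open>e\<close> as the number \<open>\<theta>\<close>\<close>
    have XK: "X v - complex_of_real (\<theta> * a) *\<^sub>c e \<in> krylov L (Suc j) (L e)"
      if v: "v - complex_of_real a *\<^sub>c e \<in> krylov L j (L e)" for v a j
    proof -
      define w where "w = v - complex_of_real a *\<^sub>c e"
      have w: "w \<in> krylov L j (L e)" "w \<in> krylov L (Suc j) (L e)" "w \<in> V"
        using v KV krylov_mono[of j "Suc j" L "L e"] by (auto simp: w_def)
      have vw: "v = w + complex_of_real a *\<^sub>c e" by (simp add: w_def)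
      have "L v = L w + complex_of_real a *\<^sub>c L e"
        unfolding vw using w e by (simp add: linear_map_add[OF lin] linear_map_scale[OF lin])
      then have "X v - complex_of_real (\<theta> * a) *\<^sub>c e = complex_of_real \<theta> *\<^sub>c w
          + complex_of_real (- \<sigma>) *\<^sub>c (L w + complex_of_real a *\<^sub>c L e)"
        unfolding X_def vw by (simp add: fun_vs.scale_right_distrib fun_vs.scale_scale)
      also have "\<dots> \<in> krylov L (Suc j) (L e)"
        by (intro K_add K_scale w krylov_step[OF lin subspace Le] krylov_start)
      finally show ?thesis .
    qed
    have kry: "u j - complex_of_real (\<upsilon> j) *\<^sub>c e \<in> krylov L j (L e) \<and>
       t j - complex_of_real (\<tau> j) *\<^sub>c e \<in> krylov L (Suc j) (L e)" for j
    proof (induction j)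
      case 0
      have "e - complex_of_real 1 *\<^sub>c e \<in> krylov L 0 (L e)"
        using fun_vs.subspace_0[OF subspace_krylov] by simp
      from XK[OF this] show ?case
        using fun_vs.subspace_0[OF subspace_krylov] by (simp add: t0 \<tau>0)
    next
      case (Suc j)
      have "u (Suc j) - complex_of_real (\<upsilon> (Suc j)) *\<^sub>c e
          = (X (u j) - complex_of_real (\<theta> * \<upsilon> j) *\<^sub>c e) + (t j - complex_of_real (\<tau> j) *\<^sub>c e)"
        by (simp add: ts \<tau>s fun_vs.scale_left_distrib)
      also have "\<dots> \<in> krylov L (Suc j) (L e)"
        using Suc XK by (intro K_add) auto
      finally have U: "u (Suc j) - complex_of_real (\<upsilon> (Suc j)) *\<^sub>c e \<in> krylov L (Suc j) (L e)" .
      have "t (Suc j) - complex_of_real (\<tau> (Suc j)) *\<^sub>c e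
          = (X (u (Suc j)) - complex_of_real (\<theta> * \<upsilon> (Suc j)) *\<^sub>c e) - (u j - complex_of_real (\<upsilon> j) *\<^sub>c e)"
        by (simp add: ts(2) \<tau>s(2) fun_vs.scale_left_diff_distrib)
      also have "\<dots> \<in> krylov L (Suc (Suc j)) (L e)"
        using Suc krylov_mono[of j "Suc (Suc j)" L "L e"] by (intro K_diff[OF XK[OF U]]) auto
      finally show ?case using U by blast
    qed
    have \<tau>: "inverse (\<tau> n) \<le> 2 * ((sqrt (M / m) - 1) / (sqrt (M / m) + 1)) ^ Suc n" "0 < \<tau> n"
      unfolding \<tau>_def \<theta>_def using cheb_pair_lower_bound[OF mM(1) mM'] by auto
    define w where "w = complex_of_real (- inverse (\<tau> n)) *\<^sub>c (t n - complex_of_real (\<tau> n) *\<^sub>c e)"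
    have wK: "w \<in> krylov L (Suc n) (L e)" unfolding w_def using kry by (intro K_scale) blast
    have "e - w = complex_of_real (inverse (\<tau> n)) *\<^sub>c t n"
      using \<tau>(2) by (simp add: w_def fun_eq_iff pointwise field_simps)
    then have "nrm (e - w) = inverse (\<tau> n) * nrm (t n)"
      using tuV \<tau>(2) by (simp add: nrm_scale norm_inverse)
    moreover have "nrm (t n) \<le> nrm e"
      unfolding nrm_def using inv[of n] selfadjoint_contraction[OF X _ Xb, of "u n"] tuV
      by (intro real_sqrt_le_mono) auto
    moreover have "0 \<le> 2 * ((sqrt (M / m) - 1) / (sqrt (M / m) + 1)) ^ Suc n"
      by (rule order_trans[OF _ \<tau>(1)]) (use \<tau>(2) in simp)
    ultimately have "nrm (e - w)
        \<le> 2 * ((sqrt (M / m) - 1) / (sqrt (M / m) + 1)) ^ Suc n * nrm e"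
      using mult_mono[OF \<tau>(1)] tuV nrm_nonneg by metis
    then show ?thesis using wK by blast
  qed
qed

end

lemma hermitian_posdef_inner_form:
  assumes G: "hermitian_posdef V G" and V: "fun_vs.subspace V"
    and cnj: "\<And>v. v \<in> V \<Longrightarrow> conj_fun v \<in> V"
  shows "inner_form V (\<lambda>u v. G u (conj_fun v))"
proof
  have lin: "linear_map V (dual V) G" using G by (simp add: hermitian_posdef_def)
  have G0: "G 0 = 0" by (rule linear_map_zero[OF lin V])
  show "G (u + v) (conj_fun w) = G u (conj_fun w) + G v (conj_fun w)" if "u \<in> V" "v \<in> V" for u v w
    using that by (simp add: linear_map_add[OF lin] pointwise)
  show "G (c *\<^sub>c u) (conj_fun w) = c * G u (conj_fun w)" if "u \<in> V" for c u w
    using that by (simp add: linear_map_scale[OF lin] pointwise)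
  show "G v (conj_fun u) = cnj (G u (conj_fun v))" if "u \<in> V" "v \<in> V" for u v
    using G that unfolding hermitian_posdef_def by blast
  have pos: "0 < Re (G v (conj_fun v))" if "v \<in> V" "v \<noteq> 0" for v
    using G that unfolding hermitian_posdef_def zero_fun_def by blast
  show "0 \<le> Re (G v (conj_fun v))" if "v \<in> V" for v
    using pos[OF that] G0 by (cases "v = 0") (auto simp: pointwise)
  show "v = 0" if "v \<in> V" "Re (G v (conj_fun v)) = 0" for v
    using pos[OF that(1)] that(2) by auto
qed (rule V)

lemma hermitian_posdef_bij:
  assumes G: "hermitian_posdef V G" and V: "fin_dim V"
  shows "bij_betw G V (dual V)"
proof (rule linear_to_dual_bij[OF V])
  show "linear_map V (dual V) G" using G by (simp add: hermitian_posdef_def)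
  show "v = 0" if v: "v \<in> V" "G v = 0" for v
  proof (rule ccontr)
    assume "v \<noteq> 0"
    then have "0 < Re (G v (conj_fun v))"
      using G v(1) unfolding hermitian_posdef_def zero_fun_def by blast
    then show False using v(2) by (simp add: pointwise)
  qed
qed

text \<open>In the energy inner product of \<open>G\<close>, the form of the preconditioned operator is the hermitian
  form of \<open>P\<close> evaluated at the functionals \<open>G v\<close>.\<close>

lemma preconditioned_selfadjoint:
  assumes G: "hermitian_posdef V G" and P: "hermitian_posdef_dual V P" and V: "fun_vs.subspace V"
    and cnj: "\<And>v. v \<in> V \<Longrightarrow> conj_fun v \<in> V"
  shows "selfadjoint_on V (\<lambda>u v. G u (conj_fun v)) (\<lambda>v. P (G v))"
    and "\<And>v. v \<in> V \<Longrightarrow> v \<noteq> 0 \<Longrightarrow> 0 < Re (G (P (G v)) (conj_fun v))"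
proof -
  have G': "linear_map V (dual V) G" and P': "linear_map (dual V) V P"
    using G P by (auto simp: hermitian_posdef_def hermitian_posdef_dual_def)
  note GV = linear_map_in[OF G'] and PV = linear_map_in[OF P']
  have herm: "G u (conj_fun v) = cnj (G v (conj_fun u))" if "u \<in> V" "v \<in> V" for u v
    using G that unfolding hermitian_posdef_def by blast
  have eq: "G (P (G u)) (conj_fun v) = conj_dual (G v) (P (G u))" if "u \<in> V" "v \<in> V" for u v
    using herm[of "P (G u)" v] that GV PV by (simp add: conj_dual_def)
  show "selfadjoint_on V (\<lambda>u v. G u (conj_fun v)) (\<lambda>v. P (G v))"
    unfolding selfadjoint_on_def
  proof (intro conjI ballI linear_map_comp[OF G' P'])
    fix u v assume uv: "u \<in> V" "v \<in> V"
    have "conj_dual (G v) (P (G u)) = cnj (conj_dual (G u) (P (G v)))"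
      using P uv GV unfolding hermitian_posdef_dual_def by blast
    also have "\<dots> = G u (conj_fun (P (G v)))" by (simp add: conj_dual_def)
    finally show "G (P (G u)) (conj_fun v) = G u (conj_fun (P (G v)))" using eq uv by simp
  qed
  show "0 < Re (G (P (G v)) (conj_fun v))" if v: "v \<in> V" "v \<noteq> 0" for v
  proof -
    have "0 < Re (G v (conj_fun v))" using G v unfolding hermitian_posdef_def zero_fun_def by blast
    then have "G v \<noteq> 0" by (auto simp: pointwise)
    then show ?thesis
      using P v GV unfolding eq[OF v(1) v(1)] hermitian_posdef_dual_def zero_fun_def by blast
  qed
qed

text \<open>The iterate is an orthogonal projection in the energy inner product.  It exists, is unique, and
  beats the Chebyshev choice from the same Krylov space.\<close>

lemma pcg_error_bound:
  fixes V :: "('x \<Rightarrow> complex) set"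
  assumes G: "hermitian_posdef V G" and P: "hermitian_posdef_dual V P" and V: "fin_dim V"
    and cnj: "\<And>v. v \<in> V \<Longrightarrow> conj_fun v \<in> V" and nontriv: "\<exists>v\<in>V. v \<noteq> 0" and k: "1 \<le> k"
    and \<epsilon>: "\<epsilon> = 2 * ((sqrt (cond_on V (\<lambda>v. P (G v))) - 1) / (sqrt (cond_on V (\<lambda>v. P (G v))) + 1)) ^ k"
  shows "0 \<le> \<epsilon>"
    and "\<And>x0 b. x0 \<in> V \<Longrightarrow> b \<in> dual V \<Longrightarrow> pcg V G P k x0 b \<in> V \<and>
      energy_norm G (inv_into V G b - pcg V G P k x0 b) \<le> \<epsilon> * energy_norm G (inv_into V G b - x0)"
proof -
  define ip where "ip = (\<lambda>u v. G u (conj_fun v))"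
  define L where "L = (\<lambda>v. P (G v))"
  have Vs: "fun_vs.subspace V" by (rule fin_dim_subspace[OF V])
  interpret i: inner_form V ip
    unfolding ip_def by (rule hermitian_posdef_inner_form[OF G Vs cnj])
  have en: "energy_norm G v = i.nrm v" for v
    unfolding energy_norm_def i.nrm_def by (simp add: ip_def)
  have L: "selfadjoint_on V ip L" and Lpos: "\<And>v. v \<in> V \<Longrightarrow> v \<noteq> 0 \<Longrightarrow> 0 < Re (ip (L v) v)"
    unfolding ip_def L_def using preconditioned_selfadjoint[OF G P Vs cnj] by auto
  have lin: "linear_map V V L" using L by (simp add: selfadjoint_on_def)
  obtain m M where mM: "0 < m" "m \<le> M" "cond_on V L = M / m"
    "\<forall>v\<in>V. m * Re (ip v v) \<le> Re (ip (L v) v)"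
    "\<forall>v\<in>V. Re (ip (L v) v) \<le> M * Re (ip v v)"
    using i.cond_on_Rayleigh[OF V nontriv L Lpos] by auto
  have \<epsilon>': "\<epsilon> = 2 * ((sqrt (M / m) - 1) / (sqrt (M / m) + 1)) ^ k"
    using \<epsilon> mM(3) by (simp add: L_def)
  have "1 \<le> sqrt (M / m)" using mM(1,2) by simp
  then show "0 \<le> \<epsilon>" unfolding \<epsilon>' by simp
  fix x0 b assume x0: "x0 \<in> V" and b: "b \<in> dual V"
  have bij: "bij_betw G V (dual V)" by (rule hermitian_posdef_bij[OF G V])
  define xs where "xs = inv_into V G b"
  have xs: "xs \<in> V" "G xs = b"
    using bij b by (auto simp: xs_def bij_betw_def inv_into_into f_inv_into_f)
  define e where "e = xs - x0"
  have e: "e \<in> V" using xs x0 by (simp add: e_def)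
  define r0 where "r0 = (\<lambda>x. P b x - P (G x0) x)"
  \<comment> \<open>the first residual is the operator applied to the initial error\<close>
  have r0: "r0 = L e"
  proof -
    have "L e = L xs - L x0" unfolding e_def by (rule linear_map_diff[OF lin Vs xs(1) x0])
    then show ?thesis by (simp add: r0_def L_def xs fun_diff_def)
  qed
  have LeV: "L e \<in> V" by (rule linear_map_in[OF lin e])
  define F where "F = (\<lambda>i. (L ^^ i) (L e)) ` {..<k}"
  have F: "finite F" "F \<subseteq> V" "krylov L k (L e) = fun_vs.span F"
    using krylov_generators[OF lin LeV, of k] by (auto simp: F_def krylov_span)
  obtain w where w: "w \<in> fun_vs.span F"
    "\<And>w'. w' \<in> fun_vs.span F \<Longrightarrow> i.nrm (e - w) \<le> i.nrm (e - w')"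
    "\<And>w'. w' \<in> fun_vs.span F \<Longrightarrow> i.nrm (e - w') \<le> i.nrm (e - w) \<Longrightarrow> w' = w"
    using i.best_approximation[OF F(1,2) e] by blast
  define X where "X = {\<eta>. \<exists>w\<in>krylov L k r0. \<eta> = (\<lambda>x. x0 x + w x)}"
  define err where "err = (\<lambda>\<eta>. energy_norm G (\<lambda>x. xs x - \<eta> x))"
  have X: "\<eta> \<in> X \<longleftrightarrow> \<eta> - x0 \<in> fun_vs.span F" for \<eta>
  proof -
    have "\<eta> \<in> X \<longleftrightarrow> (\<exists>w\<in>fun_vs.span F. \<eta> = x0 + w)"
      by (simp add: X_def r0 F plus_fun_def)
    also have "\<dots> \<longleftrightarrow> \<eta> - x0 \<in> fun_vs.span F"
      by (auto intro!: bexI[of _ "\<eta> - x0"])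
    finally show ?thesis .
  qed
  have err: "err \<eta> = i.nrm (e - (\<eta> - x0))" for \<eta>
    by (simp add: err_def en e_def fun_diff_def)
  have "pcg V G P k x0 b = (THE \<eta>. \<eta> \<in> X \<and> (\<forall>\<eta>'\<in>X. err \<eta> \<le> err \<eta>'))"
    by (simp add: pcg_def Let_def X_def err_def r0_def L_def xs_def)
  also have "\<dots> = x0 + w"
  proof (rule the_equality)
    show "x0 + w \<in> X \<and> (\<forall>\<eta>'\<in>X. err (x0 + w) \<le> err \<eta>')"
      using w(1,2) by (simp add: X err)
    fix \<eta> assume "\<eta> \<in> X \<and> (\<forall>\<eta>'\<in>X. err \<eta> \<le> err \<eta>')"
    then have "\<eta> - x0 \<in> fun_vs.span F" "err \<eta> \<le> err (x0 + w)" using X w(1) by auto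
    then have "\<eta> - x0 = w" using w(3) by (simp add: err)
    then show "\<eta> = x0 + w" by (simp add: algebra_simps)
  qed
  finally have pcg: "pcg V G P k x0 b = x0 + w" .
  have wV: "w \<in> V" using w(1) F(2) i.span_in_V by blast
  obtain n where n: "k = Suc n" using k by (cases k) auto
  obtain w' where "w' \<in> fun_vs.span F" "i.nrm (e - w') \<le> \<epsilon> * i.nrm e"
    using i.krylov_Chebyshev[OF L mM(1,2) e bspec[OF mM(4)] bspec[OF mM(5)], of n] F(3) unfolding \<epsilon>' n by auto
  then have "i.nrm (e - w) \<le> \<epsilon> * i.nrm e" using w(2) by fastforce
  moreover have "xs - pcg V G P k x0 b = e - w" unfolding pcg by (simp add: e_def diff_diff_add)
  ultimately have "i.nrm (xs - pcg V G P k x0 b) \<le> \<epsilon> * i.nrm e" by (simp only:)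
  moreover have "pcg V G P k x0 b \<in> V" unfolding pcg using x0 wV by simp
  ultimately show "pcg V G P k x0 b \<in> V \<and>
      energy_norm G (inv_into V G b - pcg V G P k x0 b) \<le> \<epsilon> * energy_norm G (inv_into V G b - x0)"
    unfolding en xs_def[symmetric] e_def[symmetric] by blast
qed

section \<open>Relaxed Richardson iteration with recycled inexact solves\<close>

text \<open>Here \<open>a n\<close> is the size of the \<open>n\<close>-th update, \<open>b n\<close> the size of the \<open>n\<close>-th inner error and \<open>s\<^sup>2\<close>
  the reduction factor of the inner solver, which starts from its previous result and therefore
  sees the previous inner error and the previous update.  The weighted sum \<open>a n + t * b n\<close> decays
  by the factor \<open>\<rho> + 2 * s\<close>.  The weight \<open>t\<close> must be of order \<open>1 / s\<close>: small enough for \<open>s\<^sup>2 * t\<close> to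
  be of order \<open>s\<close>, and large enough for \<open>s * t\<close> to absorb the influence of the inner error on the
  update.  For \<open>s = 0\<close> all inner errors vanish.\<close>

lemma recycled_recursion:
  fixes a b :: "nat \<Rightarrow> real"
  assumes \<alpha>: "0 \<le> \<alpha>" "\<alpha> \<le> 1" and s: "0 \<le> s" "s \<le> 1 / 4" and \<rho>: "0 \<le> \<rho>"
    and nonneg: "\<And>n. 0 \<le> a n" "\<And>n. 0 \<le> b n" and b0: "b 0 = 0"
    and b: "\<And>n. b (Suc n) \<le> s\<^sup>2 * (b n + a n)"
    and a: "\<And>n. a (Suc n) \<le> \<rho> * a n + 2 * \<alpha> * (b (Suc n) + b n)"
  shows "a n + 2 * \<alpha> * b n \<le> (\<rho> + 2 * s) ^ n * a 0"
proof (cases "s = 0")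
  case True
  have bz: "b n = 0" for n
    using b0 b[of "n - 1"] nonneg(2)[of n] True by (cases n) auto
  have "a n \<le> \<rho> ^ n * a 0" for n
  proof (induction n)
    case (Suc n)
    have "a (Suc n) \<le> \<rho> * a n" using a[of n] bz by simp
    also have "\<dots> \<le> \<rho> * (\<rho> ^ n * a 0)" using Suc \<rho> by (intro mult_left_mono)
    finally show ?case by (simp add: mult.assoc)
  qed simp
  then show ?thesis using True bz by simp
next
  case False
  \<comment> \<open>then \<open>(2 * \<alpha> + t) * s\<^sup>2 = 2 * s\<close>, which is exactly the permitted loss in front of \<open>a n\<close>\<close>
  define t where "t = 2 / s - 2 * \<alpha>"
  have sp: "0 < s" using s False by simp
  have "8 \<le> 2 / s" using sp s(2) by (simp add: field_simps)
  then have t: "2 * \<alpha> \<le> t" using \<alpha> by (simp add: t_def)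
  have st: "2 * s * t = 4 - 4 * \<alpha> * s" using sp by (simp add: t_def field_simps)
  have "\<alpha> * s \<le> 1 * (1 / 4)" using \<alpha> s by (intro mult_mono) auto
  then have "2 * \<alpha> + 2 * s \<le> 2 * s * t" unfolding st using \<alpha> s by simp
  also have "\<dots> \<le> (\<rho> + 2 * s) * t" using \<rho> t \<alpha> by (simp add: algebra_simps)
  finally have weight: "2 * \<alpha> + 2 * s \<le> (\<rho> + 2 * s) * t" .
  have "a n + t * b n \<le> (\<rho> + 2 * s) ^ n * a 0" for n
  proof (induction n)
    case 0
    show ?case by (simp add: b0)
  next
    case (Suc n)
    have "a (Suc n) + t * b (Suc n) \<le> \<rho> * a n + 2 * \<alpha> * b n + (2 / s) * b (Suc n)"
      using a[of n] by (simp add: t_def algebra_simps)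
    also have "(2 / s) * b (Suc n) \<le> (2 / s) * (s\<^sup>2 * (b n + a n))"
      using b[of n] sp by (intro mult_left_mono) auto
    also have "(2 / s) * (s\<^sup>2 * (b n + a n)) = 2 * s * (b n + a n)"
      using sp by (simp add: power2_eq_square)
    finally have "a (Suc n) + t * b (Suc n) \<le> (\<rho> + 2 * s) * a n + (2 * \<alpha> + 2 * s) * b n"
      by (simp add: algebra_simps)
    also have "\<dots> \<le> (\<rho> + 2 * s) * a n + (\<rho> + 2 * s) * t * b n"
      using weight nonneg(2)[of n] by (intro add_left_mono mult_right_mono)
    also have "\<dots> = (\<rho> + 2 * s) * (a n + t * b n)" by (simp add: algebra_simps)
    also have "\<dots> \<le> (\<rho> + 2 * s) * ((\<rho> + 2 * s) ^ n * a 0)"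
      using Suc \<rho> sp by (intro mult_left_mono) auto
    finally show ?case by (simp add: mult.assoc)
  qed
  moreover have "2 * \<alpha> * b n \<le> t * b n" using t nonneg(2)[of n] by (intro mult_right_mono)
  ultimately show ?thesis by (smt (verit))
qed

context inner_form
begin

text \<open>The squared norm of a convex combination of two vectors falls short of the same combination of
  their squared norms by \<open>\<alpha> (1 - \<alpha>)\<close> times their squared distance.  Here the vectors are \<open>u\<close> and
  \<open>-w\<close>.\<close>

lemma Re_ip_relaxation:
  assumes u: "u \<in> V" and w: "w \<in> V"
  shows "Re (ip (complex_of_real (1 - \<alpha>) *\<^sub>c u - complex_of_real \<alpha> *\<^sub>c w)
               (complex_of_real (1 - \<alpha>) *\<^sub>c u - complex_of_real \<alpha> *\<^sub>c w))
    = (1 - \<alpha>) * Re (ip u u) + \<alpha> * Re (ip w w) - \<alpha> * (1 - \<alpha>) * Re (ip (u + w) (u + w))"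
proof -
  have "Re (ip (complex_of_real (1 - \<alpha>) *\<^sub>c u - complex_of_real \<alpha> *\<^sub>c w)
               (complex_of_real (1 - \<alpha>) *\<^sub>c u - complex_of_real \<alpha> *\<^sub>c w))
    = (1 - \<alpha>)\<^sup>2 * Re (ip u u) - 2 * (\<alpha> * (1 - \<alpha>) * Re (ip u w)) + \<alpha>\<^sup>2 * Re (ip w w)"
  proof -
    have "Re (ip (complex_of_real (1 - \<alpha>) *\<^sub>c u) (complex_of_real \<alpha> *\<^sub>c w)) = \<alpha> * (1 - \<alpha>) * Re (ip u w)"
      using u w by (simp add: ip_scale_left ip_scale_right flip: of_real_diff)
    then show ?thesis
      using Re_ip_diff[of "complex_of_real (1 - \<alpha>) *\<^sub>c u" "complex_of_real \<alpha> *\<^sub>c w"] u w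
        Re_ip_scale[OF u, of "complex_of_real (1 - \<alpha>)"] Re_ip_scale[OF w, of "complex_of_real \<alpha>"]
      by (simp only: closed norm_of_real power2_abs)
  qed
  then show ?thesis
    unfolding Re_ip_add[OF u w] by (simp add: power2_eq_square algebra_simps)
qed

text \<open>\<open>K\<close> is only nonexpansive; relaxation makes the iteration map \<open>E\<close> a contraction if \<open>\<gamma> > 0\<close>, with
  \<open>\<rho>\<^sup>2 \<le> 1 - \<alpha> (1 - \<alpha>) \<gamma>\<^sup>2\<close> by the preceding identity.  The smallness of \<open>\<epsilon>\<close> leaves room for the
  perturbation by the inner errors \<open>d n\<close>, and it contains the assertion that \<open>\<gamma>\<close> does not vanish, so
  that \<open>1 + K\<close> is injective, hence bijective.  The distance to the solution is bounded by the current
  update and the current inner error, since \<open>1 - E\<close> has a bounded inverse; so the estimate holds at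
  each step separately and no series of updates has to be summed.\<close>

lemma recycled_Richardson:
  fixes v d :: "nat \<Rightarrow> 'x \<Rightarrow> complex"
  assumes V: "fin_dim V" and nontriv: "\<exists>v\<in>V. v \<noteq> 0"
    and K: "linear_map V V K" and contr: "\<And>u. u \<in> V \<Longrightarrow> nrm (K u) \<le> nrm u"
    and \<alpha>: "0 < \<alpha>" "\<alpha> < 1"
    and \<rho>: "\<rho> = (SUP u\<in>V - {0}. nrm (complex_of_real (1 - \<alpha>) *\<^sub>c u - complex_of_real \<alpha> *\<^sub>c K u) / nrm u)"
    and \<gamma>: "\<gamma> = (INF u\<in>V - {0}. nrm (u + K u) / nrm u)"
    and \<epsilon>: "0 \<le> \<epsilon>" "\<epsilon> < (\<alpha> * (1 - \<alpha>) * \<gamma>\<^sup>2 / 4)\<^sup>2"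
    and v: "\<And>n. v n \<in> V" "v 0 = 0" and d: "\<And>n. d n \<in> V" "d 0 = 0" and g: "g \<in> V"
    and step: "\<And>n. v (Suc n) = complex_of_real (1 - \<alpha>) *\<^sub>c v n - complex_of_real \<alpha> *\<^sub>c K (v n)
        + complex_of_real \<alpha> *\<^sub>c g + complex_of_real (2 * \<alpha>) *\<^sub>c d n"
    and recycle: "\<And>n. nrm (d (Suc n)) \<le> \<epsilon> * (nrm (d n) + nrm (v (Suc n) - v n))"
  shows "0 \<le> \<rho>" and "\<rho> + 2 * sqrt \<epsilon> < 1"
    and "\<epsilon> < (\<alpha> * (1 - \<alpha>) * \<gamma>\<^sup>2 / 8)\<^sup>2 \<Longrightarrow> \<rho> + 4 * sqrt \<epsilon> < 1"
    and "\<exists>z\<in>V. (\<forall>u\<in>V. u + K u = g \<longleftrightarrow> u = z) \<and>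
      (\<forall>n. nrm (v n - z) \<le> nrm (v 1) / (1 - (\<rho> + 2 * sqrt \<epsilon>)) * (\<rho> + 2 * sqrt \<epsilon>) ^ n)"
proof -
  define E where "E u = complex_of_real (1 - \<alpha>) *\<^sub>c u - complex_of_real \<alpha> *\<^sub>c K u" for u
  note KV = linear_map_in[OF K]
  have EV: "E u \<in> V" if "u \<in> V" for u using that KV by (simp add: E_def)
  have Vne: "V - {0} \<noteq> {}" using nontriv by auto
  have \<gamma>_bdd: "bdd_below ((\<lambda>u. nrm (u + K u) / nrm u) ` (V - {0}))"
    by (rule bdd_belowI2[of _ 0]) (auto intro!: divide_nonneg_nonneg nrm_nonneg simp: KV)
  have \<gamma>0: "0 \<le> \<gamma>"
    unfolding \<gamma> by (rule cINF_greatest[OF Vne]) (auto intro!: divide_nonneg_nonneg nrm_nonneg simp: KV)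
  have \<gamma>_le: "\<gamma> * nrm u \<le> nrm (u + K u)" if u: "u \<in> V" for u
  proof (cases "u = 0")
    case False
    then have "\<gamma> \<le> nrm (u + K u) / nrm u"
      unfolding \<gamma> using u by (intro cINF_lower[OF \<gamma>_bdd]) auto
    then show ?thesis using nrm_pos[OF u False] by (simp add: field_simps)
  qed (use u KV nrm_zero nrm_nonneg in simp)
  define c where "c = \<alpha> * (1 - \<alpha>) * \<gamma>\<^sup>2"
  have c0: "0 \<le> c" using \<alpha> by (simp add: c_def)
  have E_sq: "(nrm (E u))\<^sup>2 \<le> (1 - c) * (nrm u)\<^sup>2" if u: "u \<in> V" for u
  proof -
    have "(nrm (E u))\<^sup>2 = (1 - \<alpha>) * (nrm u)\<^sup>2 + \<alpha> * (nrm (K u))\<^sup>2 - \<alpha> * (1 - \<alpha>) * (nrm (u + K u))\<^sup>2"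
      using Re_ip_relaxation[OF u KV[OF u], of \<alpha>] u KV EV[OF u] by (simp add: nrm_sq E_def)
    moreover have "\<alpha> * (nrm (K u))\<^sup>2 \<le> \<alpha> * (nrm u)\<^sup>2"
      using \<alpha> contr[OF u] nrm_nonneg KV u by (intro mult_left_mono power_mono) auto
    moreover have "\<alpha> * (1 - \<alpha>) * (\<gamma> * nrm u)\<^sup>2 \<le> \<alpha> * (1 - \<alpha>) * (nrm (u + K u))\<^sup>2"
      using \<alpha> \<gamma>_le[OF u] \<gamma>0 nrm_nonneg u by (intro mult_left_mono power_mono) auto
    ultimately show ?thesis by (simp add: c_def power_mult_distrib algebra_simps)
  qed
  \<comment> \<open>a squared norm is nonnegative, and some vector has positive norm\<close>
  have c1: "c \<le> 1"
  proof -
    obtain u where u: "u \<in> V" "u \<noteq> 0" using nontriv by blast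
    have "0 \<le> (1 - c) * (nrm u)\<^sup>2" using E_sq[OF u(1)] zero_le_power2 order_trans by blast
    then show ?thesis using nrm_pos[OF u] by (simp add: zero_le_mult_iff)
  qed
  have sqrt_c: "sqrt (1 - c) \<le> 1 - c / 2"
    by (rule real_le_lsqrt) (use c0 c1 in \<open>auto simp: power2_eq_square algebra_simps\<close>)
  have E_le_c: "nrm (E u) \<le> (1 - c / 2) * nrm u" if u: "u \<in> V" for u
  proof -
    have "nrm (E u) \<le> sqrt ((1 - c) * (nrm u)\<^sup>2)"
      using E_sq[OF u] by (rule real_le_rsqrt)
    also have "\<dots> = sqrt (1 - c) * nrm u"
      using nrm_nonneg[OF u] by (simp add: real_sqrt_mult)
    also have "\<dots> \<le> (1 - c / 2) * nrm u"
      using sqrt_c nrm_nonneg[OF u] by (rule mult_right_mono)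
    finally show ?thesis .
  qed
  have \<rho>E: "\<rho> = (SUP u\<in>V - {0}. nrm (E u) / nrm u)" by (simp add: \<rho> E_def)
  have quot: "nrm (E u) / nrm u \<le> 1 - c / 2" if "u \<in> V - {0}" for u
    using E_le_c[of u] that nrm_pos[of u] by (simp add: field_simps)
  have \<rho>_bdd: "bdd_above ((\<lambda>u. nrm (E u) / nrm u) ` (V - {0}))"
    by (rule bdd_aboveI2[of _ _ "1 - c / 2"]) (rule quot)
  have \<rho>_c: "\<rho> \<le> 1 - c / 2"
    unfolding \<rho>E by (rule cSUP_least[OF Vne quot])
  have E_le: "nrm (E u) \<le> \<rho> * nrm u" if u: "u \<in> V" for u
  proof (cases "u = 0")
    case True
    then show ?thesis using E_le_c[OF u] nrm_nonneg[OF EV[OF u]] by (simp add: nrm_zero)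
  next
    case False
    then have "nrm (E u) / nrm u \<le> \<rho>"
      unfolding \<rho>E using u by (intro cSUP_upper[OF _ \<rho>_bdd]) auto
    then show ?thesis using nrm_pos[OF u False] by (simp add: field_simps)
  qed
  show \<rho>0: "0 \<le> \<rho>"
  proof -
    obtain u where u: "u \<in> V" "u \<noteq> 0" using nontriv by blast
    have "0 \<le> \<rho> * nrm u" using E_le[OF u(1)] nrm_nonneg[OF EV[OF u(1)]] by simp
    then show ?thesis using nrm_pos[OF u] by (simp add: zero_le_mult_iff)
  qed
  define s where "s = sqrt \<epsilon>"
  have s0: "0 \<le> s" and ss: "s\<^sup>2 = \<epsilon>" using \<epsilon>(1) by (simp_all add: s_def)
  have s_less: "s < c / 4"
    using \<epsilon>(2) c0 unfolding s_def c_def[symmetric] by (intro real_less_lsqrt) auto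
  show \<rho>s: "\<rho> + 2 * sqrt \<epsilon> < 1" using s_less \<rho>_c by (simp add: s_def)
  show "\<rho> + 4 * sqrt \<epsilon> < 1" if small: "\<epsilon> < (\<alpha> * (1 - \<alpha>) * \<gamma>\<^sup>2 / 8)\<^sup>2"
  proof -
    have "s < c / 8"
      using small c0 unfolding s_def c_def[symmetric] by (intro real_less_lsqrt) auto
    then show ?thesis using \<rho>_c by (simp add: s_def)
  qed
  have "c \<noteq> 0" using s0 s_less by auto
  then have \<gamma>p: "0 < \<gamma>" using \<gamma>0 by (auto simp: c_def)
  have IK: "linear_map V V (\<lambda>u. u + K u)"
    using linear_map_combine[OF linear_map_id K subspace, of 1 1] by simp
  have bij: "bij_betw (\<lambda>u. u + K u) V V"
  proof (rule linear_endo_bij[OF V IK])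
    fix u assume u: "u \<in> V" "u + K u = 0"
    then have "\<gamma> * nrm u \<le> 0" using \<gamma>_le[OF u(1)] by (simp add: nrm_zero)
    then show "u = 0" using \<gamma>p nrm_pos[OF u(1)] by (smt (verit) mult_pos_pos)
  qed
  then have "g \<in> (\<lambda>u. u + K u) ` V" using g by (simp add: bij_betw_def)
  then obtain z where z: "z \<in> V" "z + K z = g" by auto
  have uniq: "u + K u = g \<longleftrightarrow> u = z" if "u \<in> V" for u
    using bij that z by (auto simp: bij_betw_def inj_on_def)
  have Ediff: "E (u - w) = E u - E w" if "u \<in> V" "w \<in> V" for u w
    using that by (simp add: E_def linear_map_diff[OF K subspace] fun_vs.scale_right_diff_distrib)
  have step': "v (Suc n) = E (v n) + complex_of_real \<alpha> *\<^sub>c g + complex_of_real (2 * \<alpha>) *\<^sub>c d n" for n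
    by (simp add: step E_def)
  have Ez: "z = E z + complex_of_real \<alpha> *\<^sub>c g"
    unfolding E_def z(2)[symmetric] by (simp add: fun_eq_iff pointwise algebra_simps)
  have errstep: "v (Suc n) - z = E (v n - z) + complex_of_real (2 * \<alpha>) *\<^sub>c d n" for n
  proof -
    have "v (Suc n) - z = E (v n) + complex_of_real \<alpha> *\<^sub>c g + complex_of_real (2 * \<alpha>) *\<^sub>c d n
        - (E z + complex_of_real \<alpha> *\<^sub>c g)"
      using step'[of n] Ez by metis
    also have "\<dots> = (E (v n) - E z) + complex_of_real (2 * \<alpha>) *\<^sub>c d n" by (simp add: algebra_simps)
    also have "E (v n) - E z = E (v n - z)" by (rule Ediff[OF v(1) z(1), symmetric])
    finally show ?thesis .
  qed
  define a b where "a n = nrm (v (Suc n) - v n)" and "b n = nrm (d n)" for n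
  have ab0: "0 \<le> a n" "0 \<le> b n" for n using v d by (simp_all add: a_def b_def nrm_nonneg)
  have rec: "a n + 2 * \<alpha> * b n \<le> (\<rho> + 2 * s) ^ n * a 0" for n
  proof (rule recycled_recursion)
    show "0 \<le> \<alpha>" "\<alpha> \<le> 1" "0 \<le> s" "s \<le> 1 / 4" "0 \<le> \<rho>" using \<alpha> s0 s_less c1 \<rho>0 by auto
    show "b 0 = 0" by (simp add: b_def d nrm_zero)
    show "b (Suc n) \<le> s\<^sup>2 * (b n + a n)" for n
      using recycle[of n] by (simp add: a_def b_def ss)
    show "a (Suc n) \<le> \<rho> * a n + 2 * \<alpha> * (b (Suc n) + b n)" for n
    proof -
      have V4: "v (Suc n) \<in> V" "v n \<in> V" "d (Suc n) \<in> V" "d n \<in> V" using v d by auto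
      have "v (Suc (Suc n)) - v (Suc n)
          = E (v (Suc n) - v n) + complex_of_real (2 * \<alpha>) *\<^sub>c (d (Suc n) - d n)"
        using V4 step'[of "Suc n"] step'[of n] Ediff[of "v (Suc n)" "v n"]
        by (simp add: fun_vs.scale_right_diff_distrib)
      then have "a (Suc n) \<le> nrm (E (v (Suc n) - v n)) + nrm (complex_of_real (2 * \<alpha>) *\<^sub>c (d (Suc n) - d n))"
        unfolding a_def using V4 EV nrm_triangle by simp
      also have "\<dots> \<le> \<rho> * a n + 2 * \<alpha> * nrm (d (Suc n) - d n)"
        using E_le[of "v (Suc n) - v n"] nrm_scale[of "d (Suc n) - d n" "complex_of_real (2 * \<alpha>)"] V4 \<alpha>
        by (simp add: a_def)
      also have "\<dots> \<le> \<rho> * a n + 2 * \<alpha> * (b (Suc n) + b n)"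
        using nrm_triangle_diff[OF V4(3,4)] \<alpha> by (simp add: b_def)
      finally show ?thesis .
    qed
  qed (use ab0 in auto)
  have "nrm (v n - z) \<le> nrm (v 1) / (1 - (\<rho> + 2 * sqrt \<epsilon>)) * (\<rho> + 2 * sqrt \<epsilon>) ^ n" for n
  proof -
    define x where "x = nrm (v n - z)"
    have Vn: "v n \<in> V" "v (Suc n) \<in> V" "d n \<in> V" using v d by auto
    have "x \<le> nrm (v (Suc n) - z) + a n"
    proof -
      have "v n - z = (v (Suc n) - z) - (v (Suc n) - v n)" by simp
      then have "x = nrm ((v (Suc n) - z) - (v (Suc n) - v n))" by (simp only: x_def)
      also have "\<dots> \<le> nrm (v (Suc n) - z) + a n"
        unfolding a_def using Vn z(1) by (intro nrm_triangle_diff) auto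
      finally show ?thesis .
    qed
    also have "nrm (v (Suc n) - z) \<le> \<rho> * x + 2 * \<alpha> * b n"
    proof -
      have "nrm (v (Suc n) - z) \<le> nrm (E (v n - z)) + nrm (complex_of_real (2 * \<alpha>) *\<^sub>c d n)"
        unfolding errstep using Vn z(1) EV by (intro nrm_triangle) auto
      then show ?thesis
        using E_le[of "v n - z"] nrm_scale[OF Vn(3), of "complex_of_real (2 * \<alpha>)"] Vn z(1) \<alpha>
        by (simp add: x_def b_def)
    qed
    finally have "(1 - \<rho>) * x \<le> (\<rho> + 2 * s) ^ n * a 0"
      using rec[of n] by (simp add: algebra_simps)
    moreover have "(1 - (\<rho> + 2 * s)) * x \<le> (1 - \<rho>) * x"
      using s0 nrm_nonneg[of "v n - z"] Vn z(1) by (intro mult_right_mono) (auto simp: x_def)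
    moreover have "a 0 = nrm (v 1)" by (simp add: a_def v)
    ultimately have "(1 - (\<rho> + 2 * s)) * x \<le> (\<rho> + 2 * s) ^ n * nrm (v 1)" by simp
    moreover have "0 < 1 - (\<rho> + 2 * s)" using \<rho>s by (simp add: s_def)
    ultimately have "x \<le> (\<rho> + 2 * s) ^ n * nrm (v 1) / (1 - (\<rho> + 2 * s))"
      by (simp add: pos_le_divide_eq mult.commute)
    then show ?thesis by (simp add: x_def s_def mult.commute)
  qed
  then show "\<exists>z\<in>V. (\<forall>u\<in>V. u + K u = g \<longleftrightarrow> u = z) \<and>
      (\<forall>n. nrm (v n - z) \<le> nrm (v 1) / (1 - (\<rho> + 2 * sqrt \<epsilon>)) * (\<rho> + 2 * sqrt \<epsilon>) ^ n)"
    using z(1) uniq by blast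
qed

end

section \<open>Exchange and scattering operators\<close>

lemma adjoint_on_dual:
  assumes L: "linear_map V W L" and V: "fun_vs.subspace V" and q: "q \<in> dual W"
  shows "adjoint_on V L q \<in> dual V"
  using linear_map_in[OF L] q fun_vs.subspace_add[OF V] fun_vs.subspace_scale[OF V]
  by (auto simp: dual_iff adjoint_on_def restr_def linear_map_add[OF L] linear_map_scale[OF L])

lemma adjoint_on_linear:
  assumes L: "linear_map V W L" and V: "fun_vs.subspace V"
  shows "linear_map (dual W) (dual V) (adjoint_on V L)"
  unfolding linear_map_iff using adjoint_on_dual[OF L V]
  by (auto simp: adjoint_on_def[abs_def] restr_def fun_eq_iff pointwise)

lemma dual_norm_eq:
  assumes T: "hermitian_posdef V T" and V: "fin_dim V" and v: "v \<in> V"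
  shows "dual_norm V T (T v) = energy_norm T v"
proof -
  have "inv_into V T (T v) = v"
    using hermitian_posdef_bij[OF T V] v by (simp add: bij_betw_def)
  then show ?thesis by (simp add: dual_norm_def energy_norm_def conj_dual_def)
qed

text \<open>All that the convergence analysis uses of the Helmholtz problem: \<open>A\<close> is dissipative, and
  trace-free solutions of the homogeneous local problems vanish.\<close>

locale domain_decomposition =
  fixes VO VG :: "('y \<Rightarrow> complex) set" and VS :: "('x \<Rightarrow> complex) set"
    and A T :: "('y \<Rightarrow> complex) \<Rightarrow> ('y \<Rightarrow> complex) \<Rightarrow> complex"
    and l :: "('y \<Rightarrow> complex) \<Rightarrow> complex"
    and B :: "('y \<Rightarrow> complex) \<Rightarrow> 'y \<Rightarrow> complex"
    and R :: "('x \<Rightarrow> complex) \<Rightarrow> 'y \<Rightarrow> complex"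
    and P :: "(('x \<Rightarrow> complex) \<Rightarrow> complex) \<Rightarrow> 'x \<Rightarrow> complex"
  assumes VO: "fin_dim VO" and VG: "fin_dim VG" and VS: "fin_dim VS"
    and cnj_VO: "\<And>v. v \<in> VO \<Longrightarrow> conj_fun v \<in> VO"
    and cnj_VG: "\<And>v. v \<in> VG \<Longrightarrow> conj_fun v \<in> VG"
    and cnj_VS: "\<And>v. v \<in> VS \<Longrightarrow> conj_fun v \<in> VS"
    and nontriv_VS: "\<exists>v\<in>VS. v \<noteq> 0"
    and A: "linear_map VO (dual VO) A"
    and A_dissipative: "\<And>u. u \<in> VO \<Longrightarrow> Im (A u (conj_fun u)) \<le> 0"
    and A_unique: "\<And>u. u \<in> VO \<Longrightarrow> B u = 0 \<Longrightarrow> A u = 0 \<Longrightarrow> u = 0"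
    and l: "l \<in> dual VO"
    and B: "linear_map VO VG B" and B_cnj: "\<And>v. B (conj_fun v) = conj_fun (B v)"
    and R: "linear_map VS VG R" and R_cnj: "\<And>v. R (conj_fun v) = conj_fun (R v)"
    and R_inj: "\<And>v. v \<in> VS \<Longrightarrow> R v = 0 \<Longrightarrow> v = 0"
    and T: "hermitian_posdef VG T" and P: "hermitian_posdef_dual VS P"
begin

abbreviation "ip u v \<equiv> T u (conj_fun v)"

sublocale G: inner_form VG ip
  by (rule hermitian_posdef_inner_form[OF T fin_dim_subspace[OF VG] cnj_VG])

lemma T_lin: "linear_map VG (dual VG) T"
  using T by (simp add: hermitian_posdef_def)

lemma T_bij: "bij_betw T VG (dual VG)"
  by (rule hermitian_posdef_bij[OF T VG])

lemma nrm_energy: "G.nrm v = energy_norm T v"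
  by (simp add: G.nrm_def energy_norm_def)

lemmas B_in = linear_map_in[OF B] and R_in = linear_map_in[OF R]
  and T_in = linear_map_in[OF T_lin]
lemmas VO_sub = fin_dim_subspace[OF VO] and VS_sub = fin_dim_subspace[OF VS]

definition "Bs = adjoint_on VO B"
definition "Rs = adjoint_on VS R"
definition "RTR = (\<lambda>\<eta>. Rs (T (R \<eta>)))"
definition "M = (\<lambda>u. A u - \<i> *\<^sub>c Bs (T (B u)))"

lemmas Bs_lin = adjoint_on_linear[OF B VO_sub, folded Bs_def]
lemmas Rs_lin = adjoint_on_linear[OF R VS_sub, folded Rs_def]

lemma Bs_apply: "v \<in> VO \<Longrightarrow> Bs q v = q (B v)"
  by (simp add: Bs_def adjoint_on_def restr_def)

lemma Rs_apply: "v \<in> VS \<Longrightarrow> Rs q v = q (R v)"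
  by (simp add: Rs_def adjoint_on_def restr_def)

lemma RTR_posdef: "hermitian_posdef VS RTR"
  unfolding hermitian_posdef_def
proof (intro conjI ballI impI)
  show "linear_map VS (dual VS) RTR"
    unfolding RTR_def by (rule linear_map_comp[OF linear_map_comp[OF R T_lin] Rs_lin])
  fix u v assume uv: "u \<in> VS" "v \<in> VS"
  have "RTR u (conj_fun v) = ip (R u) (R v)" "RTR v (conj_fun u) = ip (R v) (R u)"
    using uv by (auto simp: RTR_def Rs_apply cnj_VS R_cnj)
  then show "RTR u (conj_fun v) = cnj (RTR v (conj_fun u))"
    using G.ip_herm[of "R v" "R u"] uv R_in by simp
next
  fix v assume v: "v \<in> VS" "v \<noteq> (\<lambda>_. 0)"
  then have "R v \<noteq> 0" using R_inj by (auto simp: zero_fun_def)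
  then show "0 < Re (RTR v (conj_fun v))"
    using G.Re_ip_pos[of "R v"] v R_in by (simp add: RTR_def Rs_apply cnj_VS R_cnj)
qed

lemma RTR_bij: "bij_betw RTR VS (dual VS)"
  by (rule hermitian_posdef_bij[OF RTR_posdef VS])

lemma RTR_energy: "v \<in> VS \<Longrightarrow> energy_norm RTR v = G.nrm (R v)"
  by (simp add: energy_norm_def G.nrm_def RTR_def Rs_apply cnj_VS R_cnj)

lemma M_lin: "linear_map VO (dual VO) M"
  using linear_map_combine[OF A linear_map_comp[OF linear_map_comp[OF B T_lin] Bs_lin] subspace_dual,
      of 1 "-\<i>"]
  by (simp add: M_def)

text \<open>If \<open>M u = 0\<close>, the imaginary part of the energy identity forces the traces of \<open>u\<close> to vanish,
  and what remains is the homogeneous local problem.\<close>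

lemma M_bij: "bij_betw M VO (dual VO)"
proof (rule linear_to_dual_bij[OF VO M_lin])
  fix u assume u: "u \<in> VO" "M u = 0"
  then have "A u = \<i> *\<^sub>c Bs (T (B u))" by (simp add: M_def)
  then have "A u (conj_fun u) = \<i> * ip (B u) (B u)"
    using u by (simp add: pointwise Bs_apply cnj_VO B_cnj)
  then have "Re (ip (B u) (B u)) \<le> 0"
    using A_dissipative[OF u(1)] by simp
  then have "B u = 0"
    using G.Re_ip_pos[of "B u"] B_in[OF u(1)] by fastforce
  moreover then have "A u = 0"
    using u(2) linear_map_zero[OF T_lin G.subspace] linear_map_zero[OF Bs_lin subspace_dual]
    by (simp add: M_def)
  ultimately show "u = 0" by (rule A_unique[OF u(1)])
qed

text \<open>Transported from the dual to \<open>VG\<close> by \<open>T\<close>, the scattering and exchange operators become \<open>scatter\<close> and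
  \<open>exchange\<close>.  They are built from the local solves \<open>lift\<close> and the coarse solve on the skeleton.\<close>

definition "lift q = inv_into VO M q"
definition "scatter v = v + (2 * \<i>) *\<^sub>c B (lift (Bs (T v)))"
definition "coarse v = inv_into VS RTR (Rs (T v))"
definition "exchange v = 2 *\<^sub>c R (coarse v) - v"

lemma lift_lin: "linear_map (dual VO) VO lift"
  unfolding lift_def by (rule linear_map_inv_into[OF M_lin VO_sub subspace_dual M_bij])

lemma M_lift: "q \<in> dual VO \<Longrightarrow> M (lift q) = q"
  unfolding lift_def using M_bij by (simp add: bij_betw_def f_inv_into_f)

lemma scatter_lin: "linear_map VG VG scatter"
  using linear_map_combine[OF linear_map_id
      linear_map_comp[OF linear_map_comp[OF linear_map_comp[OF T_lin Bs_lin] lift_lin] B] G.subspace, of 1 "2 * \<i>"]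
  by (simp add: scatter_def[abs_def])

lemma coarse_lin: "linear_map VG VS coarse"
proof -
  have lin: "linear_map VS (dual VS) RTR"
    using RTR_posdef unfolding hermitian_posdef_def by blast
  show ?thesis
    unfolding coarse_def
    by (rule linear_map_comp[OF linear_map_comp[OF T_lin Rs_lin]
          linear_map_inv_into[OF lin VS_sub subspace_dual RTR_bij]])
qed

lemma RTR_coarse: "v \<in> VG \<Longrightarrow> RTR (coarse v) = Rs (T v)"
  unfolding coarse_def using RTR_bij linear_map_in[OF Rs_lin] T_in
  by (simp add: bij_betw_def f_inv_into_f)

lemma exchange_lin: "linear_map VG VG exchange"
  using linear_map_combine[OF linear_map_comp[OF coarse_lin R] linear_map_id G.subspace, of 2 "-1"]
  by (simp add: exchange_def[abs_def])

text \<open>Energy balance: the norm is lost only through the dissipation of \<open>A\<close>.\<close>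

lemma scatter_contraction:
  assumes v: "v \<in> VG"
  shows "G.nrm (scatter v) \<le> G.nrm v"
proof -
  define u where "u = lift (Bs (T v))"
  have q: "Bs (T v) \<in> dual VO" using linear_map_in[OF Bs_lin] T_in v by blast
  have u: "u \<in> VO" unfolding u_def by (rule linear_map_in[OF lift_lin q])
  have BV: "B u \<in> VG" by (rule B_in[OF u])
  have "M u (conj_fun u) = Bs (T v) (conj_fun u)" unfolding u_def M_lift[OF q] ..
  then have eq: "ip v (B u) = A u (conj_fun u) - \<i> * ip (B u) (B u)"
    using u by (simp add: M_def pointwise Bs_apply cnj_VO B_cnj)
  have "Re (ip (scatter v) (scatter v)) = Re (ip v v) + 2 * Re (ip v ((2 * \<i>) *\<^sub>c B u))
      + Re (ip ((2 * \<i>) *\<^sub>c B u) ((2 * \<i>) *\<^sub>c B u))"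
    unfolding scatter_def u_def[symmetric] using v BV by (intro G.Re_ip_add) simp_all
  also have "Re (ip v ((2 * \<i>) *\<^sub>c B u)) = 2 * Im (A u (conj_fun u)) - 2 * Re (ip (B u) (B u))"
    unfolding G.ip_scale_right[OF BV v] eq by simp
  also have "Re (ip ((2 * \<i>) *\<^sub>c B u) ((2 * \<i>) *\<^sub>c B u)) = 4 * Re (ip (B u) (B u))"
    unfolding G.Re_ip_scale[OF BV] by (simp add: norm_mult)
  finally have "Re (ip (scatter v) (scatter v)) \<le> Re (ip v v)"
    using A_dissipative[OF u] by simp
  then show ?thesis by (simp add: G.nrm_def)
qed

text \<open>\<open>R (coarse v)\<close> is the orthogonal projection of \<open>v\<close> onto the range of \<open>R\<close>, so \<open>exchange\<close> is the
  reflection at that range.\<close>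

lemma coarse_orthogonal:
  assumes v: "v \<in> VG"
  shows "ip (R (coarse v)) (R (coarse v)) = ip v (R (coarse v))"
proof -
  have c: "coarse v \<in> VS" by (rule linear_map_in[OF coarse_lin v])
  have "RTR (coarse v) (conj_fun (coarse v)) = Rs (T v) (conj_fun (coarse v))"
    unfolding RTR_coarse[OF v] ..
  then show ?thesis
    using c by (simp add: RTR_def Rs_apply cnj_VS R_cnj)
qed

lemma exchange_isometry:
  assumes v: "v \<in> VG"
  shows "G.nrm (exchange v) = G.nrm v"
proof -
  define w where "w = R (coarse v)"
  have w: "w \<in> VG" unfolding w_def by (intro R_in linear_map_in[OF coarse_lin v])
  have eq: "Re (ip w w) = Re (ip w v)"
    using coarse_orthogonal[OF v] G.Re_ip_commute[OF v w] by (simp add: w_def)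
  have "Re (ip (2 *\<^sub>c w - v) (2 *\<^sub>c w - v)) = Re (ip (2 *\<^sub>c w) (2 *\<^sub>c w)) - 2 * Re (ip (2 *\<^sub>c w) v) + Re (ip v v)"
    using v w by (intro G.Re_ip_diff) simp_all
  then have "Re (ip (exchange v) (exchange v)) = Re (ip v v)"
    unfolding exchange_def w_def[symmetric]
    by (simp add: G.Re_ip_scale[OF w] G.ip_scale_left[OF w v] eq)
  then show ?thesis by (simp add: G.nrm_def)
qed

lemma coarse_contraction:
  assumes v: "v \<in> VG"
  shows "G.nrm (R (coarse v)) \<le> G.nrm v"
proof -
  define w where "w = R (coarse v)"
  have w: "w \<in> VG" unfolding w_def by (intro R_in linear_map_in[OF coarse_lin v])
  have "(G.nrm w)\<^sup>2 = Re (ip v w)"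
    using coarse_orthogonal[OF v] by (simp add: w_def G.nrm_sq[OF w[unfolded w_def]])
  also have "\<dots> \<le> G.nrm v * G.nrm w"
    using G.cmod_ip_le[OF v w] complex_Re_le_cmod order_trans by blast
  finally have "G.nrm w * G.nrm w \<le> G.nrm v * G.nrm w" by (simp add: power2_eq_square)
  then show ?thesis
    using G.nrm_nonneg[OF w] G.nrm_nonneg[OF v] unfolding w_def[symmetric]
    by (cases "G.nrm w = 0") auto
qed

lemma dual_norm_nonneg:
  assumes "q \<in> dual VG"
  shows "0 \<le> dual_norm VG T q"
proof -
  obtain v where "v \<in> VG" "q = T v" using assms T_bij by (auto simp: bij_betw_def)
  then show ?thesis using dual_norm_eq[OF T VG, of v] G.nrm_nonneg[of v] by (simp add: nrm_energy)
qed

lemma nontriv_VG: "\<exists>v\<in>VG. v \<noteq> 0"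
  using nontriv_VS R_in R_inj by blast

definition "Pex = (\<lambda>q. 2 *\<^sub>c T (R (inv_into VS RTR (Rs q))) - q)"
definition "S = (\<lambda>q. q + (2 * \<i>) *\<^sub>c T (B (inv_into VO M (Bs q))))"
definition "g = (2 * \<i>) *\<^sub>c T (B (inv_into VO M l))"

lemma S_T: "v \<in> VG \<Longrightarrow> S (T v) = T (scatter v)"
proof -
  assume v: "v \<in> VG"
  then have "B (lift (Bs (T v))) \<in> VG"
    by (intro B_in linear_map_in[OF lift_lin] linear_map_in[OF Bs_lin] T_in)
  then show ?thesis
    using v by (simp add: S_def scatter_def linear_map_add[OF T_lin] linear_map_scale[OF T_lin] flip: lift_def)
qed

lemma Pex_T: "v \<in> VG \<Longrightarrow> Pex (T v) = T (exchange v)"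
proof -
  assume v: "v \<in> VG"
  then have "R (coarse v) \<in> VG" by (intro R_in linear_map_in[OF coarse_lin])
  then show ?thesis
    using v
    by (simp add: Pex_def exchange_def linear_map_diff[OF T_lin G.subspace] linear_map_scale[OF T_lin] flip: coarse_def)
qed

text \<open>On \<open>VG\<close> the scheme is the relaxed Richardson iteration for the composition of \<open>exchange\<close> and
  \<open>scatter\<close>, perturbed by \<open>d n\<close>, the error of the \<open>n\<close>-th coarse solve measured after applying \<open>R\<close>.
  The solver is started at the previous coarse solution.  The new initial error is therefore the old
  final error plus the change of the exact coarse solution, and the latter is not larger than the last
  update, because it is the projection of the scattered update.\<close>

theorem recycled_pcg_Richardson:
  fixes qt :: "nat \<Rightarrow> ('y \<Rightarrow> complex) \<Rightarrow> complex" and pt :: "nat \<Rightarrow> 'x \<Rightarrow> complex"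
  assumes k: "1 \<le> k" and \<alpha>: "0 < \<alpha>" "\<alpha> < 1"
    and init: "qt 0 = 0" "pt 0 = 0"
    and iter_p: "\<And>n. pt (Suc n) = pcg VS RTR P k (pt n) (Rs (S (qt n)))"
    and iter_q: "\<And>n. qt (Suc n) = complex_of_real (1 - \<alpha>) *\<^sub>c qt n + complex_of_real \<alpha> *\<^sub>c S (qt n)
            - (2 * complex_of_real \<alpha>) *\<^sub>c T (R (pt (Suc n))) + complex_of_real \<alpha> *\<^sub>c g"
    and N: "N = dual_norm VG T"
    and \<rho>: "\<rho> = (SUP q\<in>dual VG - {0}. N (complex_of_real (1 - \<alpha>) *\<^sub>c q - complex_of_real \<alpha> *\<^sub>c Pex (S q)) / N q)"
    and \<gamma>: "\<gamma> = (INF q\<in>dual VG - {0}. N (q + Pex (S q)) / N q)"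
    and \<epsilon>: "\<epsilon> = 2 * ((sqrt (cond_on VS (\<lambda>v. P (RTR v))) - 1) / (sqrt (cond_on VS (\<lambda>v. P (RTR v))) + 1)) ^ k"
    and \<epsilon>_small: "\<epsilon> < (\<alpha> * (1 - \<alpha>) * \<gamma>\<^sup>2 / 4)\<^sup>2"
  shows "0 \<le> \<rho>" and "0 \<le> \<epsilon>" and "\<rho> + 2 * sqrt \<epsilon> < 1"
    and "\<epsilon> < (\<alpha> * (1 - \<alpha>) * \<gamma>\<^sup>2 / 8)\<^sup>2 \<Longrightarrow> \<rho> + 4 * sqrt \<epsilon> < 1"
    and "\<And>n. qt n \<in> dual VG"
    and "\<exists>z\<in>dual VG. (\<forall>q\<in>dual VG. q + Pex (S q) = g \<longleftrightarrow> q = z) \<and>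
      (\<forall>n. N (qt n - z) \<le> N (qt 1) / (1 - (\<rho> + 2 * sqrt \<epsilon>)) * (\<rho> + 2 * sqrt \<epsilon>) ^ n)"
proof -
  define K where "K v = exchange (scatter v)" for v
  have K: "linear_map VG VG K"
    unfolding K_def by (rule linear_map_comp[OF scatter_lin exchange_lin])
  note KV = linear_map_in[OF K] and sV = linear_map_in[OF scatter_lin] and cV = linear_map_in[OF coarse_lin]
  have contr: "G.nrm (K u) \<le> G.nrm u" if "u \<in> VG" for u
    using that by (simp add: K_def exchange_isometry sV scatter_contraction)
  have NT: "N (T v) = G.nrm v" if "v \<in> VG" for v
    using dual_norm_eq[OF T VG that] by (simp add: N nrm_energy)
  have KT: "Pex (S (T v)) = T (K v)" if "v \<in> VG" for v
    using that by (simp add: S_T Pex_T sV K_def)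
  have TV: "T ` VG = dual VG" and Tinj: "inj_on T VG" using T_bij by (auto simp: bij_betw_def)
  have T0: "T 0 = 0" by (rule linear_map_zero[OF T_lin G.subspace])
  have dual_image: "dual VG - {0} = T ` (VG - {0})"
    using inj_on_image_set_diff[OF Tinj, of VG "{0}"] TV T0 by simp
  have \<rho>': "\<rho> = (SUP u\<in>VG - {0}. G.nrm (complex_of_real (1 - \<alpha>) *\<^sub>c u - complex_of_real \<alpha> *\<^sub>c K u) / G.nrm u)"
    unfolding \<rho> dual_image image_image
  proof (intro SUP_cong refl)
    fix u assume "u \<in> VG - {0}"
    then show "N (complex_of_real (1 - \<alpha>) *\<^sub>c T u - complex_of_real \<alpha> *\<^sub>c Pex (S (T u))) / N (T u)
      = G.nrm (complex_of_real (1 - \<alpha>) *\<^sub>c u - complex_of_real \<alpha> *\<^sub>c K u) / G.nrm u"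
      using KV by (simp add: KT NT flip: linear_map_scale[OF T_lin] linear_map_diff[OF T_lin G.subspace])
  qed
  have \<gamma>': "\<gamma> = (INF u\<in>VG - {0}. G.nrm (u + K u) / G.nrm u)"
    unfolding \<gamma> dual_image image_image
  proof (intro INF_cong refl)
    fix u assume "u \<in> VG - {0}"
    then show "N (T u + Pex (S (T u))) / N (T u) = G.nrm (u + K u) / G.nrm u"
      using KV by (simp add: KT NT flip: linear_map_add[OF T_lin])
  qed
  have pcg_pos: "0 \<le> \<epsilon>"
    using pcg_error_bound(1)[where V = VS and G = RTR and P = P and k = k and \<epsilon> = \<epsilon>, OF RTR_posdef P VS cnj_VS nontriv_VS k \<epsilon>] .
  have pcg: "pcg VS RTR P k x0 b \<in> VS \<and>
      energy_norm RTR (inv_into VS RTR b - pcg VS RTR P k x0 b) \<le> \<epsilon> * energy_norm RTR (inv_into VS RTR b - x0)"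
    if "x0 \<in> VS" "b \<in> dual VS" for x0 b
    using pcg_error_bound(2)[where V = VS and G = RTR and P = P and k = k and \<epsilon> = \<epsilon>, OF RTR_posdef P VS cnj_VS nontriv_VS k \<epsilon> that] .
  show \<epsilon>0: "0 \<le> \<epsilon>" by (rule pcg_pos)
  define gv where "gv = (2 * \<i>) *\<^sub>c B (lift l)"
  have liftl: "B (lift l) \<in> VG" by (intro B_in linear_map_in[OF lift_lin] l)
  have gv: "gv \<in> VG" "T gv = g"
    using liftl by (simp_all add: gv_def g_def lift_def linear_map_scale[OF T_lin])
  have SV: "S q \<in> dual VG" if "q \<in> dual VG" for q
    using that S_T sV T_in TV by (metis imageE)
  have inv: "qt n \<in> dual VG \<and> pt n \<in> VS" for n
  proof (induction n)
    case 0
    show ?case using init fun_vs.subspace_0[OF subspace_dual] fun_vs.subspace_0[OF VS_sub] by simp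
  next
    case (Suc n)
    have "Rs (S (qt n)) \<in> dual VS" using Suc SV linear_map_in[OF Rs_lin] by blast
    then have p: "pt (Suc n) \<in> VS" unfolding iter_p using Suc pcg by blast
    have "T (R (pt (Suc n))) \<in> dual VG" by (intro T_in R_in p)
    moreover have "g \<in> dual VG" using T_in[OF gv(1)] gv(2) by simp
    moreover have "qt n \<in> dual VG" "S (qt n) \<in> dual VG" using Suc SV by auto
    ultimately have "qt (Suc n) \<in> dual VG"
      unfolding iter_q
      by (intro fun_vs.subspace_add[OF subspace_dual] fun_vs.subspace_diff[OF subspace_dual]
          fun_vs.subspace_scale[OF subspace_dual])
    then show ?case using p by blast
  qed
  define v where "v n = inv_into VG T (qt n)" for n
  have v: "v n \<in> VG" "T (v n) = qt n" for n
    using inv[of n] T_bij by (auto simp: v_def bij_betw_def inv_into_into f_inv_into_f)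
  have v0: "v 0 = 0" using v[of 0] init T0 Tinj by (metis G.closed(1) inj_onD)
  define d where "d n = R (coarse (scatter (v n)) - pt (Suc n))" for n
  have csV: "coarse (scatter (v n)) \<in> VS" for n by (intro cV sV v)
  have dS: "coarse (scatter (v n)) - pt (Suc n) \<in> VS" for n
    using csV inv by (intro fun_vs.subspace_diff[OF VS_sub]) blast+
  have d: "d n \<in> VG" for n unfolding d_def by (intro R_in dS)
  have exact: "inv_into VS RTR (Rs (S (qt n))) = coarse (scatter (v n))" for n
    using S_T[OF v(1)[of n]] by (simp add: v(2) coarse_def)
  have pcg_step: "G.nrm (d n) \<le> \<epsilon> * G.nrm (R (coarse (scatter (v n)) - pt n))" for n
  proof -
    have "Rs (S (qt n)) \<in> dual VS" using inv SV linear_map_in[OF Rs_lin] by blast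
    then have "energy_norm RTR (coarse (scatter (v n)) - pt (Suc n))
        \<le> \<epsilon> * energy_norm RTR (coarse (scatter (v n)) - pt n)"
      using pcg[of "pt n" "Rs (S (qt n))"] inv[of n] by (simp add: iter_p exact)
    moreover have "coarse (scatter (v n)) - pt n \<in> VS"
      using csV inv by (intro fun_vs.subspace_diff[OF VS_sub]) blast+
    ultimately show ?thesis using dS by (simp add: RTR_energy d_def)
  qed
  have z0: "scatter 0 = 0" "coarse 0 = 0" "R 0 = 0"
    using linear_map_zero[OF scatter_lin G.subspace] linear_map_zero[OF coarse_lin G.subspace]
      linear_map_zero[OF R VS_sub] by auto
  \<comment> \<open>the first system has right-hand side zero and initial guess zero\<close>
  have d0: "d 0 = 0"
  proof -
    have "G.nrm (d 0) \<le> 0" using pcg_step[of 0] by (simp add: v0 init z0 G.nrm_zero)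
    then show ?thesis using G.nrm_nonneg[OF d[of 0]] G.nrm_eq_0[OF d[of 0]] by simp
  qed
  have recycle: "G.nrm (d (Suc n)) \<le> \<epsilon> * (G.nrm (d n) + G.nrm (v (Suc n) - v n))" for n
  proof -
    define w where "w = R (coarse (scatter (v (Suc n) - v n)))"
    have vd: "v (Suc n) - v n \<in> VG" using v by simp
    have w: "w \<in> VG" unfolding w_def by (intro R_in cV sV vd)
    have "coarse (scatter (v (Suc n) - v n)) = coarse (scatter (v (Suc n))) - coarse (scatter (v n))"
      using v sV by (simp add: linear_map_diff[OF scatter_lin G.subspace] linear_map_diff[OF coarse_lin G.subspace])
    then have "coarse (scatter (v (Suc n))) - pt (Suc n)
        = coarse (scatter (v (Suc n) - v n)) + (coarse (scatter (v n)) - pt (Suc n))" by simp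
    then have "R (coarse (scatter (v (Suc n))) - pt (Suc n)) = w + d n"
      unfolding w_def d_def using linear_map_add[OF R cV[OF sV[OF vd]] dS[of n]] by (simp only:)
    then have "G.nrm (R (coarse (scatter (v (Suc n))) - pt (Suc n))) \<le> G.nrm w + G.nrm (d n)"
      using G.nrm_triangle[OF w d] by simp
    moreover have "G.nrm w \<le> G.nrm (v (Suc n) - v n)"
      using coarse_contraction[OF sV[OF vd]] scatter_contraction[OF vd] by (simp add: w_def)
    ultimately have "G.nrm (R (coarse (scatter (v (Suc n))) - pt (Suc n)))
        \<le> G.nrm (d n) + G.nrm (v (Suc n) - v n)" by simp
    then show ?thesis
      using pcg_step[of "Suc n"] \<epsilon>0 by (meson mult_left_mono order_trans)
  qed
  have step: "v (Suc n) = complex_of_real (1 - \<alpha>) *\<^sub>c v n - complex_of_real \<alpha> *\<^sub>c K (v n)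
        + complex_of_real \<alpha> *\<^sub>c gv + complex_of_real (2 * \<alpha>) *\<^sub>c d n" (is "_ = ?r") for n
  proof (rule inj_onD[OF Tinj])
    define s p c where "s = scatter (v n)" and "p = R (pt (Suc n))" and "c = R (coarse (scatter (v n)))"
    have V: "s \<in> VG" "p \<in> VG" "c \<in> VG" using sV v R_in inv csV by (auto simp: s_def p_def c_def)
    have Kv: "K (v n) = 2 *\<^sub>c c - s" by (simp add: K_def exchange_def c_def s_def)
    have dn: "d n = c - p"
      unfolding d_def c_def p_def using linear_map_diff[OF R VS_sub csV] inv by blast
    have r: "?r = complex_of_real (1 - \<alpha>) *\<^sub>c v n + complex_of_real \<alpha> *\<^sub>c s
        - (2 * complex_of_real \<alpha>) *\<^sub>c p + complex_of_real \<alpha> *\<^sub>c gv"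
      unfolding Kv dn by (simp add: fun_eq_iff pointwise algebra_simps)
    have "T (v (Suc n)) = complex_of_real (1 - \<alpha>) *\<^sub>c T (v n) + complex_of_real \<alpha> *\<^sub>c T s
            - (2 * complex_of_real \<alpha>) *\<^sub>c T p + complex_of_real \<alpha> *\<^sub>c T gv"
      unfolding v(2) iter_q s_def p_def gv(2) S_T[OF v(1), symmetric] ..
    also have "\<dots> = T ?r"
      unfolding r using V v gv(1)
      by (simp only: linear_map_add[OF T_lin] linear_map_diff[OF T_lin G.subspace] linear_map_scale[OF T_lin] G.closed)
    finally show "T (v (Suc n)) = T ?r" .
    show "v (Suc n) \<in> VG" by (rule v)
    show "?r \<in> VG" using v KV gv(1) d by simp
  qed
  note rich = G.recycled_Richardson[OF VG nontriv_VG K contr \<alpha> \<rho>' \<gamma>' \<epsilon>0 \<epsilon>_small v(1) v0 d d0 gv(1) step recycle]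
  show "0 \<le> \<rho>" by (rule rich(1))
  show "\<rho> + 2 * sqrt \<epsilon> < 1" by (rule rich(2))
  show "\<rho> + 4 * sqrt \<epsilon> < 1" if "\<epsilon> < (\<alpha> * (1 - \<alpha>) * \<gamma>\<^sup>2 / 8)\<^sup>2"
    by (rule rich(3)[OF _ that])
  have N1: "N (qt 1) = G.nrm (v 1)" using NT[OF v(1)] v(2) by metis
  show "qt n \<in> dual VG" for n using inv by blast
  obtain z where z: "z \<in> VG" "\<forall>u\<in>VG. u + K u = gv \<longleftrightarrow> u = z"
    "\<And>n. G.nrm (v n - z) \<le> G.nrm (v 1) / (1 - (\<rho> + 2 * sqrt \<epsilon>)) * (\<rho> + 2 * sqrt \<epsilon>) ^ n"
    using rich(4) by blast
  show "\<exists>z\<in>dual VG. (\<forall>q\<in>dual VG. q + Pex (S q) = g \<longleftrightarrow> q = z) \<and>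
      (\<forall>n. N (qt n - z) \<le> N (qt 1) / (1 - (\<rho> + 2 * sqrt \<epsilon>)) * (\<rho> + 2 * sqrt \<epsilon>) ^ n)"
  proof (intro bexI[of _ "T z"] conjI ballI allI)
    show "T z \<in> dual VG" by (rule T_in[OF z(1)])
    fix q assume "q \<in> dual VG"
    then obtain u where u: "u \<in> VG" "q = T u" using TV by auto
    have "q + Pex (S q) = g \<longleftrightarrow> T (u + K u) = T gv"
      using u KV by (simp add: KT gv linear_map_add[OF T_lin])
    also have "\<dots> \<longleftrightarrow> u + K u = gv"
      using inj_on_eq_iff[OF Tinj, of "u + K u" gv] u KV gv by simp
    also have "\<dots> \<longleftrightarrow> q = T z"
      using z(1,2) u inj_on_eq_iff[OF Tinj u(1) z(1)] by simp
    finally show "q + Pex (S q) = g \<longleftrightarrow> q = T z" .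
  next
    fix n
    have "N (qt n - T z) = G.nrm (v n - z)"
      using NT[of "v n - z"] v z(1) by (simp add: linear_map_diff[OF T_lin G.subspace])
    then show "N (qt n - T z) \<le> N (qt 1) / (1 - (\<rho> + 2 * sqrt \<epsilon>)) * (\<rho> + 2 * sqrt \<epsilon>) ^ n"
      using z(3) N1 by simp
  qed
qed

end

section \<open>Finite element spaces\<close>

lemma sum_pointwise: "(\<Sum>i\<in>I. f i) x = (\<Sum>i\<in>I. f i x :: complex)"
  by (induction I rule: infinite_finite_induct) (auto simp: pointwise)

lemma fin_dim_subset:
  assumes "fin_dim W" "fun_vs.subspace V" "V \<subseteq> W"
  shows "fin_dim V"
  using assms unfolding fin_dim_def by blast

lemma fin_dim_span: "finite C \<Longrightarrow> fin_dim (fun_vs.span C)"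
  unfolding fin_dim_def using fun_vs.subspace_span by blast

lemma fin_dim_image:
  assumes V: "fin_dim V" and L: "Vector_Spaces.linear cscale cscale L"
  shows "fin_dim (L ` V)"
proof -
  interpret L: Vector_Spaces.linear cscale cscale L by (rule L)
  obtain B where B: "finite B" "B \<subseteq> V" "\<not> fun_vs.dependent B" "fun_vs.span B = V"
    by (rule fin_dim_basis[OF V])
  have "L ` V = fun_vs.span (L ` B)" using L.span_image[of B] B(4) by simp
  then show ?thesis using fin_dim_span[of "L ` B"] B(1) by simp
qed

lemma fin_dim_sum:
  assumes I: "finite I" and V: "\<And>i. i \<in> I \<Longrightarrow> fin_dim (V i)"
  shows "fin_dim (fun_vs.span (\<Union>i\<in>I. V i))"
proof -
  have "\<exists>B. finite B \<and> fun_vs.span B = V i" if "i \<in> I" for i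
    using fin_dim_basis[OF V[OF that]] by metis
  then obtain B where B: "\<And>i. i \<in> I \<Longrightarrow> finite (B i)" "\<And>i. i \<in> I \<Longrightarrow> fun_vs.span (B i) = V i"
    by metis
  have "V i \<subseteq> fun_vs.span (\<Union>i\<in>I. B i)" if "i \<in> I" for i
    using B(2)[OF that] fun_vs.span_mono[of "B i" "\<Union>i\<in>I. B i"] that by blast
  then have "fun_vs.span (\<Union>i\<in>I. V i) \<subseteq> fun_vs.span (\<Union>i\<in>I. B i)"
    by (intro fun_vs.span_minimal) auto
  moreover have "finite (\<Union>i\<in>I. B i)" using I B(1) by auto
  ultimately show ?thesis
    using fin_dim_subset[OF fin_dim_span fun_vs.subspace_span] by blast
qed

lemma linear_restr: "Vector_Spaces.linear cscale cscale (restr X)"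
  by unfold_locales (auto simp: restr_def fun_eq_iff pointwise algebra_simps)

text \<open>The sets of points lying in a prescribed subfamily of \<open>\<K>\<close> partition the space, and on each
  of them a piecewise \<open>W\<close> function is the restriction of a single element of \<open>W\<close>.\<close>

lemma fin_dim_piecewise:
  assumes \<K>: "finite \<K>" and W: "fin_dim W" and V: "fun_vs.subspace V"
    and out: "\<And>v x. v \<in> V \<Longrightarrow> x \<notin> \<Union>\<K> \<Longrightarrow> v x = 0"
    and pw: "\<And>v K. v \<in> V \<Longrightarrow> K \<in> \<K> \<Longrightarrow> \<exists>f\<in>W. \<forall>x\<in>K. v x = f x"
  shows "fin_dim V"
proof (rule fin_dim_subset[OF fin_dim_sum V])
  define atom where "atom S = {x. {K \<in> \<K>. x \<in> K} = S}" for S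
  show "finite (Pow \<K>)" using \<K> by simp
  show "fin_dim (restr (atom S) ` W)" for S by (rule fin_dim_image[OF W linear_restr])
  show "V \<subseteq> fun_vs.span (\<Union>S\<in>Pow \<K>. restr (atom S) ` W)"
  proof
    fix v assume v: "v \<in> V"
    obtain f where f: "\<And>K. K \<in> \<K> \<Longrightarrow> f K \<in> W" "\<And>K x. K \<in> \<K> \<Longrightarrow> x \<in> K \<Longrightarrow> v x = f K x"
      using pw[OF v] by metis
    define h where "h S = (if S = {} then 0 else f (SOME K. K \<in> S))" for S
    have some: "(SOME K. K \<in> S) \<in> S" if "S \<noteq> {}" for S :: "'a set set"
      using that some_in_eq by blast
    have hW: "h S \<in> W" if "S \<subseteq> \<K>" for S
      using f(1) some[of S] that fun_vs.subspace_0[OF fin_dim_subspace[OF W]] by (auto simp: h_def)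
    have "v = (\<Sum>S\<in>Pow \<K>. restr (atom S) (h S))"
    proof
      fix x
      define S0 where "S0 = {K \<in> \<K>. x \<in> K}"
      have S0: "S0 \<in> Pow \<K>" by (auto simp: S0_def)
      have "(\<Sum>S\<in>Pow \<K>. restr (atom S) (h S)) x = (\<Sum>S\<in>Pow \<K>. restr (atom S) (h S) x)"
        by (rule sum_pointwise)
      also have "\<dots> = (\<Sum>S\<in>Pow \<K>. if S = S0 then h S x else 0)"
        by (intro sum.cong) (auto simp: restr_def atom_def S0_def)
      also have "\<dots> = h S0 x" using S0 \<K> by simp
      also have "\<dots> = v x"
      proof (cases "S0 = {}")
        case True
        then have "x \<notin> \<Union>\<K>" by (auto simp: S0_def)
        then show ?thesis using out[OF v] True by (simp add: h_def pointwise)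
      next
        case False
        have "(SOME K. K \<in> S0) \<in> \<K>" "x \<in> (SOME K. K \<in> S0)"
          using some[OF False] unfolding S0_def by auto
        then show ?thesis using f(2) False by (simp add: h_def)
      qed
      finally show "v x = (\<Sum>S\<in>Pow \<K>. restr (atom S) (h S)) x" by simp
    qed
    also have "\<dots> \<in> fun_vs.span (\<Union>S\<in>Pow \<K>. restr (atom S) ` W)"
      by (rule fun_vs.span_sum, rule fun_vs.span_base) (use hW in auto)
    finally show "v \<in> fun_vs.span (\<Union>S\<in>Pow \<K>. restr (atom S) ` W)" .
  qed
qed

lemma subspace_product:
  fixes W :: "'i \<Rightarrow> ('x \<Rightarrow> complex) set"
  assumes "\<And>j. fun_vs.subspace (W j)"
  shows "fun_vs.subspace {v. \<forall>j. (\<lambda>x. v (j, x)) \<in> W j}"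
proof -
  have "(\<lambda>x. (u + v) (j, x)) = (\<lambda>x. u (j, x)) + (\<lambda>x. v (j, x))"
    "(\<lambda>x. (c *\<^sub>c v) (j, x)) = c *\<^sub>c (\<lambda>x. v (j, x))" "(\<lambda>x. (0::'i \<times> 'x \<Rightarrow> complex) (j, x)) = 0" for u v :: "'i \<times> 'x \<Rightarrow> complex" and j c
    by (auto simp: fun_eq_iff pointwise)
  then show ?thesis
    using assms unfolding fun_vs.subspace_def by simp
qed

lemma fin_dim_product:
  fixes W :: "'i::finite \<Rightarrow> ('x \<Rightarrow> complex) set"
  assumes W: "\<And>j. fin_dim (W j)"
  shows "fin_dim {v. \<forall>j. (\<lambda>x. v (j, x)) \<in> W j}" (is "fin_dim ?V")
proof (rule fin_dim_subset[OF fin_dim_sum subspace_product[OF fin_dim_subspace[OF W]]])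
  define emb :: "'i \<Rightarrow> ('x \<Rightarrow> complex) \<Rightarrow> 'i \<times> 'x \<Rightarrow> complex"
    where "emb j w = (\<lambda>(i, x). if i = j then w x else 0)" for j w
  have "Vector_Spaces.linear cscale cscale (emb j)" for j
    by unfold_locales (auto simp: emb_def fun_eq_iff pointwise algebra_simps)
  then show "fin_dim (emb j ` W j)" for j by (rule fin_dim_image[OF W])
  show "finite (UNIV :: 'i set)" by simp
  show "?V \<subseteq> fun_vs.span (\<Union>j\<in>UNIV. emb j ` W j)"
  proof
    fix v assume v: "v \<in> ?V"
    have "v = (\<Sum>j\<in>UNIV. emb j (\<lambda>x. v (j, x)))"
    proof
      fix z :: "'i \<times> 'x"
      obtain i x where z: "z = (i, x)" by (cases z)
      have "(\<Sum>j\<in>UNIV. emb j (\<lambda>x. v (j, x))) z = (\<Sum>j\<in>UNIV. emb j (\<lambda>x. v (j, x)) z)"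
        by (rule sum_pointwise)
      also have "\<dots> = (\<Sum>j\<in>UNIV. if i = j then v z else 0)"
        by (intro sum.cong) (auto simp: emb_def z)
      finally show "v z = (\<Sum>j\<in>UNIV. emb j (\<lambda>x. v (j, x))) z" by simp
    qed
    also have "\<dots> \<in> fun_vs.span (\<Union>j\<in>UNIV. emb j ` W j)"
      by (rule fun_vs.span_sum, rule fun_vs.span_base) (use v in auto)
    finally show "v \<in> fun_vs.span (\<Union>j\<in>UNIV. emb j ` W j)" .
  qed
qed

definition multi_indices :: "nat \<Rightarrow> ('a::euclidean_space \<Rightarrow> nat) set" where
  "multi_indices p = {m. (\<forall>b. b \<notin> Basis \<longrightarrow> m b = 0) \<and> (\<Sum>b\<in>Basis. m b) \<le> p}"

definition monomial :: "('a::euclidean_space \<Rightarrow> nat) \<Rightarrow> 'a \<Rightarrow> complex" where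
  "monomial m x = (\<Prod>b\<in>Basis. complex_of_real (x \<bullet> b) ^ m b)"

lemma finite_multi_indices: "finite (multi_indices p :: ('a::euclidean_space \<Rightarrow> nat) set)"
proof (rule finite_subset)
  have "m b \<le> p" if "m \<in> multi_indices p" "b \<in> Basis" for m and b :: 'a
    using that member_le_sum[of b Basis m] by (auto simp: multi_indices_def)
  then show "(multi_indices p :: ('a \<Rightarrow> nat) set) \<subseteq> {m. \<forall>x. (x \<in> Basis \<longrightarrow> m x \<in> {..p}) \<and> (x \<notin> Basis \<longrightarrow> m x = 0)}"
    by (auto simp: multi_indices_def)
  show "finite {m::'a \<Rightarrow> nat. \<forall>x. (x \<in> Basis \<longrightarrow> m x \<in> {..p}) \<and> (x \<notin> Basis \<longrightarrow> m x = 0)}"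
    by (rule finite_set_of_finite_funs) auto
qed

lemma polys_iff: "f \<in> polys_deg_le p \<longleftrightarrow> (\<exists>c. \<forall>x. f x = (\<Sum>m\<in>multi_indices p. c m * monomial m x))"
  by (simp add: polys_deg_le_def multi_indices_def monomial_def)

lemma polys_add: "f \<in> polys_deg_le p \<Longrightarrow> g \<in> polys_deg_le p \<Longrightarrow> f + g \<in> polys_deg_le p"
proof -
  assume "f \<in> polys_deg_le p" "g \<in> polys_deg_le p"
  then obtain c d where "\<forall>x. f x = (\<Sum>m\<in>multi_indices p. c m * monomial m x)"
    "\<forall>x. g x = (\<Sum>m\<in>multi_indices p. d m * monomial m x)"
    by (auto simp: polys_iff)
  then show ?thesis
    unfolding polys_iff
    by (intro exI[of _ "\<lambda>m. c m + d m"]) (simp add: pointwise ring_distribs sum.distrib)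
qed

lemma polys_scale: "f \<in> polys_deg_le p \<Longrightarrow> c *\<^sub>c f \<in> polys_deg_le p"
proof -
  assume "f \<in> polys_deg_le p"
  then obtain d where "\<forall>x. f x = (\<Sum>m\<in>multi_indices p. d m * monomial m x)" by (auto simp: polys_iff)
  then show ?thesis
    unfolding polys_iff
    by (intro exI[of _ "\<lambda>m. c * d m"]) (simp add: pointwise sum_distrib_left mult.assoc)
qed

lemma polys_conj: "f \<in> polys_deg_le p \<Longrightarrow> conj_fun f \<in> polys_deg_le p"
proof -
  assume "f \<in> polys_deg_le p"
  then obtain d where "\<forall>x. f x = (\<Sum>m\<in>multi_indices p. d m * monomial m x)" by (auto simp: polys_iff)
  moreover have "cnj (monomial m x) = monomial m x" for m and x :: 'a by (simp add: monomial_def)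
  ultimately show ?thesis
    unfolding polys_iff by (intro exI[of _ "\<lambda>m. cnj (d m)"]) (simp add: conj_fun_def)
qed

lemma polys_const: "(\<lambda>x::'a::euclidean_space. c) \<in> polys_deg_le p"
proof -
  have "(\<Sum>m\<in>multi_indices p. (if m = (\<lambda>_. 0) then c else 0) * monomial m x)
      = (\<Sum>m\<in>(multi_indices p :: ('a \<Rightarrow> nat) set). if m = (\<lambda>_. 0) then c else 0)" for x :: 'a
    by (intro sum.cong) (auto simp: monomial_def)
  moreover have "(\<lambda>_. 0) \<in> (multi_indices p :: ('a \<Rightarrow> nat) set)" by (simp add: multi_indices_def)
  ultimately show ?thesis
    unfolding polys_iff using finite_multi_indices[of p, where 'a = 'a]
    by (intro exI[of _ "\<lambda>m. if m = (\<lambda>_. 0) then c else 0"]) simp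
qed

lemma fin_dim_polys: "fin_dim (polys_deg_le p :: ('a::euclidean_space \<Rightarrow> complex) set)"
proof (rule fin_dim_subset[OF fin_dim_span])
  show "finite (monomial ` (multi_indices p :: ('a \<Rightarrow> nat) set))" using finite_multi_indices by blast
  have "(0::'a \<Rightarrow> complex) \<in> polys_deg_le p" using polys_const[of 0 p] by (simp add: zero_fun_def)
  then show "fun_vs.subspace (polys_deg_le p :: ('a \<Rightarrow> complex) set)"
    using polys_add polys_scale by (auto simp: fun_vs.subspace_def)
  show "(polys_deg_le p :: ('a \<Rightarrow> complex) set) \<subseteq> fun_vs.span (monomial ` multi_indices p)"
  proof
    fix f :: "'a \<Rightarrow> complex" assume "f \<in> polys_deg_le p"
    then obtain c where c: "\<forall>x. f x = (\<Sum>m\<in>multi_indices p. c m * monomial m x)" by (auto simp: polys_iff)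
    have "f = (\<Sum>m\<in>multi_indices p. c m *\<^sub>c monomial m)"
    proof
      fix x
      have "(\<Sum>m\<in>multi_indices p. c m *\<^sub>c monomial m) x = (\<Sum>m\<in>multi_indices p. c m * monomial m x)"
        by (simp add: sum_pointwise pointwise)
      then show "f x = (\<Sum>m\<in>multi_indices p. c m *\<^sub>c monomial m) x" using c by simp
    qed
    also have "\<dots> \<in> fun_vs.span (monomial ` multi_indices p)"
      by (rule fun_vs.span_sum, rule fun_vs.span_scale, rule fun_vs.span_base, rule imageI)
    finally show "f \<in> fun_vs.span (monomial ` multi_indices p)" .
  qed
qed

definition C1 :: "('a::euclidean_space \<Rightarrow> complex) \<Rightarrow> bool" where
  "C1 f \<longleftrightarrow> (\<exists>D. (\<forall>x. (f has_derivative D x) (at x)) \<and> (\<forall>h. continuous_on UNIV (\<lambda>x. D x h)))"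

lemma C1_continuous: "C1 f \<Longrightarrow> continuous_on UNIV f"
  unfolding C1_def by (meson continuous_at_imp_continuous_on has_derivative_continuous)

lemma C1_const: "C1 (\<lambda>x. c)"
  unfolding C1_def by (intro exI[of _ "\<lambda>_ _. 0"]) auto

lemma C1_coord: "C1 (\<lambda>x. complex_of_real (x \<bullet> b))"
  unfolding C1_def
  by (intro exI[of _ "\<lambda>_ h. complex_of_real (h \<bullet> b)"]) (auto intro!: derivative_eq_intros)

lemma C1_add:
  assumes "C1 f" "C1 g"
  shows "C1 (\<lambda>x. f x + g x)"
proof -
  obtain D E where "\<forall>x. (f has_derivative D x) (at x)" "\<forall>h. continuous_on UNIV (\<lambda>x. D x h)"
    "\<forall>x. (g has_derivative E x) (at x)" "\<forall>h. continuous_on UNIV (\<lambda>x. E x h)"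
    using assms unfolding C1_def by blast
  then show ?thesis
    unfolding C1_def
    by (intro exI[of _ "\<lambda>x h. D x h + E x h"]) (auto intro!: has_derivative_add continuous_intros)
qed

lemma C1_mult:
  assumes "C1 f" "C1 g"
  shows "C1 (\<lambda>x. f x * g x)"
proof -
  obtain D E where "\<forall>x. (f has_derivative D x) (at x)" "\<forall>h. continuous_on UNIV (\<lambda>x. D x h)"
    "\<forall>x. (g has_derivative E x) (at x)" "\<forall>h. continuous_on UNIV (\<lambda>x. E x h)"
    using assms unfolding C1_def by blast
  then show ?thesis
    using C1_continuous[OF assms(1)] C1_continuous[OF assms(2)] unfolding C1_def
    by (intro exI[of _ "\<lambda>x h. f x * E x h + D x h * g x"]) (auto intro!: has_derivative_mult continuous_intros)
qed

lemma C1_sum: "finite I \<Longrightarrow> (\<And>i. i \<in> I \<Longrightarrow> C1 (f i)) \<Longrightarrow> C1 (\<lambda>x. \<Sum>i\<in>I. f i x)"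
  by (induction rule: finite_induct) (auto simp: C1_const C1_add)

lemma C1_prod: "finite I \<Longrightarrow> (\<And>i. i \<in> I \<Longrightarrow> C1 (f i)) \<Longrightarrow> C1 (\<lambda>x. \<Prod>i\<in>I. f i x)"
  by (induction rule: finite_induct) (auto simp: C1_const C1_mult)

lemma C1_power: "C1 f \<Longrightarrow> C1 (\<lambda>x. f x ^ n)"
  by (induction n) (auto simp: C1_const C1_mult)

lemma polys_C1:
  assumes "f \<in> polys_deg_le p"
  shows "C1 f"
proof -
  obtain c where "\<And>x. f x = (\<Sum>m\<in>multi_indices p. c m * monomial m x)"
    using assms by (auto simp: polys_iff)
  then have f: "f = (\<lambda>x. \<Sum>m\<in>multi_indices p. c m * monomial m x)" by blast
  show ?thesis
    unfolding f monomial_def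
    by (intro C1_sum C1_mult C1_const C1_prod C1_power C1_coord finite_multi_indices finite_Basis)
qed

lemma mesh_elements:
  assumes "mesh_of \<T> (\<Omega> :: 'a::euclidean_space set)"
  shows "finite \<T>" "\<And>K. K \<in> \<T> \<Longrightarrow> polytope K" "\<And>K. K \<in> \<T> \<Longrightarrow> interior K \<noteq> {}"
    "\<Union>\<T> = closure \<Omega>"
    "\<And>K K'. K \<in> \<T> \<Longrightarrow> K' \<in> \<T> \<Longrightarrow> (K \<inter> K') face_of K \<and> (K \<inter> K') face_of K'"
proof -
  show "finite \<T>" "\<Union>\<T> = closure \<Omega>"
    using assms by (auto simp: mesh_of_def triangulation_def)
  have "(K \<inter> K') face_of K" if "K \<in> \<T>" "K' \<in> \<T>" for K K'
    using assms that by (auto simp: mesh_of_def triangulation_def)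
  then show "\<And>K K'. K \<in> \<T> \<Longrightarrow> K' \<in> \<T> \<Longrightarrow> (K \<inter> K') face_of K \<and> (K \<inter> K') face_of K'"
    by (metis Int_commute)
  fix K assume "K \<in> \<T>"
  then have s: "int DIM('a) simplex K" using assms by (auto simp: mesh_of_def)
  show "polytope K" using s by (rule simplex_imp_polytope)
  have dim: "aff_dim K = int DIM('a)" by (rule aff_dim_simplex[OF s])
  then have "K \<noteq> {}" by auto
  then show "interior K \<noteq> {}"
    using interior_rel_interior[OF dim] rel_interior_eq_empty[OF convex_simplex[OF s]] by simp
qed

lemma Vh_subspace: "fun_vs.subspace (Vh \<T> \<Omega> p)"
proof -
  have "u + v \<in> Vh \<T> \<Omega> p" if uv: "u \<in> Vh \<T> \<Omega> p" "v \<in> Vh \<T> \<Omega> p" for u v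
  proof -
    have "\<exists>f\<in>polys_deg_le p. \<forall>x\<in>K. (u + v) x = f x" if K: "K \<in> \<T>" for K
    proof -
      obtain f g where "f \<in> polys_deg_le p" "\<forall>x\<in>K. u x = f x" "g \<in> polys_deg_le p" "\<forall>x\<in>K. v x = g x"
        using uv K by (fastforce simp: Vh_def)
      then show ?thesis by (intro bexI[of _ "f + g"]) (auto simp: pointwise polys_add)
    qed
    then show ?thesis using uv by (auto simp: Vh_def pointwise plus_fun_def intro!: continuous_on_add)
  qed
  moreover have "c *\<^sub>c u \<in> Vh \<T> \<Omega> p" if u: "u \<in> Vh \<T> \<Omega> p" for c u
  proof -
    have "\<exists>f\<in>polys_deg_le p. \<forall>x\<in>K. (c *\<^sub>c u) x = f x" if K: "K \<in> \<T>" for K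
    proof -
      obtain f where "f \<in> polys_deg_le p" "\<forall>x\<in>K. u x = f x" using u K by (fastforce simp: Vh_def)
      then show ?thesis by (intro bexI[of _ "c *\<^sub>c f"]) (auto simp: pointwise polys_scale)
    qed
    then show ?thesis using u by (auto simp: Vh_def pointwise cscale_def intro!: continuous_on_mult_left)
  qed
  moreover have "0 \<in> Vh \<T> \<Omega> p"
    using polys_const[of 0 p] by (auto simp: Vh_def zero_fun_def)
  ultimately show ?thesis by (auto simp: fun_vs.subspace_def)
qed

lemma fin_dim_Vh:
  assumes "mesh_of \<T> \<Omega>"
  shows "fin_dim (Vh \<T> \<Omega> p)"
  by (rule fin_dim_piecewise[OF mesh_elements(1)[OF assms] fin_dim_polys[of p] Vh_subspace])
    (auto simp: Vh_def mesh_elements(4)[OF assms])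

lemma Vh_conj: "v \<in> Vh \<T> \<Omega> p \<Longrightarrow> conj_fun v \<in> Vh \<T> \<Omega> p"
proof -
  assume v: "v \<in> Vh \<T> \<Omega> p"
  have "\<exists>f\<in>polys_deg_le p. \<forall>x\<in>K. conj_fun v x = f x" if K: "K \<in> \<T>" for K
  proof -
    obtain f where "f \<in> polys_deg_le p" "\<forall>x\<in>K. v x = f x" using v K by (fastforce simp: Vh_def)
    then show ?thesis by (intro bexI[of _ "conj_fun f"]) (auto simp: conj_fun_def intro: polys_conj[unfolded conj_fun_def])
  qed
  then show ?thesis using v by (auto simp: Vh_def conj_fun_def intro!: continuous_on_cnj)
qed

lemma Vh_one: "restr (closure \<Omega>) (\<lambda>_. 1) \<in> Vh \<T> \<Omega> p" if "\<Union>\<T> = closure \<Omega>"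
proof -
  have "continuous_on (closure \<Omega>) (restr (closure \<Omega>) (\<lambda>_. 1)) \<longleftrightarrow> continuous_on (closure \<Omega>) (\<lambda>_. 1 :: complex)"
    by (intro continuous_on_cong) (auto simp: restr_def)
  moreover have "\<exists>f\<in>polys_deg_le p. \<forall>x\<in>K. restr (closure \<Omega>) (\<lambda>_. 1) x = f x" if "K \<in> \<T>" for K
    using \<open>\<Union>\<T> = closure \<Omega>\<close> that polys_const[of 1 p]
    by (intro bexI[of _ "\<lambda>_. 1"]) (auto simp: restr_def)
  ultimately show ?thesis by (auto simp: Vh_def restr_def)
qed

lemma restr_conj: "restr X (conj_fun v) = conj_fun (restr X v)"
  by (auto simp: restr_def conj_fun_def)

lemma product_conj:
  assumes "\<And>j w. w \<in> W j \<Longrightarrow> conj_fun w \<in> W j" and "v \<in> {v. \<forall>j. (\<lambda>x. v (j, x)) \<in> W j}"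
  shows "conj_fun v \<in> {v. \<forall>j. (\<lambda>x. v (j, x)) \<in> W j}"
  using assms by (auto simp: conj_fun_def)

lemma restr_Vh_conj: "w \<in> restr X ` Vh \<T> \<Omega> p \<Longrightarrow> conj_fun w \<in> restr X ` Vh \<T> \<Omega> p"
  by (auto simp: restr_conj[symmetric] intro!: imageI Vh_conj)

lemma fe_spaces:
  fixes D :: "'i::finite \<Rightarrow> 'a::euclidean_space set"
  assumes "mesh_of \<T> \<Omega>"
  shows "fin_dim (Vh_volumes \<T> \<Omega> p D)" "fin_dim (Vh_traces \<T> \<Omega> p D)" "fin_dim (Vh_skeleton \<T> \<Omega> p D)"
    and "\<And>v. v \<in> Vh_volumes \<T> \<Omega> p D \<Longrightarrow> conj_fun v \<in> Vh_volumes \<T> \<Omega> p D"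
    and "\<And>v. v \<in> Vh_traces \<T> \<Omega> p D \<Longrightarrow> conj_fun v \<in> Vh_traces \<T> \<Omega> p D"
    and "\<And>v. v \<in> Vh_skeleton \<T> \<Omega> p D \<Longrightarrow> conj_fun v \<in> Vh_skeleton \<T> \<Omega> p D"
proof -
  have fd: "fin_dim (restr X ` Vh \<T> \<Omega> p)" for X
    by (rule fin_dim_image[OF fin_dim_Vh[OF assms] linear_restr])
  show "fin_dim (Vh_volumes \<T> \<Omega> p D)" "fin_dim (Vh_traces \<T> \<Omega> p D)" "fin_dim (Vh_skeleton \<T> \<Omega> p D)"
    unfolding Vh_volumes_def Vh_traces_def Vh_skeleton_def by (intro fin_dim_product fd)+
  show "\<And>v. v \<in> Vh_volumes \<T> \<Omega> p D \<Longrightarrow> conj_fun v \<in> Vh_volumes \<T> \<Omega> p D"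
    unfolding Vh_volumes_def by (rule product_conj[OF restr_Vh_conj])
  show "\<And>v. v \<in> Vh_traces \<T> \<Omega> p D \<Longrightarrow> conj_fun v \<in> Vh_traces \<T> \<Omega> p D"
    unfolding Vh_traces_def by (rule product_conj[OF restr_Vh_conj])
  show "\<And>v. v \<in> Vh_skeleton \<T> \<Omega> p D \<Longrightarrow> conj_fun v \<in> Vh_skeleton \<T> \<Omega> p D"
    unfolding Vh_skeleton_def by (rule restr_Vh_conj)
qed

lemma trace_op_linear: "linear_map (Vh_volumes \<T> \<Omega> p D) (Vh_traces \<T> \<Omega> p D) (trace_op D)"
  unfolding linear_map_iff
proof (intro conjI ballI allI)
  fix u assume u: "u \<in> Vh_volumes \<T> \<Omega> p D"
  have "(\<lambda>x. trace_op D u (j, x)) \<in> restr (frontier (D j)) ` Vh \<T> \<Omega> p" for j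
  proof -
    obtain w where "w \<in> Vh \<T> \<Omega> p" "(\<lambda>x. u (j, x)) = restr (closure (D j)) w"
      using u by (auto simp: Vh_volumes_def)
    moreover from this(2) have "(\<lambda>x. trace_op D u (j, x)) = restr (frontier (D j)) w"
      by (auto simp: trace_op_def restr_def frontier_def fun_eq_iff)
    ultimately show ?thesis by simp
  qed
  then show "trace_op D u \<in> Vh_traces \<T> \<Omega> p D" by (simp add: Vh_traces_def)
qed (auto simp: trace_op_def fun_eq_iff pointwise)

lemma restriction_op_linear: "linear_map (Vh_skeleton \<T> \<Omega> p D) (Vh_traces \<T> \<Omega> p D) (restriction_op D)"
  unfolding linear_map_iff
proof (intro conjI ballI allI)
  fix u assume "u \<in> Vh_skeleton \<T> \<Omega> p D"
  then obtain w where w: "w \<in> Vh \<T> \<Omega> p" "u = restr (skeleton D) w" by (auto simp: Vh_skeleton_def)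
  then have "(\<lambda>x. restriction_op D u (j, x)) = restr (frontier (D j)) w" for j
    by (auto simp: restriction_op_def restr_def skeleton_def fun_eq_iff)
  then show "restriction_op D u \<in> Vh_traces \<T> \<Omega> p D" using w(1) by (simp add: Vh_traces_def)
qed (auto simp: restriction_op_def fun_eq_iff pointwise)

lemma restriction_op_inj:
  assumes v: "v \<in> Vh_skeleton \<T> \<Omega> p D" and R: "restriction_op D v = 0"
  shows "v = 0"
proof
  fix x
  show "v x = 0 x"
  proof (cases "x \<in> skeleton D")
    case True
    then obtain j where j: "x \<in> frontier (D j)" by (auto simp: skeleton_def)
    have "restriction_op D v (j, x) = 0" using R by (simp add: pointwise)
    then show ?thesis using j by (simp add: restriction_op_def pointwise)
  next
    case False
    then show ?thesis using v by (auto simp: Vh_skeleton_def restr_def pointwise)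
  qed
qed

text \<open>A bounded nonempty set has a frontier, and the constant function does not vanish there.  If the
  trace space were trivial, the supremum and infimum in the convergence theorem would range over the
  empty set.\<close>

lemma Vh_skeleton_nontrivial:
  assumes mesh: "mesh_of \<T> \<Omega>" and D: "polyhedral_region (D j)" "closure (D j) \<subseteq> closure \<Omega>"
  shows "\<exists>v\<in>Vh_skeleton \<T> \<Omega> p D. v \<noteq> 0"
proof -
  have "D j \<noteq> {}" "D j \<noteq> UNIV" using D(1) not_bounded_UNIV by (auto simp: polyhedral_region_def)
  then have "frontier (D j) \<noteq> {}" by (simp add: frontier_not_empty)
  then obtain x where x: "x \<in> frontier (D j)" by blast
  define v where "v = restr (skeleton D) (restr (closure \<Omega>) (\<lambda>_. 1))"
  have "x \<in> skeleton D" using x by (auto simp: skeleton_def)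
  moreover have "x \<in> closure \<Omega>" using x D(2) by (auto simp: frontier_def)
  ultimately have "v x = 1" by (simp add: v_def restr_def)
  then have "v \<noteq> 0" by (auto simp: pointwise)
  moreover have "v \<in> Vh_skeleton \<T> \<Omega> p D"
    unfolding v_def Vh_skeleton_def by (intro imageI Vh_one mesh_elements(4)[OF mesh])
  ultimately show ?thesis by blast
qed

section \<open>Integrals of piecewise polynomials\<close>

definition pieces :: "'a::euclidean_space set set \<Rightarrow> nat \<Rightarrow> ('a \<Rightarrow> complex) \<Rightarrow> bool" where
  "pieces \<K> p u \<longleftrightarrow> (\<forall>K\<in>\<K>. \<exists>f\<in>polys_deg_le p. \<forall>x\<in>K. u x = f x)"

definition integrand :: "real \<Rightarrow> ('a::euclidean_space \<Rightarrow> complex) \<Rightarrow> ('a \<Rightarrow> complex) \<Rightarrow> 'a \<Rightarrow> complex" where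
  "integrand \<kappa> u v x = grad_dot u v x - complex_of_real (\<kappa>\<^sup>2) * u x * v x"

definition volume_form ::
  "real \<Rightarrow> 'a::euclidean_space set \<Rightarrow> ('a \<Rightarrow> complex) \<Rightarrow> ('a \<Rightarrow> complex) \<Rightarrow> complex" where
  "volume_form \<kappa> U u v = set_lebesgue_integral lebesgue U (integrand \<kappa> u v)"

lemma helmholtz_form_eq:
  "helmholtz_form \<T> \<kappa> U E u v = volume_form \<kappa> U u v
     - \<i> * complex_of_real \<kappa> * surface_integral \<T> E (\<lambda>x. u x * v x)"
  by (simp add: helmholtz_form_def volume_form_def integrand_def[abs_def])

lemma frechet_derivative_local:
  assumes "open S" "x \<in> S" "\<And>y. y \<in> S \<Longrightarrow> u y = v y"
  shows "frechet_derivative u (at x) = frechet_derivative v (at x)"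
proof -
  have "(u has_derivative F) (at x) \<longleftrightarrow> (v has_derivative F) (at x)" for F
    using has_derivative_transform_within_open[OF _ assms(1,2)] assms(3) by metis
  then show ?thesis by (simp add: frechet_derivative_def)
qed

lemma integrand_local:
  assumes "open S" "x \<in> S" "\<And>y. y \<in> S \<Longrightarrow> u y = u' y" "\<And>y. y \<in> S \<Longrightarrow> v y = v' y"
  shows "integrand \<kappa> u v x = integrand \<kappa> u' v' x"
  using assms frechet_derivative_local[OF assms(1,2), of u u'] frechet_derivative_local[OF assms(1,2), of v v']
  by (simp add: integrand_def grad_dot_def)

lemma integrand_sym: "integrand \<kappa> u v = integrand \<kappa> v u"
  by (simp add: fun_eq_iff integrand_def grad_dot_def mult.commute mult.left_commute)

lemma helmholtz_form_sym: "helmholtz_form \<T> \<kappa> U E u v = helmholtz_form \<T> \<kappa> U E v u"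
  by (simp add: helmholtz_form_eq volume_form_def integrand_sym[of \<kappa> u v] mult.commute)

lemma integrand_add:
  assumes "u differentiable (at x)" "u' differentiable (at x)"
  shows "integrand \<kappa> (u + u') v x = integrand \<kappa> u v x + integrand \<kappa> u' v x"
proof -
  have "(u + u' has_derivative (\<lambda>h. frechet_derivative u (at x) h + frechet_derivative u' (at x) h)) (at x)"
    unfolding plus_fun_def using assms unfolding frechet_derivative_works by (rule has_derivative_add)
  from frechet_derivative_at[OF this, symmetric] show ?thesis
    by (simp add: integrand_def grad_dot_def pointwise ring_distribs sum.distrib)
qed

lemma integrand_scale:
  assumes "u differentiable (at x)"
  shows "integrand \<kappa> (c *\<^sub>c u) v x = c * integrand \<kappa> u v x"
proof -
  have "(c *\<^sub>c u has_derivative (\<lambda>h. c * frechet_derivative u (at x) h)) (at x)"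
    unfolding cscale_def using assms unfolding frechet_derivative_works by (rule has_derivative_mult_right)
  from frechet_derivative_at[OF this, symmetric] show ?thesis
    by (simp add: integrand_def grad_dot_def pointwise sum_distrib_left algebra_simps)
qed

lemma integrand_real:
  assumes "u differentiable (at x)"
  shows "integrand \<kappa> u (conj_fun u) x = complex_of_real (Re (integrand \<kappa> u (conj_fun u) x))"
proof -
  have "(conj_fun u has_derivative (\<lambda>h. cnj (frechet_derivative u (at x) h))) (at x)"
    unfolding conj_fun_def using assms unfolding frechet_derivative_works by (rule has_derivative_cnj)
  from frechet_derivative_at[OF this, symmetric]
  have "Im (integrand \<kappa> u (conj_fun u) x) = 0"
    by (simp add: integrand_def grad_dot_def conj_fun_def mult.assoc)
  then show ?thesis by (simp add: complex_eq_iff)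
qed

text \<open>A piecewise polynomial on elements that cover \<open>U\<close> is smooth on \<open>U\<close> off the negligible union \<open>N\<close>
  of the frontiers of the elements.\<close>

locale tiling =
  fixes \<K> :: "'a::euclidean_space set set" and U :: "'a set" and p :: nat
  assumes finite: "finite \<K>" and poly: "\<And>K. K \<in> \<K> \<Longrightarrow> polytope K"
    and U_open: "open U" and covers: "U \<subseteq> \<Union>\<K>"
begin

definition "N = (\<Union>K\<in>\<K>. frontier K)"

lemma negligible_N: "negligible N"
  unfolding N_def using finite poly
  by (intro negligible_Union) (auto intro!: negligible_convex_frontier polytope_imp_convex)

lemma in_interior:
  assumes "x \<in> U - N"
  obtains K where "K \<in> \<K>" "x \<in> interior K"
proof -
  obtain K where K: "K \<in> \<K>" "x \<in> K" using assms covers by blast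
  then have "x \<notin> frontier K" using assms by (auto simp: N_def)
  then have "x \<in> interior K" using K closure_subset by (auto simp: frontier_def)
  then show thesis using that K by blast
qed

lemma piece_derivative:
  assumes "pieces \<K> p u" "K \<in> \<K>"
  shows "\<exists>f D. C1 f \<and> (\<forall>x\<in>interior K. u x = f x) \<and> (\<forall>x\<in>interior K. (u has_derivative D x) (at x)) \<and>
    (\<forall>h. continuous_on UNIV (\<lambda>x. D x h))"
proof -
  obtain f where f: "f \<in> polys_deg_le p" "\<forall>x\<in>K. u x = f x" using assms by (auto simp: pieces_def)
  have C: "C1 f" by (rule polys_C1[OF f(1)])
  then obtain D where D: "\<And>x. (f has_derivative D x) (at x)" "\<And>h. continuous_on UNIV (\<lambda>x. D x h)"
    by (auto simp: C1_def)
  have eq: "u x = f x" if "x \<in> interior K" for x using f(2) that interior_subset by blast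
  have "(u has_derivative D x) (at x)" if "x \<in> interior K" for x
    by (rule has_derivative_transform_within_open[OF D(1) open_interior that]) (simp add: eq)
  then show ?thesis using C eq D(2) by blast
qed

lemma pieces_differentiable:
  assumes "pieces \<K> p u" "x \<in> U - N"
  shows "u differentiable (at x)"
proof -
  obtain K where "K \<in> \<K>" "x \<in> interior K" by (rule in_interior[OF assms(2)])
  then show ?thesis using piece_derivative[OF assms(1)] unfolding differentiable_def by blast
qed

text \<open>On the interior of an element the integrand agrees with a function that is continuous on the
  whole space, and finitely many such interiors exhaust \<open>U\<close> up to the null set \<open>N\<close>.\<close>

lemma integrand_integrable:
  assumes u: "pieces \<K> p u" and v: "pieces \<K> p v"
  shows "set_integrable lebesgue U (integrand \<kappa> u v)"
proof -
  have "set_integrable lebesgue (U \<inter> interior K) (integrand \<kappa> u v)" if K: "K \<in> \<K>" for K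
  proof -
    obtain f D where f: "C1 f" "\<forall>x\<in>interior K. u x = f x"
      "\<forall>x\<in>interior K. (u has_derivative D x) (at x)" "\<forall>h. continuous_on UNIV (\<lambda>x. D x h)"
      using piece_derivative[OF u K] by auto
    obtain g D' where g: "C1 g" "\<forall>x\<in>interior K. v x = g x"
      "\<forall>x\<in>interior K. (v has_derivative D' x) (at x)" "\<forall>h. continuous_on UNIV (\<lambda>x. D' x h)"
      using piece_derivative[OF v K] by auto
    define h where "h x = (\<Sum>b\<in>Basis. D x b * D' x b) - complex_of_real (\<kappa>\<^sup>2) * f x * g x" for x
    have "continuous_on UNIV h"
      unfolding h_def using f(4) g(4) C1_continuous[OF f(1)] C1_continuous[OF g(1)]
      by (intro continuous_intros) auto
    obtain a b where ab: "K \<subseteq> cbox a b"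
      using polytope_imp_bounded[OF poly[OF K]] bounded_subset_cbox_symmetric by blast
    have "set_integrable lebesgue (cbox a b) h"
      using \<open>continuous_on UNIV h\<close> by (intro absolutely_integrable_continuous) (auto intro: continuous_on_subset)
    then have "set_integrable lebesgue (U \<inter> interior K) h"
      using ab interior_subset[of K] U_open by (elim set_integrable_subset) auto
    moreover have "integrand \<kappa> u v x = h x" if "x \<in> U \<inter> interior K" for x
    proof -
      have "x \<in> interior K" using that by blast
      then show ?thesis
        using frechet_derivative_at[OF bspec[OF f(3)], of x] frechet_derivative_at[OF bspec[OF g(3)], of x] f(2) g(2)
        by (simp add: integrand_def grad_dot_def h_def)
    qed
    ultimately show ?thesis using set_integrable_cong[of lebesgue lebesgue] by metis
  qed
  then have "set_integrable lebesgue (\<Union>K\<in>\<K>. U \<inter> interior K) (integrand \<kappa> u v)"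
    using finite U_open by (intro set_integrable_UN) auto
  moreover have "negligible {x \<in> U - (\<Union>K\<in>\<K>. U \<inter> interior K). integrand \<kappa> u v x \<noteq> 0}"
  proof (rule negligible_subset[OF negligible_N], rule subsetI, rule ccontr)
    fix x assume x: "x \<in> {x \<in> U - (\<Union>K\<in>\<K>. U \<inter> interior K). integrand \<kappa> u v x \<noteq> 0}" "x \<notin> N"
    then have "x \<in> U - N" by blast
    then obtain K where "K \<in> \<K>" "x \<in> interior K" by (rule in_interior)
    then show False using x by blast
  qed
  moreover have "{x \<in> (\<Union>K\<in>\<K>. U \<inter> interior K) - U. integrand \<kappa> u v x \<noteq> 0} = {}" by blast
  then have "negligible {x \<in> (\<Union>K\<in>\<K>. U \<inter> interior K) - U. integrand \<kappa> u v x \<noteq> 0}"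
    by (simp only: negligible_empty)
  ultimately show ?thesis
    using absolutely_integrable_spike_set_eq[of "\<Union>K\<in>\<K>. U \<inter> interior K" U "integrand \<kappa> u v"] by blast
qed

lemma set_lebesgue_integral_spike:
  assumes "set_integrable lebesgue U f" "\<And>x. x \<in> U - N \<Longrightarrow> g x = (f x :: complex)"
  shows "set_lebesgue_integral lebesgue U g = set_lebesgue_integral lebesgue U f"
proof -
  have "set_integrable lebesgue U g"
    by (rule absolutely_integrable_spike[OF assms(1) negligible_N assms(2)])
  then have "set_lebesgue_integral lebesgue U g = integral U g"
    by (rule set_lebesgue_integral_eq_integral(2))
  also have "\<dots> = integral U f"
    by (rule integral_spike[OF negligible_N]) (use assms(2) in auto)
  finally show ?thesis using set_lebesgue_integral_eq_integral(2)[OF assms(1)] by simp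
qed

lemma volume_form_add:
  assumes "pieces \<K> p u" "pieces \<K> p u'" "pieces \<K> p v"
  shows "volume_form \<kappa> U (u + u') v = volume_form \<kappa> U u v + volume_form \<kappa> U u' v"
proof -
  have i: "set_integrable lebesgue U (integrand \<kappa> u v)" "set_integrable lebesgue U (integrand \<kappa> u' v)"
    by (intro integrand_integrable assms)+
  have "volume_form \<kappa> U (u + u') v = (LINT x:U|lebesgue. integrand \<kappa> u v x + integrand \<kappa> u' v x)"
    unfolding volume_form_def using assms
    by (intro set_lebesgue_integral_spike set_integral_add(1) i integrand_add pieces_differentiable) auto
  then show ?thesis using i by (simp add: volume_form_def)
qed

lemma volume_form_scale:
  assumes "pieces \<K> p u" "pieces \<K> p v"
  shows "volume_form \<kappa> U (c *\<^sub>c u) v = c * volume_form \<kappa> U u v"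
proof -
  have "volume_form \<kappa> U (c *\<^sub>c u) v = (LINT x:U|lebesgue. c * integrand \<kappa> u v x)"
    unfolding volume_form_def using assms
    by (intro set_lebesgue_integral_spike set_integrable_mult_right integrand_integrable integrand_scale
        pieces_differentiable) auto
  then show ?thesis by (simp add: volume_form_def)
qed

lemma volume_form_real:
  assumes "pieces \<K> p u" "pieces \<K> p (conj_fun u)"
  shows "Im (volume_form \<kappa> U u (conj_fun u)) = 0"
proof -
  have "volume_form \<kappa> U u (conj_fun u)
      = (LINT x:U|lebesgue. complex_of_real (Re (integrand \<kappa> u (conj_fun u) x)))"
    unfolding volume_form_def
  proof (rule set_lebesgue_integral_spike[symmetric])
    show "set_integrable lebesgue U (integrand \<kappa> u (conj_fun u))"
      by (rule integrand_integrable[OF assms])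
    show "complex_of_real (Re (integrand \<kappa> u (conj_fun u) x)) = integrand \<kappa> u (conj_fun u) x"
      if "x \<in> U - N" for x
      using integrand_real[OF pieces_differentiable[OF assms(1) that]] by simp
  qed
  then show ?thesis by (simp add: set_integral_complex_of_real)
qed

end

text \<open>The prism of height 1 over a compact set in a hyperplane is bounded.  The aim is that continuous
  functions, and their products with square integrable ones, are integrable over facets.\<close>

lemma facet_measure_finite:
  fixes F :: "'a::euclidean_space set"
  assumes F: "compact F" "aff_dim F < DIM('a)"
  shows "sets (facet_measure F) = sets borel" "emeasure (facet_measure F) F < \<infinity>"
proof -
  obtain a b where ab: "a \<noteq> 0" "F \<subseteq> {x. a \<bullet> x = b}"
    using aff_lowdim_subset_hyperplane[OF F(2)] by blast
  have "\<exists>y. case y of (n, c) \<Rightarrow> norm n = 1 \<and> F \<subseteq> {x. n \<bullet> x = c}"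
    using ab by (intro exI[of _ "(a /\<^sub>R norm a, b / norm a)"]) (auto simp: divide_inverse mult.commute)
  then have some: "case (SOME (n, c). norm n = 1 \<and> F \<subseteq> {x. n \<bullet> x = c}) of
      (n, c) \<Rightarrow> norm n = 1 \<and> F \<subseteq> {x. n \<bullet> x = c}" by (rule someI_ex)
  obtain n c where nc: "(SOME (n, c). norm n = 1 \<and> F \<subseteq> {x. n \<bullet> x = c}) = (n, c)" by fastforce
  have n: "norm n = 1" using some nc by simp
  have fm: "facet_measure F = hyperplane_measure n c" unfolding facet_measure_def nc by simp
  define S where "S = {x. c \<le> n \<bullet> x \<and> n \<bullet> x \<le> c + 1}"
  define \<phi> where "\<phi> x = x - (n \<bullet> x - c) *\<^sub>R n" for x
  have hm: "hyperplane_measure n c = distr (restrict_space lborel S) borel \<phi>"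
    by (simp add: hyperplane_measure_def S_def \<phi>_def[abs_def])
  show "sets (facet_measure F) = sets borel" by (simp add: fm hm)
  have S: "S \<in> sets borel" unfolding S_def by measurable
  have "continuous_on UNIV \<phi>" unfolding \<phi>_def by (intro continuous_intros)
  then have "\<phi> \<in> borel_measurable borel" by (rule borel_measurable_continuous_onI)
  then have \<phi>: "\<phi> \<in> borel_measurable (restrict_space lborel S)"
    by (intro measurable_restrict_space1) simp
  have Fb: "F \<in> sets borel" using F(1) by (simp add: borel_compact)
  obtain r where r: "\<And>x. x \<in> F \<Longrightarrow> norm x \<le> r" using F(1) compact_imp_bounded bounded_iff by metis
  have "norm x \<le> r + 1" if "x \<in> S" "\<phi> x \<in> F" for x
  proof -
    have "x = \<phi> x + (n \<bullet> x - c) *\<^sub>R n" by (simp add: \<phi>_def)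
    then have "norm x \<le> norm (\<phi> x) + norm ((n \<bullet> x - c) *\<^sub>R n)" by (metis norm_triangle_ineq)
    also have "norm ((n \<bullet> x - c) *\<^sub>R n) \<le> 1" using that(1) n by (simp add: S_def)
    finally show ?thesis using r[OF that(2)] by simp
  qed
  then have bd: "bounded (\<phi> -` F \<inter> S)" by (intro boundedI[of _ "r + 1"]) auto
  have "emeasure (facet_measure F) F = emeasure (restrict_space lborel S) (\<phi> -` F \<inter> S)"
    unfolding fm hm using \<phi> Fb by (subst emeasure_distr) (auto simp: space_restrict_space)
  also have "\<dots> = emeasure lborel (\<phi> -` F \<inter> S)"
    using S by (intro emeasure_restrict_space) auto
  also have "\<dots> < \<infinity>" by (rule emeasure_bounded_finite[OF bd])
  finally show "emeasure (facet_measure F) F < \<infinity>" .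
qed

lemma facet_integrable:
  fixes F :: "'a::euclidean_space set" and h :: "'a \<Rightarrow> complex"
  assumes F: "compact F" "aff_dim F < DIM('a)" and h: "continuous_on F h"
  shows "set_integrable (facet_measure F) F h"
proof -
  note fm = facet_measure_finite[OF F]
  have Fb: "F \<in> sets borel" using F(1) by (simp add: borel_compact)
  obtain B where B: "\<And>x. x \<in> F \<Longrightarrow> norm (h x) \<le> B"
    using compact_continuous_image[OF h F(1)] compact_imp_bounded bounded_iff by (metis imageI)
  have "(\<lambda>x. indicator F x *\<^sub>R h x) \<in> borel_measurable borel"
    by (rule borel_measurable_continuous_on_indicator[OF Fb h])
  then have "(\<lambda>x. indicator F x *\<^sub>R h x) \<in> borel_measurable (facet_measure F)"
    using fm(1) by (simp cong: measurable_cong_sets)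
  then have "integrable (facet_measure F) (\<lambda>x. indicator F x *\<^sub>R (indicator F x *\<^sub>R h x))"
    using Fb fm B by (intro integrableI_bounded_set_indicator[where B = B]) auto
  then show ?thesis by (simp add: set_integrable_def flip: indicator_inter_arith)
qed

lemma facet_integrable_L2:
  fixes F :: "'a::euclidean_space set" and f v :: "'a \<Rightarrow> complex"
  assumes F: "compact F" "aff_dim F < DIM('a)" and v: "continuous_on F v"
    and f: "set_borel_measurable (facet_measure F) F f"
      "set_integrable (facet_measure F) F (\<lambda>x. (norm (f x))\<^sup>2)"
  shows "set_integrable (facet_measure F) F (\<lambda>x. f x * v x)"
proof -
  have iv: "set_integrable (facet_measure F) F v" by (rule facet_integrable[OF F v])
  have i1: "set_integrable (facet_measure F) F (\<lambda>_. 1 :: complex)" by (rule facet_integrable[OF F]) simp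
  obtain B where B: "\<And>x. x \<in> F \<Longrightarrow> norm (v x) \<le> B"
    using compact_continuous_image[OF v F(1)] compact_imp_bounded bounded_iff by (metis imageI)
  have mv: "(\<lambda>x. indicator F x *\<^sub>R v x) \<in> borel_measurable (facet_measure F)"
    using iv by (auto simp: set_integrable_def)
  have mf: "(\<lambda>x. indicator F x *\<^sub>R f x) \<in> borel_measurable (facet_measure F)"
    using f(1) by (simp add: set_borel_measurable_def)
  have eq: "(\<lambda>x. indicator F x *\<^sub>R (f x * v x)) = (\<lambda>x. (indicator F x *\<^sub>R f x) * (indicator F x *\<^sub>R v x))"
    by (auto simp: indicator_def fun_eq_iff)
  show ?thesis
    unfolding set_integrable_def
  proof (rule Bochner_Integration.integrable_bound)
    show "(\<lambda>x. indicator F x *\<^sub>R (f x * v x)) \<in> borel_measurable (facet_measure F)"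
      unfolding eq using mf mv by measurable
    have "integrable (facet_measure F) (\<lambda>x. norm (indicator F x *\<^sub>R (1 :: complex)))"
      using i1 unfolding set_integrable_def by (rule integrable_norm)
    moreover have "integrable (facet_measure F) (\<lambda>x. indicator F x *\<^sub>R (norm (f x))\<^sup>2)"
      using f(2) by (simp add: set_integrable_def)
    ultimately show "integrable (facet_measure F)
        (\<lambda>x. B * (norm (indicator F x *\<^sub>R (1 :: complex)) + indicator F x *\<^sub>R (norm (f x))\<^sup>2))"
      by auto
    have "norm (f x * v x) \<le> \<bar>B * (1 + (norm (f x))\<^sup>2)\<bar>" if "x \<in> F" for x
    proof -
      have B0: "0 \<le> B" using B[OF that] norm_ge_zero order_trans by blast
      have "0 \<le> (norm (f x) - 1 / 2)\<^sup>2" by simp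
      then have "norm (f x) \<le> 1 + (norm (f x))\<^sup>2" by (simp add: power2_eq_square algebra_simps)
      then have "norm (f x) * norm (v x) \<le> (1 + (norm (f x))\<^sup>2) * B"
        using B[OF that] by (intro mult_mono) auto
      then show ?thesis using B0 by (simp add: norm_mult mult.commute)
    qed
    then show "AE x in facet_measure F. norm (indicator F x *\<^sub>R (f x * v x))
        \<le> norm (B * (norm (indicator F x *\<^sub>R (1 :: complex)) + indicator F x *\<^sub>R (norm (f x))\<^sup>2))"
      by (intro AE_I2) (auto simp: indicator_def)
  qed
qed

lemma mesh_facet:
  assumes "\<And>K. K \<in> \<T> \<Longrightarrow> polytope K" "F \<in> mesh_facets \<T> E"
  shows "compact F" "aff_dim F < DIM('a)" "F \<subseteq> (E :: 'a::euclidean_space set)"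
proof -
  obtain K where K: "K \<in> \<T>" "F facet_of K" "F \<subseteq> E" using assms(2) by (auto simp: mesh_facets_def)
  show "F \<subseteq> E" by (rule K(3))
  have "F face_of K" "aff_dim F = aff_dim K - 1" using K(2) by (auto simp: facet_of_def)
  then show "compact F" using face_of_polytope_polytope assms(1)[OF K(1)] polytope_imp_compact by blast
  show "aff_dim F < DIM('a)" using \<open>aff_dim F = aff_dim K - 1\<close> aff_dim_le_DIM[of K] by simp
qed

lemma surface_integral_add:
  assumes "\<And>F. F \<in> mesh_facets \<T> E \<Longrightarrow> set_integrable (facet_measure F) F f"
    and "\<And>F. F \<in> mesh_facets \<T> E \<Longrightarrow> set_integrable (facet_measure F) F g"
  shows "surface_integral \<T> E (\<lambda>x. f x + g x) = surface_integral \<T> E f + surface_integral \<T> E g"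
  unfolding surface_integral_def sum.distrib[symmetric]
  by (intro sum.cong refl set_integral_add(2) assms)

lemma surface_integral_scale: "surface_integral \<T> E (\<lambda>x. c * f x) = c * surface_integral \<T> E f"
  by (simp add: surface_integral_def sum_distrib_left)

lemma surface_integral_zero:
  assumes "\<And>x. x \<in> E \<Longrightarrow> f x = 0"
  shows "surface_integral \<T> E f = 0"
  unfolding surface_integral_def
proof (intro sum.neutral ballI)
  fix F assume "F \<in> mesh_facets \<T> E"
  then have "(\<lambda>x. indicator F x *\<^sub>R f x) = (\<lambda>x. 0)"
    using assms by (auto simp: mesh_facets_def indicator_def fun_eq_iff)
  then show "set_lebesgue_integral (facet_measure F) F f = 0" by (simp add: set_lebesgue_integral_def)
qed

lemma surface_integral_nonneg:
  obtains s where "0 \<le> s" "surface_integral \<T> E (\<lambda>x. u x * conj_fun u x) = complex_of_real s"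
proof -
  have eq: "(\<lambda>x. u x * conj_fun u x) = (\<lambda>x. complex_of_real ((cmod (u x))\<^sup>2))"
    by (simp add: conj_fun_def fun_eq_iff complex_norm_square[symmetric])
  define s where "s = (\<Sum>F\<in>mesh_facets \<T> E. LINT x:F|facet_measure F. (cmod (u x))\<^sup>2)"
  have "0 \<le> s"
    unfolding s_def set_lebesgue_integral_def by (intro sum_nonneg integral_nonneg) auto
  moreover have "surface_integral \<T> E (\<lambda>x. u x * conj_fun u x) = complex_of_real s"
    unfolding eq surface_integral_def set_integral_complex_of_real s_def by simp
  ultimately show thesis using that by blast
qed

context tiling
begin

lemma helmholtz_add:
  assumes \<T>: "\<And>K. K \<in> \<T> \<Longrightarrow> polytope K"
    and u: "pieces \<K> p u" "continuous_on E u" and u': "pieces \<K> p u'" "continuous_on E u'"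
    and v: "pieces \<K> p v" "continuous_on E v"
  shows "helmholtz_form \<T> \<kappa> U E (u + u') v = helmholtz_form \<T> \<kappa> U E u v + helmholtz_form \<T> \<kappa> U E u' v"
proof -
  have "surface_integral \<T> E (\<lambda>x. (u + u') x * v x)
      = surface_integral \<T> E (\<lambda>x. u x * v x) + surface_integral \<T> E (\<lambda>x. u' x * v x)"
    unfolding pointwise distrib_right
    by (intro surface_integral_add facet_integrable mesh_facet[OF \<T>] continuous_on_mult
        continuous_on_subset[OF u(2)] continuous_on_subset[OF u'(2)] continuous_on_subset[OF v(2)])
  then show ?thesis
    by (simp add: helmholtz_form_eq volume_form_add[OF u(1) u'(1) v(1)] algebra_simps)
qed

lemma helmholtz_scale:
  assumes "pieces \<K> p u" "pieces \<K> p v"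
  shows "helmholtz_form \<T> \<kappa> U E (c *\<^sub>c u) v = c * helmholtz_form \<T> \<kappa> U E u v"
proof -
  have "surface_integral \<T> E (\<lambda>x. (c *\<^sub>c u) x * v x) = c * surface_integral \<T> E (\<lambda>x. u x * v x)"
    unfolding pointwise mult.assoc by (rule surface_integral_scale)
  then show ?thesis
    by (simp add: helmholtz_form_eq volume_form_scale[OF assms] algebra_simps)
qed

text \<open>The volume part is real, so only the impedance term on the outer boundary contributes to the
  imaginary part.\<close>

lemma helmholtz_dissipative:
  assumes "pieces \<K> p u" "pieces \<K> p (conj_fun u)" "0 < \<kappa>"
  shows "Im (helmholtz_form \<T> \<kappa> U E u (conj_fun u)) \<le> 0"
proof -
  obtain s where "0 \<le> s" "surface_integral \<T> E (\<lambda>x. u x * conj_fun u x) = complex_of_real s"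
    by (rule surface_integral_nonneg)
  then show ?thesis
    using volume_form_real[OF assms(1,2)] assms(3) by (simp add: helmholtz_form_eq)
qed

end

section \<open>The Helmholtz problem on a partitioned mesh\<close>

locale fem_partition =
  fixes \<Omega> :: "'a::euclidean_space set" and \<T> :: "'a set set" and D :: "'i::finite \<Rightarrow> 'a set"
    and \<kappa> :: real and p :: nat and f :: "'a \<Rightarrow> complex"
  assumes domain: "polyhedral_region \<Omega>"
    and mesh: "mesh_of \<T> \<Omega>"
    and \<kappa>: "0 < \<kappa>"
    and f: "surface_L2 \<T> (frontier \<Omega>) f"
    and wellposed: "\<exists>!u. discrete_solution \<T> \<kappa> \<Omega> p f u"
    and region: "\<And>j. polyhedral_region (D j)"
    and disjoint: "\<And>i j. i \<noteq> j \<Longrightarrow> D i \<inter> D j = {}"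
    and cover: "closure \<Omega> = (\<Union>j. closure (D j))"
    and elements: "\<And>j. \<exists>\<M>\<subseteq>\<T>. closure (D j) = \<Union>\<M>"
begin

abbreviation "VO \<equiv> Vh_volumes \<T> \<Omega> p D"
abbreviation "A \<equiv> local_operator \<T> \<kappa> \<Omega> p D"
abbreviation "outer j \<equiv> frontier \<Omega> \<inter> frontier (D j)"

definition "sub j = {K \<in> \<T>. K \<subseteq> closure (D j)}"

lemmas \<T>_finite = mesh_elements(1)[OF mesh] and \<T>_polytope = mesh_elements(2)[OF mesh]
  and \<T>_interior = mesh_elements(3)[OF mesh] and \<T>_cover = mesh_elements(4)[OF mesh]
  and \<T>_faces = mesh_elements(5)[OF mesh]

lemma sub_cover: "closure (D j) = \<Union>(sub j)"
proof -
  obtain \<M> where M: "\<M> \<subseteq> \<T>" "closure (D j) = \<Union>\<M>" using elements by blast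
  then have "\<M> \<subseteq> sub j" by (auto simp: sub_def)
  then show ?thesis using M(2) by (auto simp: sub_def)
qed

lemma sub_coverE:
  assumes "x \<in> closure (D j)"
  obtains K where "K \<in> \<T>" "K \<subseteq> closure (D j)" "x \<in> K"
proof -
  obtain K where "K \<in> sub j" "x \<in> K" using assms sub_cover by blast
  then have "K \<in> \<T>" "K \<subseteq> closure (D j)" "x \<in> K" by (simp_all add: sub_def)
  then show thesis by (rule that)
qed

lemma \<Omega>_open: "open \<Omega>" "interior (closure \<Omega>) = \<Omega>"
  using domain by (auto simp: polyhedral_region_def)

lemma D_open: "open (D j)" "interior (closure (D j)) = D j"
  using region[of j] by (auto simp: polyhedral_region_def)

lemma D_closure_sub: "closure (D j) \<subseteq> closure \<Omega>"
  using cover by blast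

lemma D_sub: "D j \<subseteq> \<Omega>"
  using interior_mono[OF D_closure_sub[of j]] by (simp add: D_open \<Omega>_open)

sublocale whole: tiling \<T> \<Omega> p
  by unfold_locales (use \<T>_finite \<T>_polytope \<Omega>_open \<T>_cover closure_subset[of \<Omega>] in auto)

sublocale part: tiling "sub j" "D j" p for j
proof
  show "finite (sub j)" using \<T>_finite by (simp add: sub_def)
  show "polytope K" if "K \<in> sub j" for K using that \<T>_polytope by (simp add: sub_def)
  show "open (D j)" by (rule D_open)
  show "D j \<subseteq> \<Union>(sub j)" using closure_subset[of "D j"] sub_cover[of j] by blast
qed

text \<open>A subdomain equals the interior of its closure, so its frontier is made of element frontiers.\<close>

lemma closure_off_frontiers:
  assumes "x \<in> closure (D j)" "x \<notin> whole.N"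
  shows "x \<in> D j"
proof -
  obtain K where K: "K \<in> \<T>" "K \<subseteq> closure (D j)" "x \<in> K"
    by (rule sub_coverE[OF assms(1)])
  then have "x \<in> interior K"
    using assms(2) closure_subset[of K] by (auto simp: whole.N_def frontier_def)
  then have "x \<in> interior (closure (D j))" using interior_mono[OF K(2)] by blast
  then show ?thesis by (simp add: D_open)
qed

lemma closure_disjoint:
  assumes "i \<noteq> j" "x \<in> closure (D j)"
  shows "x \<notin> D i"
  using open_Int_closure_eq_empty[OF D_open(1)[of i], of "D j"] disjoint[OF assms(1)] assms(2) by blast

lemma frontier_D: "frontier (D j) = closure (D j) - D j"
  using D_open(1)[of j] by (simp add: frontier_def interior_open)

lemma frontier_\<Omega>: "frontier \<Omega> = closure \<Omega> - \<Omega>"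
  using \<Omega>_open(1) by (simp add: frontier_def interior_open)

text \<open>A mesh element has an interior point off all element boundaries.  It lies in some
  \<open>closure (D j)\<close>, hence in the interior of an element that tiles it, and two elements of a
  conforming mesh with a common interior point coincide.\<close>

lemma element_in_part:
  assumes K: "K \<in> \<T>"
  obtains j where "K \<in> sub j"
proof -
  have "\<not> interior K \<subseteq> whole.N"
    using open_not_negligible[OF open_interior \<T>_interior[OF K]] negligible_subset[OF whole.negligible_N] by blast
  then obtain x where x: "x \<in> interior K" "x \<notin> whole.N" by blast
  have "x \<in> closure \<Omega>" using x(1) K \<T>_cover interior_subset by blast
  then obtain j where "x \<in> closure (D j)" using cover by blast
  then obtain K' where K': "K' \<in> \<T>" "K' \<subseteq> closure (D j)" "x \<in> K'" by (rule sub_coverE)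
  have face: "K \<inter> K' face_of K" using \<T>_faces[OF K K'(1)] by blast
  have "(K \<inter> K') \<inter> interior K \<noteq> {}" using x(1) K'(3) interior_subset[of K] by blast
  then have "K \<inter> K' = K" using face_of_disjoint_interior[OF face] by blast
  then have "K \<in> sub j" using K K'(2) by (auto simp: sub_def)
  then show thesis by (rule that)
qed

lemma Vh_pieces: "v \<in> Vh \<T> \<Omega> p \<Longrightarrow> pieces \<T> p v"
  by (simp add: Vh_def pieces_def)

lemma Vh_continuous: "v \<in> Vh \<T> \<Omega> p \<Longrightarrow> continuous_on (closure \<Omega>) v"
  by (simp add: Vh_def)

lemma restr_Vh:
  assumes "v \<in> Vh \<T> \<Omega> p"
  shows "pieces (sub j) p (restr (closure (D j)) v)" "continuous_on (closure (D j)) (restr (closure (D j)) v)"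
proof -
  have "\<exists>f\<in>polys_deg_le p. \<forall>x\<in>K. restr (closure (D j)) v x = f x" if K: "K \<in> sub j" for K
  proof -
    have "K \<in> \<T>" "K \<subseteq> closure (D j)" using K by (auto simp: sub_def)
    then obtain f where "f \<in> polys_deg_le p" "\<forall>x\<in>K. v x = f x"
      using Vh_pieces[OF assms] by (auto simp: pieces_def)
    then show ?thesis using \<open>K \<subseteq> closure (D j)\<close> by (intro bexI[of _ f]) (auto simp: restr_def)
  qed
  then show "pieces (sub j) p (restr (closure (D j)) v)" by (simp add: pieces_def)
  have "continuous_on (closure (D j)) v"
    using Vh_continuous[OF assms] D_closure_sub by (rule continuous_on_subset)
  then show "continuous_on (closure (D j)) (restr (closure (D j)) v)"
    by (rule continuous_on_eq) (simp add: restr_def)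
qed

lemma VO_component:
  assumes "u \<in> VO"
  shows "pieces (sub j) p (\<lambda>x. u (j, x))" "continuous_on (closure (D j)) (\<lambda>x. u (j, x))"
    "x \<notin> closure (D j) \<Longrightarrow> u (j, x) = 0"
proof -
  obtain v where v: "v \<in> Vh \<T> \<Omega> p" "(\<lambda>x. u (j, x)) = restr (closure (D j)) v"
    using assms by (auto simp: Vh_volumes_def)
  show "pieces (sub j) p (\<lambda>x. u (j, x))" "continuous_on (closure (D j)) (\<lambda>x. u (j, x))"
    unfolding v(2) by (rule restr_Vh[OF v(1)])+
  show "u (j, x) = 0" if "x \<notin> closure (D j)"
    using fun_cong[OF v(2), of x] that by (simp add: restr_def)
qed

lemma VO_component_outer: "u \<in> VO \<Longrightarrow> continuous_on (outer j) (\<lambda>x. u (j, x))"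
  by (rule continuous_on_subset[OF VO_component(2)]) (auto simp: frontier_D)

abbreviation "local_form j u v \<equiv>
  helmholtz_form \<T> \<kappa> (D j) (outer j) (\<lambda>x. u (j, x)) (\<lambda>x. v (j, x))"

lemma A_apply: "v \<in> VO \<Longrightarrow> A u v = (\<Sum>j\<in>UNIV. local_form j u v)"
  by (simp add: local_operator_def restr_def)

lemma component_add: "(\<lambda>x. (u + u') (j, x)) = (\<lambda>x. u (j, x)) + (\<lambda>x. (u' :: 'i \<times> 'a \<Rightarrow> complex) (j, x))"
  and component_scale: "(\<lambda>x. (c *\<^sub>c u) (j, x)) = c *\<^sub>c (\<lambda>x. u (j, x))"
  and component_conj: "(\<lambda>x. conj_fun u (j, x)) = conj_fun (\<lambda>x. u (j, x))"
  by (auto simp: fun_eq_iff pointwise conj_fun_def)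

lemma local_form_add_left:
  "\<lbrakk>u \<in> VO; u' \<in> VO; v \<in> VO\<rbrakk> \<Longrightarrow> local_form j (u + u') v = local_form j u v + local_form j u' v"
  unfolding component_add
  by (intro part.helmholtz_add \<T>_polytope VO_component(1) VO_component_outer)

lemma local_form_scale_left:
  "\<lbrakk>u \<in> VO; v \<in> VO\<rbrakk> \<Longrightarrow> local_form j (c *\<^sub>c u) v = c * local_form j u v"
  unfolding component_scale by (intro part.helmholtz_scale VO_component(1))

lemma local_form_sym: "local_form j u v = local_form j v u"
  by (rule helmholtz_form_sym)

lemmas VO_fin_dim = fe_spaces(1)[OF mesh, of p D]
lemmas VO_subspace = fin_dim_subspace[OF VO_fin_dim]

lemma A_linear: "linear_map VO (dual VO) A"
  unfolding linear_map_iff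
proof (intro conjI ballI allI)
  note closed = fun_vs.subspace_add[OF VO_subspace] fun_vs.subspace_scale[OF VO_subspace]
  show "A u \<in> dual VO" if u: "u \<in> VO" for u
    unfolding dual_iff
  proof (intro conjI ballI allI impI)
    fix v w assume vw: "v \<in> VO" "w \<in> VO"
    have "local_form j u (v + w) = local_form j u v + local_form j u w" for j
      unfolding local_form_sym[of j u] by (rule local_form_add_left[OF vw u])
    then show "A u (v + w) = A u v + A u w"
      using vw closed by (simp add: A_apply sum.distrib)
  next
    fix c v assume v: "v \<in> VO"
    have "local_form j u (c *\<^sub>c v) = c * local_form j u v" for j
      unfolding local_form_sym[of j u] by (rule local_form_scale_left[OF v u])
    then show "A u (c *\<^sub>c v) = c * A u v"
      using v closed by (simp add: A_apply sum_distrib_left)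
  qed (simp add: local_operator_def restr_def)
  show "A (u + v) = A u + A v" if "u \<in> VO" "v \<in> VO" for u v
  proof
    fix w
    show "A (u + v) w = (A u + A v) w"
      using local_form_add_left[OF that, of w] that closed
      by (cases "w \<in> VO") (simp_all add: pointwise A_apply sum.distrib local_operator_def[of _ _ _ _ _ _] restr_def)
  qed
  show "A (c *\<^sub>c u) = c *\<^sub>c A u" if "u \<in> VO" for c u
  proof
    fix w
    show "A (c *\<^sub>c u) w = (c *\<^sub>c A u) w"
      using local_form_scale_left[OF that, of w] that closed
      by (cases "w \<in> VO") (simp_all add: pointwise A_apply sum_distrib_left local_operator_def restr_def)
  qed
qed

lemma A_dissipative:
  assumes u: "u \<in> VO"
  shows "Im (A u (conj_fun u)) \<le> 0"
proof -
  have cu: "conj_fun u \<in> VO" by (rule fe_spaces(4)[OF mesh u])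
  have "Im (local_form j u (conj_fun u)) \<le> 0" for j
    using VO_component(1)[OF cu, of j] unfolding component_conj
    by (intro part.helmholtz_dissipative VO_component(1)[OF u] \<kappa>)
  then show ?thesis unfolding A_apply[OF cu] by (simp add: sum_nonpos)
qed

lemma load_in_dual: "local_load \<T> \<Omega> p D f \<in> dual VO"
proof -
  define l where "l j v = surface_integral \<T> (outer j) (\<lambda>x. f x * v (j, x))" for j and v :: "'i \<times> 'a \<Rightarrow> complex"
  have load: "local_load \<T> \<Omega> p D f v = (if v \<in> VO then \<Sum>j\<in>UNIV. l j v else 0)" for v
    by (simp add: local_load_def restr_def l_def)
  have int: "set_integrable (facet_measure F) F (\<lambda>x. f x * v (j, x))"
    if v: "v \<in> VO" and F: "F \<in> mesh_facets \<T> (outer j)" for v j F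
  proof (rule facet_integrable_L2[OF mesh_facet(1,2)[OF \<T>_polytope F]])
    show "continuous_on F (\<lambda>x. v (j, x))"
      using VO_component_outer[OF v] mesh_facet(3)[OF \<T>_polytope F] by (rule continuous_on_subset)
    have "F \<in> mesh_facets \<T> (frontier \<Omega>)" using F by (auto simp: mesh_facets_def)
    then show "set_borel_measurable (facet_measure F) F f"
      "set_integrable (facet_measure F) F (\<lambda>x. (norm (f x))\<^sup>2)"
      using f by (auto simp: surface_L2_def)
  qed
  have add: "l j (u + v) = l j u + l j v" if "u \<in> VO" "v \<in> VO" for j u v
    unfolding l_def pointwise distrib_left by (intro surface_integral_add int that)
  have scale: "l j (c *\<^sub>c v) = c * l j v" for j c v
    unfolding l_def pointwise surface_integral_scale[symmetric] by (simp add: algebra_simps)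
  show ?thesis
    unfolding dual_iff load
    using fun_vs.subspace_add[OF VO_subspace] fun_vs.subspace_scale[OF VO_subspace]
    by (simp add: add scale sum.distrib sum_distrib_left)
qed

text \<open>Local functions without traces glue to a global finite element function.  If they solve the
  homogeneous local problems, the glued function solves the homogeneous global problem, whose
  only solution is zero.\<close>

lemma trace_free_solution:
  assumes u: "u \<in> VO" and trace: "trace_op D u = 0" and Au: "A u = 0"
  shows "u = 0"
proof -
  have u0: "u (j, x) = 0" if "x \<notin> D j" for j x
  proof (cases "x \<in> frontier (D j)")
    case True
    have "trace_op D u (j, x) = 0" using trace by (simp add: pointwise)
    then show ?thesis using True by (simp add: trace_op_def)
  next
    case False
    then show ?thesis using that VO_component(3)[OF u] by (auto simp: frontier_D)
  qed
  define w where "w x = (\<Sum>j\<in>UNIV. u (j, x))" for x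
  have w_eq: "w x = u (j, x)" if "x \<in> closure (D j)" for j x
  proof -
    have "w x = (\<Sum>i\<in>UNIV. if i = j then u (j, x) else 0)"
      unfolding w_def using u0 closure_disjoint[OF _ that] by (intro sum.cong) auto
    then show ?thesis by simp
  qed
  have wV: "w \<in> Vh \<T> \<Omega> p"
    unfolding Vh_def
  proof (intro CollectI conjI allI impI ballI)
    have "continuous_on (closure (D j)) w" for j
      by (rule continuous_on_eq[OF VO_component(2)[OF u, of j]]) (simp add: w_eq)
    then show "continuous_on (closure \<Omega>) w"
      unfolding cover by (intro continuous_on_closed_Union) auto
    show "w x = 0" if "x \<notin> closure \<Omega>" for x
      using that cover VO_component(3)[OF u] by (auto simp: w_def)
    fix K assume "K \<in> \<T>"
    then obtain j where j: "K \<in> sub j" by (rule element_in_part)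
    then have "K \<subseteq> closure (D j)" by (simp add: sub_def)
    moreover obtain h where "h \<in> polys_deg_le p" "\<forall>x\<in>K. u (j, x) = h x"
      using VO_component(1)[OF u, of j] j by (auto simp: pieces_def)
    ultimately show "\<exists>h\<in>polys_deg_le p. \<forall>x\<in>K. w x = h x"
      using w_eq by (intro bexI[of _ h]) auto
  qed
  \<comment> \<open>both the global and the local boundary terms vanish with \<open>w\<close> on the outer boundary\<close>
  have w_frontier: "w x = 0" if "x \<in> frontier \<Omega>" for x
  proof -
    have "x \<notin> D j" for j using that D_sub[of j] by (auto simp: frontier_\<Omega>)
    then show ?thesis by (simp add: w_def u0)
  qed
  have zero: "helmholtz_form \<T> \<kappa> \<Omega> (frontier \<Omega>) w v = 0" if v: "v \<in> Vh \<T> \<Omega> p" for v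
  proof -
    define vv where "vv = (\<lambda>(j, x). restr (closure (D j)) v x)"
    have vv: "vv \<in> VO" using v by (simp add: Vh_volumes_def vv_def)
    note i = whole.integrand_integrable[OF Vh_pieces[OF wV] Vh_pieces[OF v], of \<kappa>]
    have iD: "set_integrable lebesgue (D j) (integrand \<kappa> w v)" for j
      using i by (rule set_integrable_subset) (use D_open D_sub in auto)
    have iU: "set_integrable lebesgue (\<Union>j. D j) (integrand \<kappa> w v)"
      by (intro set_integrable_UN iD) (use D_open in auto)
    have "volume_form \<kappa> \<Omega> w v = integral \<Omega> (integrand \<kappa> w v)"
      unfolding volume_form_def by (rule set_lebesgue_integral_eq_integral(2)[OF i])
    also have "\<dots> = integral (\<Union>j. D j) (integrand \<kappa> w v)"
    proof (rule integral_spike_set)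
      have "\<Omega> - (\<Union>j. D j) \<subseteq> whole.N"
      proof (rule subsetI, rule ccontr)
        fix x assume x: "x \<in> \<Omega> - (\<Union>j. D j)" "x \<notin> whole.N"
        have "x \<in> closure \<Omega>" using x(1) closure_subset by blast
        then obtain j where "x \<in> closure (D j)" using cover by blast
        then have "x \<in> D j" using x(2) by (rule closure_off_frontiers)
        then show False using x(1) by blast
      qed
      then show "negligible {x \<in> \<Omega> - (\<Union>j. D j). integrand \<kappa> w v x \<noteq> 0}"
        by (intro negligible_subset[OF whole.negligible_N]) blast
      have "{x \<in> (\<Union>j. D j) - \<Omega>. integrand \<kappa> w v x \<noteq> 0} = {}" using D_sub by blast
      then show "negligible {x \<in> (\<Union>j. D j) - \<Omega>. integrand \<kappa> w v x \<noteq> 0}" by (simp only: negligible_empty)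
    qed
    also have "\<dots> = set_lebesgue_integral lebesgue (\<Union>j\<in>UNIV. D j) (integrand \<kappa> w v)"
      by (rule set_lebesgue_integral_eq_integral(2)[OF iU, symmetric])
    also have "\<dots> = (\<Sum>j\<in>UNIV. set_lebesgue_integral lebesgue (D j) (integrand \<kappa> w v))"
      using disjoint D_open by (intro set_integral_finite_UN_AE iD AE_I2) auto
    also have "\<dots> = (\<Sum>j\<in>UNIV. volume_form \<kappa> (D j) (\<lambda>x. u (j, x)) (\<lambda>x. vv (j, x)))"
    proof (intro sum.cong refl)
      fix j
      have "integrand \<kappa> w v x = integrand \<kappa> (\<lambda>x. u (j, x)) (\<lambda>x. vv (j, x)) x" if "x \<in> D j" for x
        using closure_subset[of "D j"]
        by (intro integrand_local[OF D_open(1) that]) (auto simp: w_eq vv_def restr_def)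
      then show "set_lebesgue_integral lebesgue (D j) (integrand \<kappa> w v)
          = volume_form \<kappa> (D j) (\<lambda>x. u (j, x)) (\<lambda>x. vv (j, x))"
        unfolding volume_form_def using D_open(1)[of j] by (intro set_lebesgue_integral_cong) auto
    qed
    also have "\<dots> = (\<Sum>j\<in>UNIV. local_form j u vv)"
    proof (intro sum.cong refl)
      fix j
      have "surface_integral \<T> (outer j) (\<lambda>x. u (j, x) * vv (j, x)) = 0"
        using u0 by (intro surface_integral_zero) (auto simp: frontier_D)
      then show "volume_form \<kappa> (D j) (\<lambda>x. u (j, x)) (\<lambda>x. vv (j, x)) = local_form j u vv"
        by (simp add: helmholtz_form_eq)
    qed
    also have "\<dots> = A u vv" by (rule A_apply[OF vv, symmetric])
    also have "\<dots> = 0" using Au by (simp add: pointwise)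
    finally have "volume_form \<kappa> \<Omega> w v = 0" .
    moreover have "surface_integral \<T> (frontier \<Omega>) (\<lambda>x. w x * v x) = 0"
      using w_frontier by (intro surface_integral_zero) auto
    ultimately show ?thesis by (simp add: helmholtz_form_eq)
  qed
  obtain s where s: "discrete_solution \<T> \<kappa> \<Omega> p f s" using wellposed by blast
  have sV: "s \<in> Vh \<T> \<Omega> p" using s by (simp add: discrete_solution_def)
  have on_frontier: "continuous_on (frontier \<Omega>) v" if "v \<in> Vh \<T> \<Omega> p" for v
    using Vh_continuous[OF that] by (rule continuous_on_subset) (auto simp: frontier_\<Omega>)
  have "discrete_solution \<T> \<kappa> \<Omega> p f (s + w)"
    unfolding discrete_solution_def
  proof (intro conjI ballI)
    show "s + w \<in> Vh \<T> \<Omega> p" by (rule fun_vs.subspace_add[OF Vh_subspace sV wV])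
    fix v assume "v \<in> Vh \<T> \<Omega> p"
    then have cv: "conj_fun v \<in> Vh \<T> \<Omega> p" by (rule Vh_conj)
    have "helmholtz_form \<T> \<kappa> \<Omega> (frontier \<Omega>) (s + w) (conj_fun v)
        = helmholtz_form \<T> \<kappa> \<Omega> (frontier \<Omega>) s (conj_fun v) + helmholtz_form \<T> \<kappa> \<Omega> (frontier \<Omega>) w (conj_fun v)"
      by (intro whole.helmholtz_add \<T>_polytope Vh_pieces on_frontier sV wV cv)
    then show "helmholtz_form \<T> \<kappa> \<Omega> (frontier \<Omega>) (s + w) (conj_fun v)
        = surface_integral \<T> (frontier \<Omega>) (\<lambda>x. f x * conj_fun v x)"
      using s \<open>v \<in> Vh \<T> \<Omega> p\<close> zero[OF cv] by (simp add: discrete_solution_def)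
  qed
  then have "s + w = s" using s wellposed by blast
  then have w0: "w = 0" by simp
  show "u = 0"
  proof
    fix z :: "'i \<times> 'a"
    obtain j x where z: "z = (j, x)" by (cases z)
    show "u z = 0 z"
    proof (cases "x \<in> closure (D j)")
      case True
      then show ?thesis using w_eq[OF True] w0 by (simp add: z pointwise)
    next
      case False
      then show ?thesis using VO_component(3)[OF u False] by (simp add: z pointwise)
    qed
  qed
qed

lemma decomposes:
  assumes "hermitian_posdef (Vh_traces \<T> \<Omega> p D) T" and "hermitian_posdef_dual (Vh_skeleton \<T> \<Omega> p D) P"
  shows "domain_decomposition VO (Vh_traces \<T> \<Omega> p D) (Vh_skeleton \<T> \<Omega> p D) A T
    (local_load \<T> \<Omega> p D f) (trace_op D) (restriction_op D) P"
proof (rule domain_decomposition.intro)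
  show "fin_dim VO" by (rule fe_spaces(1)[OF mesh])
  show "fin_dim (Vh_traces \<T> \<Omega> p D)" by (rule fe_spaces(2)[OF mesh])
  show "fin_dim (Vh_skeleton \<T> \<Omega> p D)" by (rule fe_spaces(3)[OF mesh])
  show "conj_fun v \<in> VO" if "v \<in> VO" for v using that by (rule fe_spaces(4)[OF mesh])
  show "conj_fun v \<in> Vh_traces \<T> \<Omega> p D" if "v \<in> Vh_traces \<T> \<Omega> p D" for v
    using that by (rule fe_spaces(5)[OF mesh])
  show "conj_fun v \<in> Vh_skeleton \<T> \<Omega> p D" if "v \<in> Vh_skeleton \<T> \<Omega> p D" for v
    using that by (rule fe_spaces(6)[OF mesh])
  show "\<exists>v\<in>Vh_skeleton \<T> \<Omega> p D. v \<noteq> 0"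
    by (rule Vh_skeleton_nontrivial[where D = D, OF mesh region D_closure_sub])
  show "trace_op D (conj_fun v) = conj_fun (trace_op D v)" for v
    by (auto simp: trace_op_def conj_fun_def)
  show "restriction_op D (conj_fun v) = conj_fun (restriction_op D v)" for v
    by (auto simp: restriction_op_def conj_fun_def)
  show "u = 0" if "u \<in> VO" "trace_op D u = 0" "A u = 0" for u using that by (rule trace_free_solution)
  show "Im (A u (conj_fun u)) \<le> 0" if "u \<in> VO" for u using that by (rule A_dissipative)
  show "v = 0" if "v \<in> Vh_skeleton \<T> \<Omega> p D" "restriction_op D v = 0" for v
    using that by (rule restriction_op_inj)
qed (rule A_linear load_in_dual trace_op_linear restriction_op_linear assms)+

end

theorem lemma7p2:
  fixes \<Omega> :: "'a::euclidean_space set" and \<T> :: "'a set set"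
    and D :: "'i::finite \<Rightarrow> 'a set"
    and \<kappa> \<alpha> \<rho> \<gamma> \<epsilon> :: real and f :: "'a \<Rightarrow> complex" and p k :: nat
    and T :: "('i \<times> 'a \<Rightarrow> complex) \<Rightarrow> ('i \<times> 'a \<Rightarrow> complex) \<Rightarrow> complex"
    and P :: "(('a \<Rightarrow> complex) \<Rightarrow> complex) \<Rightarrow> 'a \<Rightarrow> complex"
    and qt :: "nat \<Rightarrow> ('i \<times> 'a \<Rightarrow> complex) \<Rightarrow> complex"
    and pt :: "nat \<Rightarrow> 'a \<Rightarrow> complex"
  assumes domain: "polyhedral_region \<Omega>" "connected \<Omega>"
    and mesh: "mesh_of \<T> \<Omega>"
    and p: "p \<ge> 1"
    and kappa: "\<kappa> > 0"
    and f: "surface_L2 \<T> (frontier \<Omega>) f"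
    and wellposed: "\<exists>!u. discrete_solution \<T> \<kappa> \<Omega> p f u"
    and partition:
      "\<And>j. polyhedral_region (D j)"
      "\<And>i j. i \<noteq> j \<Longrightarrow> D i \<inter> D j = {}"
      "closure \<Omega> = (\<Union>j. closure (D j))"
      "\<And>j. \<exists>\<M>\<subseteq>\<T>. closure (D j) = \<Union>\<M>"
    and spaces:
      "VO = Vh_volumes \<T> \<Omega> p D"
      "VG = Vh_traces \<T> \<Omega> p D"
      "VS = Vh_skeleton \<T> \<Omega> p D"
    and operators:
      "A = local_operator \<T> \<kappa> \<Omega> p D"
      "l = local_load \<T> \<Omega> p D f"
      "B = trace_op D"
      "R = restriction_op D"
      "Bs = adjoint_on VO B"
      "Rs = adjoint_on VS R"
    and T: "hermitian_posdef VG T"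
    and P: "hermitian_posdef_dual VS P"
    and RTR: "RTR = (\<lambda>\<eta>. Rs (T (R \<eta>)))"
    and Pex: "Pex = (\<lambda>q v. 2 * T (R (inv_into VS RTR (Rs q))) v - q v)"
    and M: "M = (\<lambda>u v. A u v - \<i> * Bs (T (B u)) v)"
    and S: "S = (\<lambda>q v. q v + 2 * \<i> * T (B (inv_into VO M (Bs q))) v)"
    and g: "g = (\<lambda>v. 2 * \<i> * T (B (inv_into VO M l)) v)"
    and k: "k \<ge> 1"
    and alpha: "0 < \<alpha>" "\<alpha> < 1"
    and init: "qt 0 = (\<lambda>_. 0)" "pt 0 = (\<lambda>_. 0)"
    and iter_p: "\<And>n. pt (Suc n) = pcg VS RTR P k (pt n) (Rs (S (qt n)))"
    and iter_q: "\<And>n. qt (Suc n) =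
      (\<lambda>v. complex_of_real (1 - \<alpha>) * qt n v + complex_of_real \<alpha> * S (qt n) v
            - 2 * complex_of_real \<alpha> * T (R (pt (Suc n))) v + complex_of_real \<alpha> * g v)"
    and norm_def: "N = dual_norm VG T"
    and rho: "\<rho> = (SUP q\<in>dual VG - {\<lambda>_. 0}.
      N (\<lambda>v. complex_of_real (1 - \<alpha>) * q v - complex_of_real \<alpha> * Pex (S q) v) / N q)"
    and gamma: "\<gamma> = (INF q\<in>dual VG - {\<lambda>_. 0}. N (\<lambda>v. q v + Pex (S q) v) / N q)"
    and eps: "\<epsilon> = 2 * ((sqrt (cond_on VS (\<lambda>v. P (RTR v))) - 1)
                      / (sqrt (cond_on VS (\<lambda>v. P (RTR v))) + 1)) ^ k"
    and eps_small: "\<epsilon> < (\<alpha> * (1 - \<alpha>) * \<gamma>\<^sup>2 / 4)\<^sup>2"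
  shows "\<exists>qinf\<in>dual VG.
    (\<forall>q\<in>dual VG. (\<lambda>v. q v + Pex (S q) v) = g \<longleftrightarrow> q = qinf) \<and>
    (\<lambda>n. N (\<lambda>v. qt n v - qinf v)) \<longlonglongrightarrow> 0 \<and>
    (\<rho> + 2 * sqrt \<epsilon> < 1 \<and>
      (\<forall>n. N (\<lambda>v. qt n v - qinf v)
            \<le> N (qt 1) / (1 - (\<rho> + 2 * sqrt \<epsilon>)) * (\<rho> + 2 * sqrt \<epsilon>) ^ n)) \<and>
    (\<epsilon> < (\<alpha> * (1 - \<alpha>) * \<gamma>\<^sup>2 / 8)\<^sup>2 \<longrightarrow> \<rho> + 4 * sqrt \<epsilon> < 1) \<and>
    (\<rho> + 4 * sqrt \<epsilon> < 1 \<longrightarrow>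
      (\<forall>n. N (\<lambda>v. qt n v - qinf v)
            \<le> N (qt 1) / (1 - (\<rho> + 4 * sqrt \<epsilon>)) * (\<rho> + 4 * sqrt \<epsilon>) ^ n))"
proof -
  interpret fem: fem_partition \<Omega> \<T> D \<kappa> p f
    using domain(1) mesh kappa f wellposed partition by unfold_locales
  interpret dd: domain_decomposition VO VG VS A T l B R P
    unfolding spaces operators using T P unfolding spaces by (rule fem.decomposes)
  have eqs: "Rs = dd.Rs" "Bs = dd.Bs"
    unfolding dd.Rs_def dd.Bs_def by (fact operators)+
  have RTR': "RTR = dd.RTR" by (simp add: RTR dd.RTR_def eqs)
  have M': "M = dd.M"
    by (simp add: M dd.M_def eqs fun_eq_iff pointwise)
  have Pex': "Pex = dd.Pex" by (simp add: Pex dd.Pex_def eqs RTR' fun_eq_iff pointwise)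
  have S': "S = dd.S" by (simp add: S dd.S_def eqs M' fun_eq_iff pointwise)
  have g': "g = dd.g" by (simp add: g dd.g_def M' fun_eq_iff pointwise)
  have zero: "(\<lambda>_. 0) = (0 :: ('i \<times> 'a \<Rightarrow> complex) \<Rightarrow> complex)" "(\<lambda>_. 0) = (0 :: 'a \<Rightarrow> complex)"
    by (simp_all add: zero_fun_def)
  have iter_q': "qt (Suc n) = complex_of_real (1 - \<alpha>) *\<^sub>c qt n + complex_of_real \<alpha> *\<^sub>c dd.S (qt n)
            - (2 * complex_of_real \<alpha>) *\<^sub>c T (R (pt (Suc n))) + complex_of_real \<alpha> *\<^sub>c dd.g" for n
    unfolding iter_q S' g' by (simp add: fun_eq_iff pointwise)
  have iter_p': "pt (Suc n) = pcg VS dd.RTR P k (pt n) (dd.Rs (dd.S (qt n)))" for n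
    unfolding iter_p RTR' eqs S' ..
  have rho': "\<rho> = (SUP q\<in>dual VG - {0}.
      N (complex_of_real (1 - \<alpha>) *\<^sub>c q - complex_of_real \<alpha> *\<^sub>c dd.Pex (dd.S q)) / N q)"
    unfolding rho Pex' S' zero by (simp add: cscale_def fun_diff_def)
  have gamma': "\<gamma> = (INF q\<in>dual VG - {0}. N (q + dd.Pex (dd.S q)) / N q)"
    unfolding gamma Pex' S' zero by (simp add: plus_fun_def)
  have eps': "\<epsilon> = 2 * ((sqrt (cond_on VS (\<lambda>v. P (dd.RTR v))) - 1)
                      / (sqrt (cond_on VS (\<lambda>v. P (dd.RTR v))) + 1)) ^ k"
    unfolding eps RTR' ..
  note main = dd.recycled_pcg_Richardson[OF k alpha init[unfolded zero] iter_p' iter_q' norm_def rho' gamma' eps' eps_small]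
  obtain z where z: "z \<in> dual VG" "\<forall>q\<in>dual VG. q + dd.Pex (dd.S q) = dd.g \<longleftrightarrow> q = z"
    "\<And>n. N (qt n - z) \<le> N (qt 1) / (1 - (\<rho> + 2 * sqrt \<epsilon>)) * (\<rho> + 2 * sqrt \<epsilon>) ^ n"
    using main(6) by blast
  define \<mu>2 where "\<mu>2 = \<rho> + 2 * sqrt \<epsilon>"
  define \<mu>4 where "\<mu>4 = \<rho> + 4 * sqrt \<epsilon>"
  have \<mu>: "0 \<le> \<mu>2" "\<mu>2 < 1" "\<mu>2 \<le> \<mu>4" using main(1-3) by (simp_all add: \<mu>2_def \<mu>4_def)
  have bound: "N (qt n - z) \<le> N (qt 1) / (1 - \<mu>2) * \<mu>2 ^ n" for n
    using z(3) by (simp add: \<mu>2_def)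
  have N1: "0 \<le> N (qt 1)" unfolding norm_def by (intro dd.dual_norm_nonneg main(5))
  \<comment> \<open>the bound increases with the rate\<close>
  have bound4: "N (qt n - z) \<le> N (qt 1) / (1 - \<mu>4) * \<mu>4 ^ n" if "\<mu>4 < 1" for n
  proof -
    have "N (qt 1) / (1 - \<mu>2) * \<mu>2 ^ n \<le> N (qt 1) / (1 - \<mu>4) * \<mu>4 ^ n"
      using N1 \<mu> that by (intro mult_mono divide_left_mono power_mono mult_pos_pos divide_nonneg_nonneg) auto
    then show ?thesis using bound[of n] by simp
  qed
  have nonneg: "0 \<le> N (qt n - z)" for n
    unfolding norm_def by (intro dd.dual_norm_nonneg fun_vs.subspace_diff[OF subspace_dual] main(5) z(1))
  have "(\<lambda>n. N (qt n - z)) \<longlonglongrightarrow> 0"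
  proof (rule tendsto_sandwich[OF _ _ tendsto_const])
    show "\<forall>\<^sub>F n in sequentially. 0 \<le> N (qt n - z)" using nonneg by simp
    show "\<forall>\<^sub>F n in sequentially. N (qt n - z) \<le> N (qt 1) / (1 - \<mu>2) * \<mu>2 ^ n" using bound by simp
    show "(\<lambda>n. N (qt 1) / (1 - \<mu>2) * \<mu>2 ^ n) \<longlonglongrightarrow> 0"
      using \<mu> by (intro tendsto_mult_right_zero LIMSEQ_power_zero) simp
  qed
  then have "z \<in> dual VG \<and> (\<forall>q\<in>dual VG. q + dd.Pex (dd.S q) = dd.g \<longleftrightarrow> q = z) \<and>
    (\<lambda>n. N (qt n - z)) \<longlonglongrightarrow> 0 \<and>
    (\<mu>2 < 1 \<and> (\<forall>n. N (qt n - z) \<le> N (qt 1) / (1 - \<mu>2) * \<mu>2 ^ n)) \<and>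
    (\<epsilon> < (\<alpha> * (1 - \<alpha>) * \<gamma>\<^sup>2 / 8)\<^sup>2 \<longrightarrow> \<mu>4 < 1) \<and>
    (\<mu>4 < 1 \<longrightarrow> (\<forall>n. N (qt n - z) \<le> N (qt 1) / (1 - \<mu>4) * \<mu>4 ^ n))"
    using z(1,2) \<mu>(2) bound bound4 main(4) unfolding \<mu>4_def by blast
  then show ?thesis
    unfolding Pex' S' g' \<mu>2_def \<mu>4_def plus_fun_def fun_diff_def by blast
qed

end
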